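(* Let $q$ be a prime power, $R=\mathbb{F}_q+u\mathbb{F}_q=\mathbb{F}_q[u]/(u^2)$, and let $\mathcal{C}$ be a linear code over $R$ with generator matrix $G$ having $k$ rows. Write $GG^T=A_0+uA_1$ with $A_0,A_1\in M_k(\mathbb{F}_q)$, let $m=\nu(GG^T)$ and assume $m>0$. Suppose that the rows of $\tilde G=[G\mid B_*]$ generate a shortest self-orthogonal embedding of $\mathcal{C}$, where $B_*=X_*+uY_*$ with $X_*,Y_*\in M_{k\times m}(\mathbb{F}_q)$. Let $$\Gamma=\{P\in GL_k(\mathbb{F}_q) : PA_0P^T=A_0\text{ and }\mathbf{u}A_1\mathbf{v}^T=0\text{ for all }\mathbf{u},\mathbf{v}\in(\ker X_* )P^{-1}\},$$ and for each $P\in\Gamma$ fix a matrix $S_P\in M_{k\times m}(\mathbb{F}_q)$ with $\varphi_{PX_*}(S_P)=PA_1P^T-A_1$ (such a matrix exists for every $P\in\Gamma$). Then a code $\mathcal{C}'$ is a shortest self-orthogonal embedding of $\mathcal{C}$ if and only if $\mathcal{C}'$ is generated by the rows of a matrix $$G'=[\,G\mid (PX_*+u(PY_*+S_P+PH))Q\,]$$ for some $P\in\Gamma$, $H\in\ker\varphi_{X_*}$ and $Q\in O_m(\mathbb{F}_q)$.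
   Context: A linear code of length $n$ over $R$ is an $R$-submodule of $R^n$. A generator matrix $G$ of $\mathcal{C}$ is a matrix whose rows $\mathbf{c}_1,\dots,\mathbf{c}_{k_1}\in R^n\setminus(uR)^n$ and $\mathbf{c}_{k_1+1},\dots,\mathbf{c}_{k_1+k_2}\in(uR)^n$ are codewords such that every codeword has a unique representation $\sum_{i=1}^{k_1}a_i\mathbf{c}_i+\sum_{j=k_1+1}^{k_1+k_2}b_j\mathbf{c}_j$ with $a_i\in R$, $b_j\in\mathbb{F}_q$. A code over $R$ is self-orthogonal if $\mathbf{x}\cdot\mathbf{y}=0$ (standard dot product) for all its codewords $\mathbf{x},\mathbf{y}$. A self-orthogonal embedding of $\mathcal{C}$ is a self-orthogonal code over $R$ generated by the rows of $[G\mid B]$ for some matrix $B$ over $R$; a shortest self-orthogonal embedding is one of smallest length among all of them. For a symmetric $k\times k$ matrix $A$ over $R$, $\nu(A)=0$ if $A=\mathcal{O}$, and otherwise $\nu(A)$ is the least $m>0$ such that $A+BB^T=\mathcal{O}$ for some $B\in M_{k\times m}(R)$ ($\infty$ if there is none). The number of columns appended in a shortest self-orthogonal embedding of $\mathcal{C}$ is $\nu(GG^T)$, which is finite. For $X\in M_{k\times m}(\mathbb{F}_q)$: $\ker X=\{\mathbf{x}\in\mathbb{F}_q^k : \mathbf{x}X=\mathbf{0}\}$, $(\ker X)P^{-1}=\{\mathbf{x}P^{-1} : \mathbf{x}\in\ker X\}$, and $\varphi_X:M_{k\times m}(\mathbb{F}_q)\to\operatorname{Sym}_k(\mathbb{F}_q)$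 is the linear map $\varphi_X(Y)=XY^T+YX^T$. $O_m(\mathbb{F}_q)=\{Q\in M_m(\mathbb{F}_q) : QQ^T=I_m\}$. *)

theory Defs
  imports
    "Jordan_Normal_Form.VS_Connect"
    "Jordan_Normal_Form.Gauss_Jordan_Elimination"
    "HOL-Computational_Algebra.Polynomial"
    "HOL-Library.Extended_Nat"
begin


section \<open>The ring $F + uF = F[u]/(u^2)$\<close>

quotient_type (overloaded) 'a dual =
  "'a::field poly" / "\<lambda>p q. (monom 1 2 :: 'a poly) dvd p - q"
proof (rule equivpI)
  show "reflp (\<lambda>p q::'a poly. monom 1 2 dvd p - q)"
    by (simp add: reflp_def)
  show "symp (\<lambda>p q::'a poly. monom 1 2 dvd p - q)"
    using dvd_diff_commute by (auto simp: symp_def)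
  show "transp (\<lambda>p q::'a poly. monom 1 2 dvd p - q)"
  proof (rule transpI)
    fix p q r :: "'a poly"
    assume "monom 1 2 dvd p - q" "monom 1 2 dvd q - r"
    then have "monom 1 2 dvd (p - q) + (q - r)" by (rule dvd_add)
    then show "monom 1 2 dvd p - r" by simp
  qed
qed

instantiation dual :: (field) comm_ring_1
begin

lift_definition zero_dual :: "'a dual" is 0 .

lift_definition one_dual :: "'a dual" is 1 .

lift_definition plus_dual :: "'a dual \<Rightarrow> 'a dual \<Rightarrow> 'a dual" is "(+)"
  unfolding add_diff_add by (rule dvd_add)

lift_definition minus_dual :: "'a dual \<Rightarrow> 'a dual \<Rightarrow> 'a dual" is "(-)"
proof -
  fix p q r s :: "'a poly"
  assume "monom 1 2 dvd p - q" "monom 1 2 dvd r - s"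
  then have "monom 1 2 dvd (p - q) - (r - s)" by (rule dvd_diff)
  then show "monom 1 2 dvd p - r - (q - s)" by (simp add: algebra_simps)
qed

lift_definition uminus_dual :: "'a dual \<Rightarrow> 'a dual" is uminus
  unfolding minus_diff_minus dvd_minus_iff .

lift_definition times_dual :: "'a dual \<Rightarrow> 'a dual \<Rightarrow> 'a dual" is "(*)"
proof -
  fix p q r s :: "'a poly"
  assume "monom 1 2 dvd p - q" "monom 1 2 dvd r - s"
  then have "monom 1 2 dvd (p - q) * r + q * (r - s)" by simp
  then show "monom 1 2 dvd p * r - q * s" by (simp add: algebra_simps)
qed

instance
proof
  have "\<not> monom 1 2 dvd (1::'a poly)"
    using monom_1_dvd_iff'[of 2 "1::'a poly"] by (auto intro!: exI[of _ 0])
  then show "(0::'a dual) \<noteq> 1"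
    by transfer simp
qed (transfer; simp add: algebra_simps)+

end

lift_definition scal :: "'a::field \<Rightarrow> 'a dual" is "\<lambda>a. [:a:]" .

lift_definition dual_u :: "'a::field dual" is "[:0, 1:]" .

lemma u_times_u: "dual_u * dual_u = (0 :: 'a::field dual)"
  by transfer (simp add: monom_altdef power2_eq_square)

lemma dual_decomposition: "\<exists>!(a, b). (x :: 'a::field dual) = scal a + dual_u * scal b"
proof -
  have dvd_iff: "monom 1 2 dvd p \<longleftrightarrow> coeff p 0 = 0 \<and> coeff p 1 = 0" for p :: "'a poly"
    by (auto simp: monom_1_dvd_iff' numeral_2_eq_2 less_Suc_eq)
  have "\<exists>a b. x = scal a + dual_u * scal b"
  proof (transfer)
    fix p :: "'a poly"
    show "\<exists>a b. monom 1 2 dvd p - ([:a:] + [:0, 1:] * [:b:])"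
      by (rule exI[of _ "coeff p 0"], rule exI[of _ "coeff p 1"]) (simp add: dvd_iff)
  qed
  then obtain a b where ab: "x = scal a + dual_u * scal b" by blast
  have "a = c \<and> b = d" if "scal a + dual_u * scal b = scal c + dual_u * scal d" for a b c d :: 'a
    using that by transfer (simp add: dvd_iff)
  then show ?thesis
    by (intro ex1I[of _ "(a, b)"]) (auto simp: ab)
qed

text \<open>The matrix $X + uY$ over $F + uF$.\<close>

definition dual_mat :: "'a::field mat \<Rightarrow> 'a mat \<Rightarrow> 'a dual mat" where
  "dual_mat X Y = map_mat scal X + dual_u \<cdot>\<^sub>m map_mat scal Y"

section \<open>Linear codes and self-orthogonal embeddings\<close>

definition linear_code :: "nat \<Rightarrow> 'a::field dual vec set \<Rightarrow> bool" where
  "linear_code n C \<longleftrightarrow>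
     LinearCombinations.submodule class_ring C (module_vec TYPE('a dual) n)"

definition generated_code :: "'a::field dual mat \<Rightarrow> 'a dual vec set" where
  "generated_code A =
     LinearCombinations.module.span class_ring (module_vec TYPE('a dual) (dim_col A)) (set (rows A))"

text \<open>The set $(uR)^n$.\<close>

definition u_vecs :: "nat \<Rightarrow> 'a::field dual vec set" where
  "u_vecs n = {v \<in> carrier_vec n. \<forall>i<n. \<exists>r. v $ i = dual_u * r}"

definition generator_matrix :: "nat \<Rightarrow> nat \<Rightarrow> 'a::field dual vec set \<Rightarrow> 'a dual mat \<Rightarrow> bool" where
  "generator_matrix n k C G \<longleftrightarrow>
     G \<in> carrier_mat k n \<and> set (rows G) \<subseteq> C \<and>
     (\<exists>k1 k2. k = k1 + k2 \<and>
        (\<forall>i<k1. row G i \<notin> u_vecs n) \<and>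
        (\<forall>j\<in>{k1..<k1 + k2}. row G j \<in> u_vecs n) \<and>
        (\<forall>c\<in>C. \<exists>!(a, b). a \<in> carrier_vec k1 \<and> b \<in> carrier_vec k2 \<and>
           c = finsum_vec TYPE('a dual) n (\<lambda>i. a $ i \<cdot>\<^sub>v row G i) {..<k1} +
               finsum_vec TYPE('a dual) n (\<lambda>j. scal (b $ j) \<cdot>\<^sub>v row G (k1 + j)) {..<k2}))"

definition self_orthogonal :: "'a::field dual vec set \<Rightarrow> bool" where
  "self_orthogonal C \<longleftrightarrow> (\<forall>x\<in>C. \<forall>y\<in>C. x \<bullet> y = 0)"

text \<open>The block matrix $[A \mid B]$.\<close>

definition hblock :: "'a::zero mat \<Rightarrow> 'a mat \<Rightarrow> 'a mat" where
  "hblock A B = four_block_mat A B (0\<^sub>m 0 (dim_col A)) (0\<^sub>m 0 (dim_col B))"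

text \<open>\<open>C'\<close> is a self-orthogonal embedding, of length \<open>l\<close>, of the code with generator matrix \<open>G\<close>.\<close>

definition self_orthogonal_embedding ::
    "'a::field dual mat \<Rightarrow> nat \<Rightarrow> 'a dual vec set \<Rightarrow> bool" where
  "self_orthogonal_embedding G l C' \<longleftrightarrow>
     (\<exists>B. dim_row B = dim_row G \<and> l = dim_col G + dim_col B \<and>
          C' = generated_code (hblock G B)) \<and>
     self_orthogonal C'"

definition shortest_self_orthogonal_embedding ::
    "'a::field dual mat \<Rightarrow> 'a dual vec set \<Rightarrow> bool" where
  "shortest_self_orthogonal_embedding G C' \<longleftrightarrow>
     (\<exists>l. self_orthogonal_embedding G l C' \<and>
          (\<forall>l' C''. self_orthogonal_embedding G l' C'' \<longrightarrow> l \<le> l'))"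

text \<open>The infimum of the empty set is \<open>\<infinity>\<close>.\<close>

definition nu :: "'a::field dual mat \<Rightarrow> enat" where
  "nu A =
     (let k = dim_row A in
      if A = 0\<^sub>m k k then 0
      else Inf {enat m | m. m > 0 \<and> (\<exists>B\<in>carrier_mat k m. A + B * transpose_mat B = 0\<^sub>m k k)})"

section \<open>Matrices over $F$\<close>

text \<open>The product $xX$ of the row vector \<open>x\<close> with the matrix \<open>X\<close>.\<close>

definition row_mult :: "'a::field vec \<Rightarrow> 'a mat \<Rightarrow> 'a vec" where
  "row_mult x X = transpose_mat X *\<^sub>v x"

definition left_kernel :: "'a::field mat \<Rightarrow> 'a vec set" where
  "left_kernel X = {x \<in> carrier_vec (dim_row X). row_mult x X = 0\<^sub>v (dim_col X)}"

definition phi :: "'a::field mat \<Rightarrow> 'a mat \<Rightarrow> 'a mat" where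
  "phi X Y = X * transpose_mat Y + Y * transpose_mat X"

definition ker_phi :: "'a::field mat \<Rightarrow> 'a mat set" where
  "ker_phi X = {Y \<in> carrier_mat (dim_row X) (dim_col X). phi X Y = 0\<^sub>m (dim_row X) (dim_row X)}"

definition general_linear_group :: "nat \<Rightarrow> 'a::field mat set" where
  "general_linear_group k = {P \<in> carrier_mat k k. invertible_mat P}"

definition orthogonal_group :: "nat \<Rightarrow> 'a::field mat set" where
  "orthogonal_group m = {Q \<in> carrier_mat m m. Q * transpose_mat Q = 1\<^sub>m m}"

definition Gamma_set :: "nat \<Rightarrow> 'a::field mat \<Rightarrow> 'a mat \<Rightarrow> 'a mat \<Rightarrow> 'a mat set" where
  "Gamma_set k A0 A1 X =
     {P \<in> general_linear_group k.
        P * A0 * transpose_mat P = A0 \<and>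
        (let K = (\<lambda>x. row_mult x (the (mat_inverse P))) ` left_kernel X
         in \<forall>v\<in>K. \<forall>w\<in>K. v \<bullet> (A1 *\<^sub>v w) = 0)}"

end

theory Submission
  imports Defs
begin

text \<open>
  Write an embedding as \<open>[G | X + uY]\<close>. It is self-orthogonal iff \<open>X X\<^sup>T = -A\<^sub>0\<close> and \<open>phi X Y = -A\<^sub>1\<close>, and
  \<open>-A\<^sub>1\<close> lies in the image of \<open>phi X\<close> as soon as it vanishes on the left kernel of \<open>X\<close>. Hence a shortest
  embedding yields an \<open>X\<close> that is incompressible: no matrix with fewer columns has the same Gram matrix
  \<open>X X\<^sup>T\<close> and a left kernel contained in that of \<open>X\<close>. The heart of the matter is that two incompressible
  matrices \<open>X\<close>, \<open>X'\<close> with the same Gram matrix satisfy \<open>X' = P X Q\<close> with \<open>P\<close> invertible and \<open>Q\<close> orthogonal.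
  Transvections preserving the Gram matrix make the left kernels comparable; if one were strictly larger,
  an isotropic vector of the row space orthogonal to it could be divided out, contradicting
  incompressibility. Once the kernels agree, Witt's extension theorem provides \<open>Q\<close>. In characteristic \<open>2\<close>
  an isometry extends only if it respects the all-ones vector \<open>1\<close>; incompressibility forces either
  \<open>1\<close> to lie in the row space or \<open>1\<close> to be orthogonal to it, and in both cases the isometry can be adjusted.
  Given \<open>X' = P X Q\<close>, membership \<open>P \<in> \<Gamma>\<close> and the shape of \<open>Y'\<close> are linear algebra.

  Up to the last step the matrices are transposed, so that they act on column vectors.
\<close>


text \<open>The scalar product may be degenerate on the row space, so the Gram matrix does not
  determine the left kernel; this is why transvections must align the kernels before any isometry
  between the row spaces can be formed. In characteristic 2 the norm \<open>x \<bullet> x\<close> is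
  the square of the linear form \<open>x \<bullet> ones m\<close>, so an orthogonal matrix must fix
  \<open>ones m\<close>, and, squares being injective, the Gram matrix determines this form on the
  range. The same vector appears in the reduction of rows for another reason: a vector
  \<open>v\<close> of norm 1 orthogonal to the range is moved to the unit vector of coordinate
  \<open>j\<close> along their difference, which works as soon as \<open>v $ j \<noteq> 1\<close>,
  so the one vector that escapes is \<open>v = ones m\<close>. Both roles together give the
  dichotomy for incompressible matrices. Halving is impossible in characteristic 2, so the image of
  \<open>phi\<close> is described for matrices of the shape \<open>N + N\<^sup>T\<close>, a shape
  inherited from a solution that is already known. Over a finite field, cardinalities of sets of
  vectors take the place of dimensions as induction measures.\<close>

section \<open>Extensionality of vectors and matrices, adjoints\<close>

lemma mat_eq_by_vecI:
  fixes A B :: "'a::semiring_1 mat"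
  assumes A: "A \<in> carrier_mat m k" and B: "B \<in> carrier_mat m k"
    and eq: "\<And>v. v \<in> carrier_vec k \<Longrightarrow> A *\<^sub>v v = B *\<^sub>v v"
  shows "A = B"
proof (rule eq_matI)
  fix i j assume "i < dim_row B" "j < dim_col B"
  then have ij: "i < m" "j < k" using B by auto
  have "(A *\<^sub>v unit_vec k j) $ i = (B *\<^sub>v unit_vec k j) $ i" using eq by simp
  then show "A $$ (i, j) = B $$ (i, j)" using ij A B by simp
qed (use A B in auto)

lemma finite_carrier_vec: "finite (carrier_vec n :: 'a::finite vec set)"
proof (rule finite_subset)
  show "(carrier_vec n :: 'a vec set) \<subseteq> vec_of_list ` {xs. set xs \<subseteq> UNIV \<and> length xs = n}"
  proof
    fix v :: "'a vec" assume "v \<in> carrier_vec n"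
    then have "v = vec_of_list (list_of_vec v)" "length (list_of_vec v) = n" by (auto simp: vec_list)
    then show "v \<in> vec_of_list ` {xs. set xs \<subseteq> UNIV \<and> length xs = n}" by blast
  qed
  show "finite (vec_of_list ` {xs :: 'a list. set xs \<subseteq> UNIV \<and> length xs = n})"
    by (intro finite_imageI finite_lists_length_eq) simp
qed

lemma mult_mat_vec_zero: "A \<in> carrier_mat m k \<Longrightarrow> A *\<^sub>v 0\<^sub>v k = (0\<^sub>v m :: 'a::semiring_0 vec)"
  by (intro eq_vecI) auto

lemma scalar_prod_transpose:
  fixes X :: "'a::comm_semiring_0 mat"
  assumes "X \<in> carrier_mat m k" "a \<in> carrier_vec k" "y \<in> carrier_vec m"
  shows "(X\<^sup>T *\<^sub>v y) \<bullet> a = y \<bullet> (X *\<^sub>v a)" "a \<bullet> (X\<^sup>T *\<^sub>v y) = (X *\<^sub>v a) \<bullet> y"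
proof -
  show 1: "(X\<^sup>T *\<^sub>v y) \<bullet> a = y \<bullet> (X *\<^sub>v a)"
    by (rule transpose_vec_mult_scalar[OF assms])
  show "a \<bullet> (X\<^sup>T *\<^sub>v y) = (X *\<^sub>v a) \<bullet> y"
    using 1 assms by (metis comm_scalar_prod mult_mat_vec_carrier transpose_carrier_mat)
qed

lemma eq_vec_by_scalar_prodI:
  fixes x y :: "'a::semiring_1 vec"
  assumes "x \<in> carrier_vec k" "y \<in> carrier_vec k" "\<And>a. a \<in> carrier_vec k \<Longrightarrow> x \<bullet> a = y \<bullet> a"
  shows "x = y"
proof (rule eq_vecI)
  fix i assume "i < dim_vec y"
  then show "x $ i = y $ i" using assms(3)[of "unit_vec k i"] assms(1,2) by simp
qed (use assms in auto)

section \<open>Generalised inverses\<close>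

definition rank_one :: "'a::semiring_0 vec \<Rightarrow> 'a vec \<Rightarrow> 'a mat" where
  "rank_one x y = mat (dim_vec x) (dim_vec y) (\<lambda>(i, j). x $ i * y $ j)"

lemma rank_one_carrier [simp]:
  "x \<in> carrier_vec m \<Longrightarrow> y \<in> carrier_vec k \<Longrightarrow> rank_one x y \<in> carrier_mat m k"
  by (auto simp: rank_one_def)

lemma rank_one_mult_vec:
  fixes x y :: "'a::comm_semiring_0 vec"
  assumes "y \<in> carrier_vec k" "v \<in> carrier_vec k"
  shows "rank_one x y *\<^sub>v v = (y \<bullet> v) \<cdot>\<^sub>v x"
proof (rule eq_vecI)
  fix i assume "i < dim_vec ((y \<bullet> v) \<cdot>\<^sub>v x)"
  then have i: "i < dim_vec x" by simp
  have "(rank_one x y *\<^sub>v v) $ i = (\<Sum>j = 0..<k. (x $ i * y $ j) * v $ j)"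
    using i assms by (simp add: rank_one_def scalar_prod_def)
  also have "\<dots> = x $ i * (\<Sum>j = 0..<k. y $ j * v $ j)"
    by (simp add: sum_distrib_left mult.assoc)
  finally show "(rank_one x y *\<^sub>v v) $ i = ((y \<bullet> v) \<cdot>\<^sub>v x) $ i"
    using i assms by (simp add: scalar_prod_def mult.commute)
qed (simp add: rank_one_def)

text \<open>Elimination with a nonzero pivot \<open>X $$ (i, j)\<close>: subtracting a rank-one
  matrix clears row \<open>i\<close> and keeps zero rows zero, so the number of nonzero rows drops
  and a generalised inverse of the remainder can be corrected to one of \<open>X\<close>.\<close>

lemma generalized_inverse_vec:
  fixes X :: "'a::field mat"
  assumes "X \<in> carrier_mat m k"
  shows "\<exists>T\<in>carrier_mat k m. \<forall>a\<in>carrier_vec k. X *\<^sub>v (T *\<^sub>v (X *\<^sub>v a)) = X *\<^sub>v a"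
  using assms
proof (induction "card {i. i < m \<and> row X i \<noteq> 0\<^sub>v k}" arbitrary: X rule: less_induct)
  case less
  note X = less.prems
  have dim: "dim_row X = m" "dim_col X = k" using X by auto
  show ?case
  proof (cases "\<exists>i<m. \<exists>j<k. X $$ (i, j) \<noteq> 0")
    case False
    then have "X = 0\<^sub>m m k" using dim by (intro eq_matI) auto
    then have "X *\<^sub>v v = 0\<^sub>v m" if "v \<in> carrier_vec k" for v using that by auto
    moreover have "0\<^sub>m k m *\<^sub>v w \<in> carrier_vec k" for w :: "'a vec" by (rule carrier_vecI) simp
    ultimately show ?thesis by (intro bexI[of _ "0\<^sub>m k m"]) auto
  next
    case True
    then obtain i j where i: "i < m" and j: "j < k" and nz: "X $$ (i, j) \<noteq> 0" by blast
    define p where "p = inverse (X $$ (i, j))"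
    define X' where "X' = X - rank_one (p \<cdot>\<^sub>v col X j) (row X i)"
    have r: "row X i \<in> carrier_vec k" and c: "col X j \<in> carrier_vec m" using X i j by auto
    have X': "X' \<in> carrier_mat m k" using r c unfolding X'_def by (intro minus_carrier_mat rank_one_carrier) auto
    have entry: "X' $$ (s, t) = X $$ (s, t) - X $$ (s, j) * p * X $$ (i, t)" if "s < m" "t < k" for s t
      using that dim j i by (simp add: X'_def rank_one_def)
    have X'_row: "row X' i = 0\<^sub>v k"
      using i j nz X' entry by (intro eq_vecI) (auto simp: p_def)
    have X'_row0: "row X' s = 0\<^sub>v k" if "s < m" "row X s = 0\<^sub>v k" for s
    proof -
      have "X $$ (s, t) = 0" if "t < k" for t
        using arg_cong[OF \<open>row X s = 0\<^sub>v k\<close>, of "\<lambda>v. v $ t"] that \<open>s < m\<close> dim by simp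
      then show ?thesis using that entry j X' by (intro eq_vecI) auto
    qed
    have "row X i \<noteq> 0\<^sub>v k"
      using nz i j dim by (metis index_row(1) index_zero_vec(1))
    then have "{s. s < m \<and> row X' s \<noteq> 0\<^sub>v k} \<subset> {s. s < m \<and> row X s \<noteq> 0\<^sub>v k}"
      using X'_row X'_row0 i by blast
    then have "card {s. s < m \<and> row X' s \<noteq> 0\<^sub>v k} < card {s. s < m \<and> row X s \<noteq> 0\<^sub>v k}"
      by (intro psubset_card_mono) auto
    from less.hyps[OF this X'] obtain T where T: "T \<in> carrier_mat k m"
      and TX: "\<And>a. a \<in> carrier_vec k \<Longrightarrow> X' *\<^sub>v (T *\<^sub>v (X' *\<^sub>v a)) = X' *\<^sub>v a"
      by blast
    let ?e = "p \<cdot>\<^sub>v unit_vec k j"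
    let ?F = "1\<^sub>m k - rank_one ?e (row X i)" and ?E = "1\<^sub>m m - rank_one (p \<cdot>\<^sub>v col X j) (unit_vec m i)"
    \<comment> \<open>With \<open>E\<close> and \<open>F\<close> for the two elimination matrices,
      \<open>E X = X' = X F\<close>. Hence \<open>X S X = X' T X'\<close> plus the subtracted
      rank-one matrix, and \<open>X' T X' = X'\<close>.\<close>
    define S where "S = ?F * (T * ?E) + rank_one ?e (unit_vec m i)"
    have F: "?F \<in> carrier_mat k k" and E: "?E \<in> carrier_mat m m" and D: "rank_one ?e (unit_vec m i) \<in> carrier_mat k m"
      using r c by (auto intro!: minus_carrier_mat rank_one_carrier)
    have TE: "T * ?E \<in> carrier_mat k m" using T E by (rule mult_carrier_mat)
    have S: "S \<in> carrier_mat k m" unfolding S_def using D by (rule add_carrier_mat)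
    have X'a: "X' *\<^sub>v a = X *\<^sub>v a - (p * (row X i \<bullet> a)) \<cdot>\<^sub>v col X j" if a: "a \<in> carrier_vec k" for a
      unfolding X'_def using a r c X
      by (subst minus_mult_distrib_mat_vec[of _ m k]) (auto simp: rank_one_mult_vec[of _ k] smult_smult_assoc mult.commute)
    have "X *\<^sub>v (S *\<^sub>v (X *\<^sub>v a)) = X *\<^sub>v a" if a: "a \<in> carrier_vec k" for a
    proof -
      define b where "b = T *\<^sub>v (X' *\<^sub>v a)"
      have b: "b \<in> carrier_vec k" using T X' a by (auto simp: b_def)
      have Xa: "X *\<^sub>v a \<in> carrier_vec m" and Xb: "X *\<^sub>v b \<in> carrier_vec m" using X a b by auto
      have "?E *\<^sub>v (X *\<^sub>v a) = X' *\<^sub>v a"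
        unfolding X'a[OF a] using Xa c i dim
        by (subst minus_mult_distrib_mat_vec[of _ m m]) (auto simp: rank_one_mult_vec[of _ m] smult_smult_assoc mult.commute)
      then have "S *\<^sub>v (X *\<^sub>v a) = ?F *\<^sub>v b + rank_one ?e (unit_vec m i) *\<^sub>v (X *\<^sub>v a)"
        unfolding S_def b_def using F T E D Xa TE
        by (subst add_mult_distrib_mat_vec[of _ k m]) (auto simp: assoc_mult_mat_vec[OF F TE] assoc_mult_mat_vec[OF T E] intro: mult_carrier_mat)
      also have "rank_one ?e (unit_vec m i) *\<^sub>v (X *\<^sub>v a) = (row X i \<bullet> a) \<cdot>\<^sub>v ?e"
        using Xa i dim by (subst rank_one_mult_vec[of _ m]) auto
      also have "?F *\<^sub>v b = b - (row X i \<bullet> b) \<cdot>\<^sub>v ?e"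
        using b r by (subst minus_mult_distrib_mat_vec[of _ k k]) (auto simp: rank_one_mult_vec[of _ k])
      finally have "X *\<^sub>v (S *\<^sub>v (X *\<^sub>v a)) = X *\<^sub>v (b - (row X i \<bullet> b) \<cdot>\<^sub>v ?e + (row X i \<bullet> a) \<cdot>\<^sub>v ?e)" by simp
      also have "\<dots> = X *\<^sub>v b - (row X i \<bullet> b) \<cdot>\<^sub>v (p \<cdot>\<^sub>v col X j) + (row X i \<bullet> a) \<cdot>\<^sub>v (p \<cdot>\<^sub>v col X j)"
      proof -
        have u: "X *\<^sub>v unit_vec k j = col X j" using dim j by (intro eq_vecI) auto
        show ?thesis using b X
          by (simp add: mult_add_distrib_mat_vec[of _ m k] mult_minus_distrib_mat_vec[of _ m k] mult_mat_vec[of _ m k] u)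
      qed
      also have "\<dots> = X' *\<^sub>v b + (p * (row X i \<bullet> a)) \<cdot>\<^sub>v col X j"
        unfolding X'a[OF b] using Xb c by (intro eq_vecI) (auto simp: ac_simps)
      also have "X' *\<^sub>v b = X' *\<^sub>v a" unfolding b_def by (rule TX[OF a])
      also have "X' *\<^sub>v a + (p * (row X i \<bullet> a)) \<cdot>\<^sub>v col X j = X *\<^sub>v a"
        unfolding X'a[OF a] using Xa c by (intro eq_vecI) auto
      finally show ?thesis .
    qed
    with S show ?thesis by blast
  qed
qed

lemma diff_vec_eq_zero_iff:
  fixes x y :: "'a::group_add vec"
  assumes "x \<in> carrier_vec n" "y \<in> carrier_vec n"
  shows "x - y = 0\<^sub>v n \<longleftrightarrow> x = y"
proof
  assume "x - y = 0\<^sub>v n"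
  then have "(x - y) $ i = 0" if "i < n" for i using that by simp
  then show "x = y" using assms by (intro eq_vecI) auto
qed (use assms in auto)

text \<open>For a generalised inverse \<open>T\<close> of \<open>X\<close>, the vector
  \<open>a - T X a\<close> lies in the kernel of \<open>X\<close>, hence in that of
  \<open>Y\<close>; so \<open>B = Y T\<close> works.\<close>

lemma factor_through_kernel:
  fixes X Y :: "'a::field mat"
  assumes X: "X \<in> carrier_mat m k" and Y: "Y \<in> carrier_mat l k"
    and ker: "\<And>a. a \<in> carrier_vec k \<Longrightarrow> X *\<^sub>v a = 0\<^sub>v m \<Longrightarrow> Y *\<^sub>v a = 0\<^sub>v l"
  obtains B where "B \<in> carrier_mat l m" and "\<And>a. a \<in> carrier_vec k \<Longrightarrow> Y *\<^sub>v a = B *\<^sub>v (X *\<^sub>v a)"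
proof -
  obtain T where T: "T \<in> carrier_mat k m"
    "\<And>a. a \<in> carrier_vec k \<Longrightarrow> X *\<^sub>v (T *\<^sub>v (X *\<^sub>v a)) = X *\<^sub>v a"
    using generalized_inverse_vec[OF X] by blast
  have "Y *\<^sub>v a = (Y * T) *\<^sub>v (X *\<^sub>v a)" if a: "a \<in> carrier_vec k" for a
  proof -
    have t: "T *\<^sub>v (X *\<^sub>v a) \<in> carrier_vec k" using T(1) X a by auto
    have "X *\<^sub>v (a - T *\<^sub>v (X *\<^sub>v a)) = 0\<^sub>v m"
      using t T(2)[OF a] a X by (simp add: mult_minus_distrib_mat_vec[of _ m k])
    then have "Y *\<^sub>v (a - T *\<^sub>v (X *\<^sub>v a)) = 0\<^sub>v l" using t a by (intro ker) auto
    then have "Y *\<^sub>v a - Y *\<^sub>v (T *\<^sub>v (X *\<^sub>v a)) = 0\<^sub>v l"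
      using t a Y by (simp add: mult_minus_distrib_mat_vec[of _ l k])
    moreover have "Y *\<^sub>v a \<in> carrier_vec l" "Y *\<^sub>v (T *\<^sub>v (X *\<^sub>v a)) \<in> carrier_vec l" using t a Y by auto
    ultimately have "Y *\<^sub>v a = Y *\<^sub>v (T *\<^sub>v (X *\<^sub>v a))"
      using diff_vec_eq_zero_iff by blast
    then show ?thesis using Y T(1) X a by (simp add: assoc_mult_mat_vec[of _ l k _ m])
  qed
  with that show thesis using mult_carrier_mat[OF Y T(1)] by blast
qed

text \<open>The Fredholm alternative, obtained by factoring the one-row matrix with row
  \<open>p\<close> through \<open>X\<close>.\<close>

lemma orthogonal_kernel_solvable:
  fixes X :: "'a::field mat"
  assumes X: "X \<in> carrier_mat m k" and p: "p \<in> carrier_vec k"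
    and ker: "\<And>a. a \<in> carrier_vec k \<Longrightarrow> X *\<^sub>v a = 0\<^sub>v m \<Longrightarrow> p \<bullet> a = 0"
  obtains y where "y \<in> carrier_vec m" and "p = X\<^sup>T *\<^sub>v y"
proof -
  let ?Y = "mat_of_row p"
  have Y: "?Y \<in> carrier_mat 1 k" using p by simp
  have Ya: "?Y *\<^sub>v a = vec 1 (\<lambda>_. p \<bullet> a)" for a
    by (intro eq_vecI) auto
  obtain B where B: "B \<in> carrier_mat 1 m" "\<And>a. a \<in> carrier_vec k \<Longrightarrow> ?Y *\<^sub>v a = B *\<^sub>v (X *\<^sub>v a)"
    using factor_through_kernel[OF X Y] ker Ya by (metis (no_types, lifting) eq_vecI dim_vec index_vec index_zero_vec)
  have "p = X\<^sup>T *\<^sub>v row B 0"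
  proof (rule eq_vec_by_scalar_prodI[OF p])
    show "X\<^sup>T *\<^sub>v row B 0 \<in> carrier_vec k" using X B by auto
    fix a :: "'a vec" assume a: "a \<in> carrier_vec k"
    have "p \<bullet> a = (?Y *\<^sub>v a) $ 0" by (simp add: Ya)
    also have "\<dots> = row B 0 \<bullet> (X *\<^sub>v a)" using B(1) B(2)[OF a] by simp
    also have "\<dots> = (X\<^sup>T *\<^sub>v row B 0) \<bullet> a"
      using X B(1) a by (subst scalar_prod_transpose[of _ m k]) auto
    finally show "p \<bullet> a = (X\<^sup>T *\<^sub>v row B 0) \<bullet> a" .
  qed
  moreover have "row B 0 \<in> carrier_vec m" using B(1) by auto
  ultimately show thesis using that by blast
qed

section \<open>Bilinearity, stated with dimension equations for the simplifier\<close>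

lemma scalar_prod_linear:
  fixes x y z :: "'a::comm_ring_1 vec"
  assumes "dim_vec y = dim_vec x" "dim_vec z = dim_vec x"
  shows "x \<bullet> (y + z) = x \<bullet> y + x \<bullet> z" "(y + z) \<bullet> x = y \<bullet> x + z \<bullet> x"
    and "x \<bullet> (y - z) = x \<bullet> y - x \<bullet> z" "(y - z) \<bullet> x = y \<bullet> x - z \<bullet> x"
  using assms
  by (auto simp: scalar_prod_def algebra_simps sum.distrib sum_subtractf)

lemma scalar_prod_smult:
  fixes x y :: "'a::comm_ring_1 vec"
  assumes "dim_vec y = dim_vec x"
  shows "x \<bullet> (c \<cdot>\<^sub>v y) = c * (x \<bullet> y)" "(c \<cdot>\<^sub>v x) \<bullet> y = c * (x \<bullet> y)"
  using assms by (auto simp: scalar_prod_def sum_distrib_left algebra_simps)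

lemma scalar_prod_commute:
  fixes x y :: "'a::comm_ring_1 vec"
  assumes "dim_vec x = dim_vec y"
  shows "x \<bullet> y = y \<bullet> x"
  using assms by (auto simp: scalar_prod_def mult.commute)

lemmas scalar_prod_simps = scalar_prod_linear scalar_prod_smult

lemma mult_mat_vec_linear:
  fixes A :: "'a::comm_ring_1 mat"
  assumes "dim_vec v = dim_col A" "dim_vec w = dim_col A"
  shows "A *\<^sub>v (v + w) = A *\<^sub>v v + A *\<^sub>v w" "A *\<^sub>v (v - w) = A *\<^sub>v v - A *\<^sub>v w"
  using assms by (auto intro!: eq_vecI simp: scalar_prod_linear)

lemma mult_mat_vec_smult:
  fixes A :: "'a::comm_ring_1 mat"
  assumes "dim_vec v = dim_col A"
  shows "A *\<^sub>v (c \<cdot>\<^sub>v v) = c \<cdot>\<^sub>v (A *\<^sub>v v)"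
  using assms by (auto intro!: eq_vecI simp: scalar_prod_smult)

lemmas mult_mat_vec_simps = mult_mat_vec_linear mult_mat_vec_smult

lemma mult_mat_vec_in_carrier: "A \<in> carrier_mat m k \<Longrightarrow> A *\<^sub>v v \<in> carrier_vec m"
  by (rule carrier_vecI) simp

lemma zero_smult_vec: "0 \<cdot>\<^sub>v v = (0\<^sub>v (dim_vec v) :: 'a::mult_zero vec)"
  by (intro eq_vecI) auto

section \<open>Orthogonal matrices\<close>

lemma orthogonal_group_carrier: "Q \<in> orthogonal_group m \<Longrightarrow> Q \<in> carrier_mat m m"
  by (simp add: orthogonal_group_def)

lemma orthogonal_group_left:
  assumes "Q \<in> orthogonal_group m"
  shows "Q\<^sup>T * Q = 1\<^sub>m m"
  using assms mat_mult_left_right_inverse[of Q m "Q\<^sup>T"] by (auto simp: orthogonal_group_def)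

lemma orthogonal_group_transpose: "Q \<in> orthogonal_group m \<Longrightarrow> Q\<^sup>T \<in> orthogonal_group m"
  using orthogonal_group_left[of Q m] by (auto simp: orthogonal_group_def)

lemma orthogonal_group_scalar_prod:
  assumes Q: "Q \<in> orthogonal_group m" and x: "x \<in> carrier_vec m" and y: "y \<in> carrier_vec m"
  shows "(Q *\<^sub>v x) \<bullet> (Q *\<^sub>v y) = x \<bullet> y"
proof -
  have c: "Q \<in> carrier_mat m m" using Q by (rule orthogonal_group_carrier)
  have "(Q *\<^sub>v x) \<bullet> (Q *\<^sub>v y) = x \<bullet> (Q\<^sup>T *\<^sub>v (Q *\<^sub>v y))"
    using c x y by (subst scalar_prod_transpose(2)[of Q m m]) auto
  also have "Q\<^sup>T *\<^sub>v (Q *\<^sub>v y) = (Q\<^sup>T * Q) *\<^sub>v y"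
    using c y by (intro assoc_mult_mat_vec[symmetric]) auto
  finally show ?thesis using orthogonal_group_left[OF Q] y by simp
qed

lemma orthogonal_groupI:
  fixes Q :: "'a::field mat"
  assumes Q: "Q \<in> carrier_mat m m"
    and pres: "\<And>x y. x \<in> carrier_vec m \<Longrightarrow> y \<in> carrier_vec m \<Longrightarrow> (Q *\<^sub>v x) \<bullet> (Q *\<^sub>v y) = x \<bullet> y"
  shows "Q \<in> orthogonal_group m"
proof -
  have "Q\<^sup>T * Q = 1\<^sub>m m"
  proof (rule mat_eq_by_vecI[of _ m m])
    fix v :: "'a vec" assume v: "v \<in> carrier_vec m"
    show "(Q\<^sup>T * Q) *\<^sub>v v = 1\<^sub>m m *\<^sub>v v"
    proof (rule eq_vec_by_scalar_prodI[of _ m])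
      fix a :: "'a vec" assume a: "a \<in> carrier_vec m"
      have "((Q\<^sup>T * Q) *\<^sub>v v) \<bullet> a = (Q\<^sup>T *\<^sub>v (Q *\<^sub>v v)) \<bullet> a"
        using Q v by (subst assoc_mult_mat_vec[of _ m m]) auto
      also have "\<dots> = (Q *\<^sub>v v) \<bullet> (Q *\<^sub>v a)"
        using Q v a by (intro scalar_prod_transpose(1)[of Q m m]) auto
      finally show "((Q\<^sup>T * Q) *\<^sub>v v) \<bullet> a = (1\<^sub>m m *\<^sub>v v) \<bullet> a" using pres v a by simp
    qed (use Q v in auto)
  qed (use Q in auto)
  then show ?thesis using Q mat_mult_left_right_inverse[of "Q\<^sup>T" m Q] by (auto simp: orthogonal_group_def)
qed

lemma orthogonal_group_mult:
  fixes Q R :: "'a::field mat"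
  assumes Q: "Q \<in> orthogonal_group m" and R: "R \<in> orthogonal_group m"
  shows "Q * R \<in> orthogonal_group m"
proof (rule orthogonal_groupI)
  note c = Q[THEN orthogonal_group_carrier] R[THEN orthogonal_group_carrier]
  show "Q * R \<in> carrier_mat m m" using c by (rule mult_carrier_mat)
  fix x y :: "'a vec" assume "x \<in> carrier_vec m" "y \<in> carrier_vec m"
  then show "((Q * R) *\<^sub>v x) \<bullet> ((Q * R) *\<^sub>v y) = x \<bullet> y"
    using c Q R by (simp add: assoc_mult_mat_vec[of _ m m] orthogonal_group_scalar_prod)
qed

lemma orthogonal_group_one: "1\<^sub>m m \<in> orthogonal_group m"
  by (simp add: orthogonal_group_def)

lemma orthogonal_group_inverse_vec:
  assumes Q: "Q \<in> orthogonal_group m" and x: "x \<in> carrier_vec m"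
  shows "Q\<^sup>T *\<^sub>v (Q *\<^sub>v x) = x"
proof -
  have "Q\<^sup>T *\<^sub>v (Q *\<^sub>v x) = (Q\<^sup>T * Q) *\<^sub>v x"
    using orthogonal_group_carrier[OF Q] x by (intro assoc_mult_mat_vec[symmetric]) auto
  then show ?thesis using orthogonal_group_left[OF Q] x by simp
qed

text \<open>\<open>v \<mapsto> v - (d \<bullet> v / (x \<bullet> d)) d\<close> with \<open>d = x - y\<close> is a reflection in odd characteristic and a
  transvection in characteristic \<open>2\<close>; it is orthogonal because \<open>d \<bullet> d = 2 (x \<bullet> d)\<close>.\<close>

lemma orthogonal_move:
  fixes x y :: "'a::field vec"
  assumes x: "x \<in> carrier_vec m" and y: "y \<in> carrier_vec m"
    and norm: "x \<bullet> x = y \<bullet> y" and neq: "x \<bullet> x \<noteq> x \<bullet> y"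
  obtains Q where "Q \<in> orthogonal_group m" "Q *\<^sub>v x = y"
    "\<And>z. z \<in> carrier_vec m \<Longrightarrow> z \<bullet> x = z \<bullet> y \<Longrightarrow> Q *\<^sub>v z = z"
proof -
  define d where "d = x - y"
  define e where "e = x \<bullet> x - x \<bullet> y"
  have e: "e \<noteq> 0" using neq by (simp add: e_def)
  have d: "d \<in> carrier_vec m" using x y by (simp add: d_def)
  have xd: "d \<bullet> x = e" using x y by (simp add: d_def e_def scalar_prod_simps scalar_prod_commute)
  have dd: "d \<bullet> d = 2 * e"
    using x y norm by (simp add: d_def e_def scalar_prod_simps scalar_prod_commute)
  define Q where "Q = 1\<^sub>m m - rank_one (inverse e \<cdot>\<^sub>v d) d"
  have Q: "Q \<in> carrier_mat m m" using d unfolding Q_def by (intro minus_carrier_mat rank_one_carrier) auto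
  have Qv: "Q *\<^sub>v v = v - ((d \<bullet> v) * inverse e) \<cdot>\<^sub>v d" if v: "v \<in> carrier_vec m" for v
    unfolding Q_def using d v
    by (subst minus_mult_distrib_mat_vec[of _ m m]) (auto simp: rank_one_mult_vec[of _ m] smult_smult_assoc)
  show thesis
  proof
    show "Q \<in> orthogonal_group m"
    proof (rule orthogonal_groupI[OF Q])
      fix v w :: "'a vec" assume v: "v \<in> carrier_vec m" and w: "w \<in> carrier_vec m"
      have "(Q *\<^sub>v v) \<bullet> (Q *\<^sub>v w) = v \<bullet> w - 2 * ((d \<bullet> v) * (d \<bullet> w) * inverse e)
          + (d \<bullet> v) * (d \<bullet> w) * inverse e * inverse e * (d \<bullet> d)"
        using v w d by (simp add: Qv scalar_prod_simps scalar_prod_commute[of v d] scalar_prod_commute[of w d] algebra_simps)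
      then show "(Q *\<^sub>v v) \<bullet> (Q *\<^sub>v w) = v \<bullet> w" using e by (simp add: dd)
    qed
    show "Q *\<^sub>v x = y" using x y e by (simp add: Qv xd) (auto simp: d_def intro!: eq_vecI)
    fix z assume z: "z \<in> carrier_vec m" "z \<bullet> x = z \<bullet> y"
    then have "d \<bullet> z = 0" using x y by (simp add: d_def scalar_prod_simps scalar_prod_commute[of x z] scalar_prod_commute[of y z])
    then show "Q *\<^sub>v z = z" using z d by (auto simp: Qv intro!: eq_vecI)
  qed
qed

text \<open>If \<open>x \<bullet> x = x \<bullet> y\<close>, the direct reflection breaks down, but
  those from \<open>x\<close> to \<open>-y\<close> and from \<open>-y\<close> to \<open>y\<close>
  exist, since a nonzero norm differs from its negative. Both fix every vector orthogonal to
  \<open>x\<close> and \<open>y\<close>.\<close>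

lemma orthogonal_move_odd:
  fixes x y :: "'a::field vec"
  assumes odd: "(2::'a) \<noteq> 0" and x: "x \<in> carrier_vec m" and y: "y \<in> carrier_vec m"
    and norm: "x \<bullet> x = y \<bullet> y" and nz: "x \<bullet> x \<noteq> 0"
  obtains Q where "Q \<in> orthogonal_group m" "Q *\<^sub>v x = y"
    "\<And>z. z \<in> carrier_vec m \<Longrightarrow> z \<bullet> x = 0 \<Longrightarrow> z \<bullet> y = 0 \<Longrightarrow> Q *\<^sub>v z = z"
proof (cases "x \<bullet> x = x \<bullet> y")
  case False
  from orthogonal_move[OF x y norm False] show thesis using that by metis
next
  case True
  define y' where "y' = (-1) \<cdot>\<^sub>v y"
  have y': "y' \<in> carrier_vec m" using y by (simp add: y'_def)
  have two: "c + c \<noteq> 0" if "c \<noteq> 0" for c :: 'a using that odd by (simp flip: mult_2)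
  have "x \<bullet> x = y' \<bullet> y'" "x \<bullet> x \<noteq> x \<bullet> y'"
    using x y norm nz True two[OF nz] by (auto simp: y'_def scalar_prod_simps eq_neg_iff_add_eq_0)
  from orthogonal_move[OF x y' this] obtain Q where Q: "Q \<in> orthogonal_group m" "Q *\<^sub>v x = y'"
    "\<And>z. z \<in> carrier_vec m \<Longrightarrow> z \<bullet> x = z \<bullet> y' \<Longrightarrow> Q *\<^sub>v z = z" by metis
  have "y' \<bullet> y' = y \<bullet> y" "y' \<bullet> y' \<noteq> y' \<bullet> y"
    using y norm nz two[OF nz] by (auto simp: y'_def scalar_prod_simps eq_neg_iff_add_eq_0)
  from orthogonal_move[OF y' y this] obtain R where R: "R \<in> orthogonal_group m" "R *\<^sub>v y' = y"
    "\<And>z. z \<in> carrier_vec m \<Longrightarrow> z \<bullet> y' = z \<bullet> y \<Longrightarrow> R *\<^sub>v z = z" by metis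
  note c = Q(1)[THEN orthogonal_group_carrier] R(1)[THEN orthogonal_group_carrier]
  show thesis
  proof
    show "R * Q \<in> orthogonal_group m" using R Q by (intro orthogonal_group_mult) auto
    show "(R * Q) *\<^sub>v x = y" using c x Q R by (simp add: assoc_mult_mat_vec[of _ m m])
    fix z assume z: "z \<in> carrier_vec m" "z \<bullet> x = 0" "z \<bullet> y = 0"
    then have "z \<bullet> y' = 0" using y by (simp add: y'_def scalar_prod_simps)
    then show "(R * Q) *\<^sub>v z = z" using c z Q R by (simp add: assoc_mult_mat_vec[of _ m m])
  qed
qed

section \<open>Witt's extension theorem\<close>

text \<open>Equality of \<open>X\<^sup>T X\<close> and \<open>Y\<^sup>T Y\<close>, written as
  equality of two forms on coefficient vectors. The numbers of rows may differ, as the reduction of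
  rows requires.\<close>

definition same_gram :: "'a::field mat \<Rightarrow> 'a mat \<Rightarrow> bool" where
  "same_gram X Y \<longleftrightarrow> (\<forall>a\<in>carrier_vec (dim_col X). \<forall>b\<in>carrier_vec (dim_col X).
     (X *\<^sub>v a) \<bullet> (X *\<^sub>v b) = (Y *\<^sub>v a) \<bullet> (Y *\<^sub>v b))"

text \<open>Exactly the condition under which \<open>X a \<mapsto> Y a\<close> is a well-defined
  linear map on the range of \<open>X\<close>. Together with \<open>same_gram\<close> it is an
  isometry; it is injective when the reverse inclusion holds too.\<close>

definition kernel_subset :: "'a::field mat \<Rightarrow> 'a mat \<Rightarrow> bool" where
  "kernel_subset X Y \<longleftrightarrow> (\<forall>a\<in>carrier_vec (dim_col X).
     X *\<^sub>v a = 0\<^sub>v (dim_row X) \<longrightarrow> Y *\<^sub>v a = 0\<^sub>v (dim_row Y))"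

lemma same_gramD:
  "same_gram X Y \<Longrightarrow> X \<in> carrier_mat m k \<Longrightarrow> a \<in> carrier_vec k \<Longrightarrow> b \<in> carrier_vec k \<Longrightarrow>
   (X *\<^sub>v a) \<bullet> (X *\<^sub>v b) = (Y *\<^sub>v a) \<bullet> (Y *\<^sub>v b)"
  by (auto simp: same_gram_def)

lemma kernel_subsetD:
  "kernel_subset X Y \<Longrightarrow> X \<in> carrier_mat m k \<Longrightarrow> Y \<in> carrier_mat l k \<Longrightarrow> a \<in> carrier_vec k \<Longrightarrow>
   X *\<^sub>v a = 0\<^sub>v m \<Longrightarrow> Y *\<^sub>v a = 0\<^sub>v l"
  by (auto simp: kernel_subset_def)

lemma same_gram_sym: "same_gram X Y \<Longrightarrow> dim_col X = dim_col Y \<Longrightarrow> same_gram Y X"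
  by (auto simp: same_gram_def)

lemma same_gram_mult:
  assumes gram: "same_gram X Y" and X: "X \<in> carrier_mat m k" and Y: "Y \<in> carrier_mat l k"
    and J: "J \<in> carrier_mat k j"
  shows "same_gram (X * J) (Y * J)"
proof -
  have "(X * J) *\<^sub>v v = X *\<^sub>v (J *\<^sub>v v)" "(Y * J) *\<^sub>v v = Y *\<^sub>v (J *\<^sub>v v)" if "v \<in> carrier_vec j" for v
    using assoc_mult_mat_vec[OF X J that] assoc_mult_mat_vec[OF Y J that] by auto
  then show ?thesis
    unfolding same_gram_def index_mult_mat(3) carrier_matD(2)[OF J]
    using same_gramD[OF gram X mult_mat_vec_in_carrier[OF J] mult_mat_vec_in_carrier[OF J]] by simp
qed

lemma kernel_subset_mult:
  assumes ker: "kernel_subset X Y" and X: "X \<in> carrier_mat m k" and Y: "Y \<in> carrier_mat l k"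
    and J: "J \<in> carrier_mat k j"
  shows "kernel_subset (X * J) (Y * J)"
proof -
  have "(X * J) *\<^sub>v v = X *\<^sub>v (J *\<^sub>v v)" "(Y * J) *\<^sub>v v = Y *\<^sub>v (J *\<^sub>v v)" if "v \<in> carrier_vec j" for v
    using assoc_mult_mat_vec[OF X J that] assoc_mult_mat_vec[OF Y J that] by auto
  then show ?thesis
    unfolding kernel_subset_def index_mult_mat(2,3) carrier_matD[OF J] carrier_matD[OF X] carrier_matD[OF Y]
    using kernel_subsetD[OF ker X Y mult_mat_vec_in_carrier[OF J]] by simp
qed

text \<open>Its cardinality plays the role of the codimension of the range in both extension
  theorems.\<close>

definition range_complement :: "'a::field mat \<Rightarrow> 'a vec set" where
  "range_complement X = {y \<in> carrier_vec (dim_row X). \<forall>a\<in>carrier_vec (dim_col X). y \<bullet> (X *\<^sub>v a) = 0}"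

text \<open>The double orthogonal complement of the range is the range: this is
  \<open>orthogonal_kernel_solvable\<close> for \<open>X\<^sup>T\<close>.\<close>

lemma in_rangeI:
  fixes X :: "'a::field mat"
  assumes X: "X \<in> carrier_mat m k" and z: "z \<in> carrier_vec m"
    and orth: "\<And>y. y \<in> range_complement X \<Longrightarrow> z \<bullet> y = 0"
  obtains a where "a \<in> carrier_vec k" "z = X *\<^sub>v a"
proof (rule orthogonal_kernel_solvable[of "X\<^sup>T" k m z])
  fix y :: "'a vec" assume y: "y \<in> carrier_vec m" and "X\<^sup>T *\<^sub>v y = 0\<^sub>v k"
  then have "y \<bullet> (X *\<^sub>v a) = 0" if "a \<in> carrier_vec k" for a
    using scalar_prod_transpose(1)[OF X that y] that by simp
  then show "z \<bullet> y = 0" using X y by (intro orth) (auto simp: range_complement_def)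
next
  show "X\<^sup>T \<in> carrier_mat k m" using X by simp
  fix a assume "a \<in> carrier_vec k" "z = X\<^sup>T\<^sup>T *\<^sub>v a"
  then show thesis using that by simp
qed (rule z)

text \<open>The functional \<open>Y a \<mapsto> z \<bullet> X a\<close> is well defined because of
  the kernel inclusion, and a functional on the range is represented by a vector. It yields the
  partner of \<open>z\<close> when an isometry is extended.\<close>

lemma dual_vector:
  fixes X Y :: "'a::field mat"
  assumes X: "X \<in> carrier_mat m k" and Y: "Y \<in> carrier_mat l k" and ker: "kernel_subset Y X"
    and z: "z \<in> carrier_vec m"
  obtains z' where "z' \<in> carrier_vec l" "\<And>a. a \<in> carrier_vec k \<Longrightarrow> z' \<bullet> (Y *\<^sub>v a) = z \<bullet> (X *\<^sub>v a)"
proof (rule orthogonal_kernel_solvable[OF Y, of "X\<^sup>T *\<^sub>v z"])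
  show "X\<^sup>T *\<^sub>v z \<in> carrier_vec k" using X z by auto
  fix a :: "'a vec" assume a: "a \<in> carrier_vec k" "Y *\<^sub>v a = 0\<^sub>v l"
  then have "X *\<^sub>v a = 0\<^sub>v m" using kernel_subsetD[OF ker Y X] by blast
  then show "(X\<^sup>T *\<^sub>v z) \<bullet> a = 0" using scalar_prod_transpose(1)[OF X a(1) z] z by simp
next
  fix z' assume z': "z' \<in> carrier_vec l" and eq: "X\<^sup>T *\<^sub>v z = Y\<^sup>T *\<^sub>v z'"
  have "z' \<bullet> (Y *\<^sub>v a) = z \<bullet> (X *\<^sub>v a)" if "a \<in> carrier_vec k" for a
    using scalar_prod_transpose(1)[OF X that z] scalar_prod_transpose(1)[OF Y that z'] eq by simp
  then show thesis using that z' by blast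
qed

text \<open>Adjoins \<open>z\<close> as a generator of the range. The new coefficient comes first,
  so that coefficient vectors have the form \<open>vCons t a\<close>.\<close>

definition prepend_col :: "'a vec \<Rightarrow> 'a mat \<Rightarrow> 'a mat" where
  "prepend_col z X = mat (dim_row X) (Suc (dim_col X)) (\<lambda>(i, j). case j of 0 \<Rightarrow> z $ i | Suc l \<Rightarrow> X $$ (i, l))"

lemma prepend_col_carrier [simp]:
  "X \<in> carrier_mat m k \<Longrightarrow> prepend_col z X \<in> carrier_mat m (Suc k)"
  by (auto simp: prepend_col_def)

lemma prepend_col_mult_vec:
  fixes X :: "'a::comm_ring_1 mat"
  assumes "X \<in> carrier_mat m k" "z \<in> carrier_vec m" "a \<in> carrier_vec k"
  shows "prepend_col z X *\<^sub>v vCons t a = t \<cdot>\<^sub>v z + X *\<^sub>v a"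
proof (rule eq_vecI)
  fix i assume "i < dim_vec (t \<cdot>\<^sub>v z + X *\<^sub>v a)"
  then have i: "i < m" using assms by simp
  have "row (prepend_col z X) i = vCons (z $ i) (row X i)"
    using i assms by (intro eq_vecI) (auto simp: prepend_col_def vec_index_vCons split: nat.splits)
  then show "(prepend_col z X *\<^sub>v vCons t a) $ i = (t \<cdot>\<^sub>v z + X *\<^sub>v a) $ i"
    using i assms carrier_matD(1)[OF prepend_col_carrier[OF assms(1), of z]] by (simp add: mult.commute)
qed (use assms in \<open>simp add: prepend_col_def\<close>)

lemma carrier_vec_SucE:
  assumes "v \<in> carrier_vec (Suc k)"
  obtains t a where "v = vCons t a" "a \<in> carrier_vec k"
  using assms
proof (cases v)
  case (vCons t a)
  then show thesis using assms by (intro that[of t a]) auto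
qed simp

text \<open>The conditions \<open>dual\<close> and \<open>norm\<close> prescribe all scalar products
  that involve the new vector. Since \<open>z\<close> lies outside the range of \<open>X\<close>, a
  relation between the columns cannot involve it, so no kernel vector arises beyond the old
  ones.\<close>

lemma extend_isometry:
  fixes X Y :: "'a::field mat"
  assumes X: "X \<in> carrier_mat m k" and Y: "Y \<in> carrier_mat l k"
    and gram: "same_gram X Y" and ker: "kernel_subset X Y"
    and z: "z \<in> carrier_vec m" and z': "z' \<in> carrier_vec l"
    and dual: "\<And>a. a \<in> carrier_vec k \<Longrightarrow> z \<bullet> (X *\<^sub>v a) = z' \<bullet> (Y *\<^sub>v a)"
    and norm: "z \<bullet> z = z' \<bullet> z'"
    and new: "\<And>a. a \<in> carrier_vec k \<Longrightarrow> z \<noteq> X *\<^sub>v a"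
  shows "same_gram (prepend_col z X) (prepend_col z' Y)"
    and "kernel_subset (prepend_col z X) (prepend_col z' Y)"
proof -
  note P = prepend_col_carrier[OF X, of z] prepend_col_carrier[OF Y, of z']
  show "same_gram (prepend_col z X) (prepend_col z' Y)"
    unfolding same_gram_def
  proof (intro ballI)
    fix v w :: "'a vec" assume "v \<in> carrier_vec (dim_col (prepend_col z X))" "w \<in> carrier_vec (dim_col (prepend_col z X))"
    then have vw: "v \<in> carrier_vec (Suc k)" "w \<in> carrier_vec (Suc k)" using P by auto
    obtain s a where v: "v = vCons s a" "a \<in> carrier_vec k" using carrier_vec_SucE[OF vw(1)] by blast
    obtain t b where w: "w = vCons t b" "b \<in> carrier_vec k" using carrier_vec_SucE[OF vw(2)] by blast
    have XY: "(X *\<^sub>v a) \<bullet> (X *\<^sub>v b) = (Y *\<^sub>v a) \<bullet> (Y *\<^sub>v b)" using same_gramD[OF gram X] v w by simp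
    show "(prepend_col z X *\<^sub>v v) \<bullet> (prepend_col z X *\<^sub>v w) = (prepend_col z' Y *\<^sub>v v) \<bullet> (prepend_col z' Y *\<^sub>v w)"
      using X Y z z' v w
      by (simp add: prepend_col_mult_vec[of _ m k] prepend_col_mult_vec[of _ l k] scalar_prod_simps XY norm
          scalar_prod_commute[of "X *\<^sub>v a" z] scalar_prod_commute[of "Y *\<^sub>v a" z'] dual)
  qed
  show "kernel_subset (prepend_col z X) (prepend_col z' Y)"
    unfolding kernel_subset_def
  proof (intro ballI impI)
    fix v :: "'a vec" assume "v \<in> carrier_vec (dim_col (prepend_col z X))"
      and 0: "prepend_col z X *\<^sub>v v = 0\<^sub>v (dim_row (prepend_col z X))"
    then have v': "v \<in> carrier_vec (Suc k)" using P by auto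
    then obtain s a where v: "v = vCons s a" "a \<in> carrier_vec k" using carrier_vec_SucE[OF v'] by blast
    have eq: "s \<cdot>\<^sub>v z + X *\<^sub>v a = 0\<^sub>v m" using 0 X z v P by (simp add: prepend_col_mult_vec[of _ m k])
    \<comment> \<open>Dividing the relation by a nonzero \<open>s\<close> would put \<open>z\<close>
      into the range of \<open>X\<close>.\<close>
    have "s = 0"
    proof (rule ccontr)
      assume s: "s \<noteq> 0"
      have "z = X *\<^sub>v ((- inverse s) \<cdot>\<^sub>v a)"
      proof (rule eq_vecI)
        fix i assume "i < dim_vec (X *\<^sub>v ((- inverse s) \<cdot>\<^sub>v a))"
        then have i: "i < m" using X by simp
        have "(s \<cdot>\<^sub>v z + X *\<^sub>v a) $ i = 0" using eq i by simp
        then have "s * z $ i + (X *\<^sub>v a) $ i = 0" using i X z by simp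
        then have "s * z $ i = - ((X *\<^sub>v a) $ i)" by (simp only: eq_neg_iff_add_eq_0)
        then have "inverse s * (s * z $ i) = - inverse s * (X *\<^sub>v a) $ i" by simp
        then have "z $ i = - inverse s * (X *\<^sub>v a) $ i" using s by (simp flip: mult.assoc)
        then show "z $ i = (X *\<^sub>v ((- inverse s) \<cdot>\<^sub>v a)) $ i"
          using i X v by (simp add: scalar_prod_smult)
      qed (use X z in auto)
      then show False using new[of "(- inverse s) \<cdot>\<^sub>v a"] v by simp
    qed
    then have "X *\<^sub>v a = 0\<^sub>v m" using eq X z v by (simp add: zero_smult_vec)
    then have "Y *\<^sub>v a = 0\<^sub>v l" using kernel_subsetD[OF ker X Y] v by blast
    then show "prepend_col z' Y *\<^sub>v v = 0\<^sub>v (dim_row (prepend_col z' Y))"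
      using Y z' v carrier_matD(1)[OF P(2)] \<open>s = 0\<close> by (simp add: prepend_col_mult_vec[of _ l k] zero_smult_vec)
  qed
qed

text \<open>By the double complement, a vector outside the range has a nonzero product with some
  \<open>y\<close> in the complement; this \<open>y\<close> drops out once \<open>z\<close> is
  adjoined.\<close>

lemma card_range_complement_prepend:
  fixes X :: "'a::{field,finite} mat"
  assumes X: "X \<in> carrier_mat m k" and z: "z \<in> carrier_vec m"
    and new: "\<And>a. a \<in> carrier_vec k \<Longrightarrow> z \<noteq> X *\<^sub>v a"
  shows "card (range_complement (prepend_col z X)) < card (range_complement X)"
proof (rule psubset_card_mono)
  show "finite (range_complement X)"
    by (rule finite_subset[OF _ finite_carrier_vec[of "dim_row X"]]) (auto simp: range_complement_def)
  have "\<exists>y\<in>range_complement X. z \<bullet> y \<noteq> 0"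
  proof (rule ccontr)
    assume "\<not> (\<exists>y\<in>range_complement X. z \<bullet> y \<noteq> 0)"
    then have "z \<bullet> y = 0" if "y \<in> range_complement X" for y using that by blast
    then obtain a where "a \<in> carrier_vec k" "z = X *\<^sub>v a" by (rule in_rangeI[OF X z]) 
    then show False using new by blast
  qed
  then obtain y where y: "y \<in> range_complement X" "z \<bullet> y \<noteq> 0" by blast
  have yc: "y \<in> carrier_vec m" using y X by (auto simp: range_complement_def)
  have "y \<bullet> (prepend_col z X *\<^sub>v vCons 1 (0\<^sub>v k)) = z \<bullet> y"
    using X z yc by (simp add: prepend_col_mult_vec[of _ m k] mult_mat_vec_zero scalar_prod_commute)
  then have "y \<notin> range_complement (prepend_col z X)"
    using y(2) prepend_col_carrier[OF X, of z] unfolding range_complement_def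
    by (auto intro!: bexI[of _ "vCons 1 (0\<^sub>v k)"])
  moreover have "range_complement (prepend_col z X) \<subseteq> range_complement X"
  proof
    fix x assume x: "x \<in> range_complement (prepend_col z X)"
    have xc: "x \<in> carrier_vec m" using x prepend_col_carrier[OF X, of z] by (auto simp: range_complement_def)
    have "x \<bullet> (X *\<^sub>v a) = 0" if a: "a \<in> carrier_vec k" for a
    proof -
      have "x \<bullet> (prepend_col z X *\<^sub>v vCons 0 a) = 0"
        using x a prepend_col_carrier[OF X, of z] by (auto simp: range_complement_def)
      then show ?thesis using X z a xc by (simp add: prepend_col_mult_vec[of _ m k] zero_smult_vec)
    qed
    then show "x \<in> range_complement X" using xc X by (auto simp: range_complement_def)
  qed
  ultimately show "range_complement (prepend_col z X) \<subset> range_complement X" using y(1) by blast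
qed

text \<open>The base case of both extension theorems: with trivial complement, \<open>X\<close> is
  onto, so the map between the ranges is already defined on the whole space.\<close>

lemma isometry_of_surjective:
  fixes X Y :: "'a::field mat"
  assumes X: "X \<in> carrier_mat m k" and Y: "Y \<in> carrier_mat m k"
    and gram: "same_gram X Y" and ker: "kernel_subset X Y"
    and compl: "range_complement X \<subseteq> {0\<^sub>v m}"
  shows "\<exists>Q\<in>orthogonal_group m. \<forall>a\<in>carrier_vec k. Q *\<^sub>v (X *\<^sub>v a) = Y *\<^sub>v a"
proof -
  have surj: "\<exists>a\<in>carrier_vec k. z = X *\<^sub>v a" if z: "z \<in> carrier_vec m" for z
  proof -
    have "z \<bullet> y = 0" if "y \<in> range_complement X" for y using that compl z by auto
    then show ?thesis using in_rangeI[OF X z] by blast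
  qed
  obtain Q where Q: "Q \<in> carrier_mat m m" "\<And>a. a \<in> carrier_vec k \<Longrightarrow> Y *\<^sub>v a = Q *\<^sub>v (X *\<^sub>v a)"
    using factor_through_kernel[OF X Y kernel_subsetD[OF ker X Y]] by blast
  have "Q \<in> orthogonal_group m"
  proof (rule orthogonal_groupI[OF Q(1)])
    fix x y :: "'a vec" assume "x \<in> carrier_vec m" "y \<in> carrier_vec m"
    then obtain a b where ab: "a \<in> carrier_vec k" "x = X *\<^sub>v a" "b \<in> carrier_vec k" "y = X *\<^sub>v b"
      using surj by blast
    then show "(Q *\<^sub>v x) \<bullet> (Q *\<^sub>v y) = x \<bullet> y" using same_gramD[OF gram X, of a b] by (simp flip: Q(2))
  qed
  then show ?thesis using Q(2) by (intro bexI[of _ Q]) auto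
qed

section \<open>Extension of isometries in characteristic 2\<close>

abbreviation ones :: "nat \<Rightarrow> 'a::one vec" where
  "ones m \<equiv> vec m (\<lambda>_. 1)"

text \<open>The Frobenius map is additive in characteristic 2.\<close>

lemma norm_char_2:
  fixes x :: "'a::field vec"
  assumes char: "(2::'a) = 0" and x: "x \<in> carrier_vec m"
  shows "x \<bullet> x = (x \<bullet> ones m)\<^sup>2"
proof -
  have "(\<Sum>i\<in>I. (x $ i)\<^sup>2) = (\<Sum>i\<in>I. x $ i)\<^sup>2" if "finite I" for I
    using that by induction (auto simp: power2_sum char)
  then show ?thesis using x by (simp add: scalar_prod_def power2_eq_square)
qed

lemma exists_scalar_prod_1:
  fixes w :: "'a::field vec"
  assumes w: "w \<in> carrier_vec m" and nz: "w \<noteq> 0\<^sub>v m"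
  obtains z where "z \<in> carrier_vec m" "z \<bullet> w = 1"
proof -
  obtain i where i: "i < m" "w $ i \<noteq> 0" using w nz by (metis carrier_vecD eq_vecI index_zero_vec)
  have "(inverse (w $ i) \<cdot>\<^sub>v unit_vec m i) \<bullet> w = 1" using i w by (simp add: scalar_prod_smult)
  then show thesis using that[of "inverse (w $ i) \<cdot>\<^sub>v unit_vec m i"] by simp
qed

lemma exists_nonzero_in_complement:
  assumes "X \<in> carrier_mat m k" and "\<not> range_complement X \<subseteq> {0\<^sub>v m}"
  obtains z where "z \<in> carrier_vec m" "z \<noteq> 0\<^sub>v m" "\<And>a. a \<in> carrier_vec k \<Longrightarrow> z \<bullet> (X *\<^sub>v a) = 0"
proof -
  obtain z where "z \<in> range_complement X" "z \<noteq> 0\<^sub>v m" using assms(2) by blast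
  then show thesis using assms(1) by (intro that[of z]) (auto simp: range_complement_def)
qed

lemma isometry_of_prepend:
  fixes X Y :: "'a::field mat"
  assumes X: "X \<in> carrier_mat m k" and Y: "Y \<in> carrier_mat l k"
    and z: "z \<in> carrier_vec m" and z': "z' \<in> carrier_vec l"
    and ext: "\<forall>v\<in>carrier_vec (Suc k). Q *\<^sub>v (prepend_col z X *\<^sub>v v) = prepend_col z' Y *\<^sub>v v"
  shows "\<forall>a\<in>carrier_vec k. Q *\<^sub>v (X *\<^sub>v a) = Y *\<^sub>v a"
proof
  fix a :: "'a vec" assume a: "a \<in> carrier_vec k"
  have "prepend_col z X *\<^sub>v vCons 0 a = X *\<^sub>v a" "prepend_col z' Y *\<^sub>v vCons 0 a = Y *\<^sub>v a"
    using X Y z z' a by (auto simp: prepend_col_mult_vec[of _ m k] prepend_col_mult_vec[of _ l k] zero_smult_vec)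
  then show "Q *\<^sub>v (X *\<^sub>v a) = Y *\<^sub>v a" using ext a by (metis vCons_carrier_vec)
qed

lemma isometry_swap:
  assumes X: "X \<in> carrier_mat m k" and Q: "Q \<in> orthogonal_group m"
    and "\<forall>a\<in>carrier_vec k. Q *\<^sub>v (X *\<^sub>v a) = Y *\<^sub>v a"
  shows "\<forall>a\<in>carrier_vec k. Q\<^sup>T *\<^sub>v (Y *\<^sub>v a) = X *\<^sub>v a"
proof
  fix a :: "'a vec" assume a: "a \<in> carrier_vec k"
  have "X *\<^sub>v a \<in> carrier_vec m" using X a by auto
  from orthogonal_group_inverse_vec[OF Q this] show "Q\<^sup>T *\<^sub>v (Y *\<^sub>v a) = X *\<^sub>v a" using assms(3) a by simp
qed

text \<open>In characteristic \<open>2\<close> the norm \<open>x \<bullet> x = (x \<bullet> ones)\<^sup>2\<close> is determined by the scalar product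
  with the all-ones vector, so an isometry fixing that vector extends along any solution of the
  linear conditions.\<close>

theorem witt_extension_char_2:
  fixes X Y :: "'a::{field,finite} mat"
  assumes char: "(2::'a) = 0"
    and "X \<in> carrier_mat m k" "Y \<in> carrier_mat m k"
    and "same_gram X Y" "kernel_subset X Y" "kernel_subset Y X"
    and "c \<in> carrier_vec k" "X *\<^sub>v c = ones m" "Y *\<^sub>v c = ones m"
  shows "\<exists>Q\<in>orthogonal_group m. \<forall>a\<in>carrier_vec k. Q *\<^sub>v (X *\<^sub>v a) = Y *\<^sub>v a"
  using assms(2-)
proof (induction "card (range_complement X)" arbitrary: k X Y c rule: less_induct)
  case less
  note X = less.prems(1) and Y = less.prems(2) and gram = less.prems(3) and ker = less.prems(4,5)
    and c = less.prems(6-8)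
  have gram': "same_gram Y X" using same_gram_sym[OF gram] X Y by simp
  \<comment> \<open>If one of the complements is trivial, the isometry is read off from that side,
    transposed if the side is \<open>Y\<close>. Otherwise one vector is adjoined to each
    range.\<close>
  consider (X) "range_complement X \<subseteq> {0\<^sub>v m}" | (Y) "range_complement Y \<subseteq> {0\<^sub>v m}"
    | (no) "\<not> range_complement X \<subseteq> {0\<^sub>v m}" "\<not> range_complement Y \<subseteq> {0\<^sub>v m}" by blast
  then show ?case
  proof cases
    case X
    then show ?thesis using isometry_of_surjective less.prems by blast
  next
    case Y
    then obtain Q where Q: "Q \<in> orthogonal_group m" "\<forall>a\<in>carrier_vec k. Q *\<^sub>v (Y *\<^sub>v a) = X *\<^sub>v a"
      using isometry_of_surjective[OF less.prems(2,1) gram' ker(2)] by blast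
    then show ?thesis
      using isometry_swap[OF less.prems(2) Q] orthogonal_group_transpose[OF Q(1)] by blast
  next
    case no
    have "\<exists>z\<in>carrier_vec m. \<exists>z'\<in>carrier_vec m. (\<forall>a\<in>carrier_vec k. z \<bullet> (X *\<^sub>v a) = z' \<bullet> (Y *\<^sub>v a)) \<and>
      (\<forall>a\<in>carrier_vec k. z \<noteq> X *\<^sub>v a) \<and> (\<forall>a\<in>carrier_vec k. z' \<noteq> Y *\<^sub>v a)"
    \<comment> \<open>If the range of \<open>X\<close> has a nonzero radical vector
      \<open>X b\<close>, any \<open>z\<close> with \<open>z \<bullet> X b = 1\<close> avoids the
      range, and so does its partner. If the radical is zero, nonzero vectors of the two complements
      avoid the ranges and have zero products with them.\<close>
    proof (cases "\<exists>b\<in>carrier_vec k. X *\<^sub>v b \<noteq> 0\<^sub>v m \<and> (\<forall>a\<in>carrier_vec k. (X *\<^sub>v a) \<bullet> (X *\<^sub>v b) = 0)")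
      case True
      then obtain b where b: "b \<in> carrier_vec k" "X *\<^sub>v b \<noteq> 0\<^sub>v m"
        and deg: "\<And>a. a \<in> carrier_vec k \<Longrightarrow> (X *\<^sub>v a) \<bullet> (X *\<^sub>v b) = 0" by blast
      have deg': "(Y *\<^sub>v a) \<bullet> (Y *\<^sub>v b) = 0" if "a \<in> carrier_vec k" for a
        using same_gramD[OF gram X that b(1)] deg[OF that] by simp
      have "X *\<^sub>v b \<in> carrier_vec m" using X b by auto
      then obtain z where z: "z \<in> carrier_vec m" "z \<bullet> (X *\<^sub>v b) = 1" using exists_scalar_prod_1 b(2) by blast
      obtain z' where z': "z' \<in> carrier_vec m"
        and dual: "\<And>a. a \<in> carrier_vec k \<Longrightarrow> z' \<bullet> (Y *\<^sub>v a) = z \<bullet> (X *\<^sub>v a)"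
        using dual_vector[OF X Y ker(2) z(1)] by blast
      have "z' \<bullet> (Y *\<^sub>v b) = 1" using dual b z by simp
      then have "\<forall>a\<in>carrier_vec k. z' \<noteq> Y *\<^sub>v a" using deg' by auto
      moreover have "\<forall>a\<in>carrier_vec k. z \<noteq> X *\<^sub>v a" using deg z by auto
      ultimately show ?thesis using z z' dual by metis
    next
      case False
      then have nondeg: "X *\<^sub>v b = 0\<^sub>v m"
        if "b \<in> carrier_vec k" "\<And>a. a \<in> carrier_vec k \<Longrightarrow> (X *\<^sub>v a) \<bullet> (X *\<^sub>v b) = 0" for b using that by blast
      have nondeg': "Y *\<^sub>v b = 0\<^sub>v m"
        if b: "b \<in> carrier_vec k" and deg: "\<And>a. a \<in> carrier_vec k \<Longrightarrow> (Y *\<^sub>v a) \<bullet> (Y *\<^sub>v b) = 0" for b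
      proof -
        have "X *\<^sub>v b = 0\<^sub>v m" using same_gramD[OF gram X _ b] deg by (intro nondeg b) auto
        then show ?thesis using kernel_subsetD[OF ker(1) X Y b] by simp
      qed
      obtain z where z: "z \<in> carrier_vec m" "z \<noteq> 0\<^sub>v m" "\<And>a. a \<in> carrier_vec k \<Longrightarrow> z \<bullet> (X *\<^sub>v a) = 0"
        using exists_nonzero_in_complement[OF X no(1)] by blast
      obtain z' where z': "z' \<in> carrier_vec m" "z' \<noteq> 0\<^sub>v m" "\<And>a. a \<in> carrier_vec k \<Longrightarrow> z' \<bullet> (Y *\<^sub>v a) = 0"
        using exists_nonzero_in_complement[OF Y no(2)] by blast
      have "z \<noteq> X *\<^sub>v b" if b: "b \<in> carrier_vec k" for b
      proof
        assume zb: "z = X *\<^sub>v b"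
        have "(X *\<^sub>v a) \<bullet> (X *\<^sub>v b) = 0" if "a \<in> carrier_vec k" for a
          using z(3)[OF that] X b that by (simp add: zb scalar_prod_commute[of "X *\<^sub>v a" "X *\<^sub>v b"])
        then show False using nondeg[OF b] zb z(2) by simp
      qed
      moreover have "z' \<noteq> Y *\<^sub>v b" if b: "b \<in> carrier_vec k" for b
      proof
        assume zb: "z' = Y *\<^sub>v b"
        have "(Y *\<^sub>v a) \<bullet> (Y *\<^sub>v b) = 0" if "a \<in> carrier_vec k" for a
          using z'(3)[OF that] Y b that by (simp add: zb scalar_prod_commute[of "Y *\<^sub>v a" "Y *\<^sub>v b"])
        then show False using nondeg'[OF b] zb z'(2) by simp
      qed
      ultimately show ?thesis using z(1,3) z'(1,3) by (intro bexI[of _ z] bexI[of _ z']) auto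
    qed
    then obtain z z' where z: "z \<in> carrier_vec m" and z': "z' \<in> carrier_vec m"
      and dual: "\<And>a. a \<in> carrier_vec k \<Longrightarrow> z \<bullet> (X *\<^sub>v a) = z' \<bullet> (Y *\<^sub>v a)"
      and new: "\<And>a. a \<in> carrier_vec k \<Longrightarrow> z \<noteq> X *\<^sub>v a" "\<And>a. a \<in> carrier_vec k \<Longrightarrow> z' \<noteq> Y *\<^sub>v a" by blast
    \<comment> \<open>The norm of \<open>z\<close> is the square of
      \<open>z \<bullet> ones m = z \<bullet> X c\<close>, which \<open>dual\<close> equates with
      \<open>z' \<bullet> Y c = z' \<bullet> ones m\<close>.\<close>
    have norm: "z \<bullet> z = z' \<bullet> z'"
      using dual[OF c(1)] c norm_char_2[OF char z] norm_char_2[OF char z'] by simp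
    note P = prepend_col_carrier[OF X, of z] prepend_col_carrier[OF Y, of z']
    have "\<exists>Q\<in>orthogonal_group m. \<forall>v\<in>carrier_vec (Suc k). Q *\<^sub>v (prepend_col z X *\<^sub>v v) = prepend_col z' Y *\<^sub>v v"
    proof (rule less.hyps[OF _ P])
      show "card (range_complement (prepend_col z X)) < card (range_complement X)"
        by (rule card_range_complement_prepend[OF X z new(1)])
      show "same_gram (prepend_col z X) (prepend_col z' Y)" "kernel_subset (prepend_col z X) (prepend_col z' Y)"
        by (rule extend_isometry[OF X Y gram ker(1) z z' dual norm new(1)]; assumption)+
      show "kernel_subset (prepend_col z' Y) (prepend_col z X)"
        by (rule extend_isometry[OF Y X gram' ker(2) z' z dual[symmetric] norm[symmetric] new(2)]; assumption)
      \<comment> \<open>Coefficient 0 at the new column keeps the representation of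
        \<open>ones m\<close> on both sides.\<close>
      show "vCons 0 c \<in> carrier_vec (Suc k)" using c by simp
      show "prepend_col z X *\<^sub>v vCons 0 c = ones m" "prepend_col z' Y *\<^sub>v vCons 0 c = ones m"
        using X Y z z' c by (auto simp: prepend_col_mult_vec[of _ m k] zero_smult_vec)
    qed
    then show ?thesis using isometry_of_prepend[OF X Y z z'] by blast
  qed
qed

section \<open>Extension of isometries in odd characteristic\<close>

text \<open>Splits off a vector \<open>x = X a\<close> of nonzero norm, applies the induction
  hypothesis to the orthogonal complement of \<open>x\<close> inside the range, and then corrects
  the image of \<open>x\<close> by a product of reflections fixing the image of that
  complement.\<close>

lemma witt_nondegenerate_odd:
  fixes X Y :: "'a::{field,finite} mat"
  assumes odd: "(2::'a) \<noteq> 0"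
    and "X \<in> carrier_mat m k" "Y \<in> carrier_mat m k"
    and "same_gram X Y" "kernel_subset X Y" "kernel_subset Y X"
    and "\<And>b. b \<in> carrier_vec k \<Longrightarrow> (\<And>a. a \<in> carrier_vec k \<Longrightarrow> (X *\<^sub>v a) \<bullet> (X *\<^sub>v b) = 0) \<Longrightarrow> X *\<^sub>v b = 0\<^sub>v m"
  shows "\<exists>Q\<in>orthogonal_group m. \<forall>a\<in>carrier_vec k. Q *\<^sub>v (X *\<^sub>v a) = Y *\<^sub>v a"
  using assms(2-)
proof (induction "card ((\<lambda>a. X *\<^sub>v a) ` carrier_vec k)" arbitrary: X Y rule: less_induct)
  case less
  note X = less.prems(1) and Y = less.prems(2) and gram = less.prems(3) and ker = less.prems(4,5)
    and nondeg = less.prems(6)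
  have Xc: "X *\<^sub>v a \<in> carrier_vec m" and Yc: "Y *\<^sub>v a \<in> carrier_vec m" for a
    using X Y by (auto intro: mult_mat_vec_in_carrier)
  show ?case
  proof (cases "\<exists>a\<in>carrier_vec k. (X *\<^sub>v a) \<bullet> (X *\<^sub>v a) \<noteq> 0")
    case False
    have "(X *\<^sub>v a) \<bullet> (X *\<^sub>v b) = 0" if a: "a \<in> carrier_vec k" and b: "b \<in> carrier_vec k" for a b
    proof -
      \<comment> \<open>Polarisation: if every norm is zero and 2 is invertible, the form vanishes
        on the range, which is then zero by nondegeneracy.\<close>
      have "(X *\<^sub>v (a + b)) \<bullet> (X *\<^sub>v (a + b)) = 0" using False a b by auto
      also have "(X *\<^sub>v (a + b)) \<bullet> (X *\<^sub>v (a + b)) = 2 * ((X *\<^sub>v a) \<bullet> (X *\<^sub>v b))"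
        using False a b X
        by (simp add: mult_mat_vec_simps scalar_prod_simps scalar_prod_commute[of "X *\<^sub>v b" "X *\<^sub>v a"])
      finally show ?thesis using odd by simp
    qed
    then have 0: "X *\<^sub>v b = 0\<^sub>v m" if "b \<in> carrier_vec k" for b using nondeg that by blast
    then have "Y *\<^sub>v b = 0\<^sub>v m" if "b \<in> carrier_vec k" for b using kernel_subsetD[OF ker(1) X Y] that by blast
    with 0 show ?thesis by (intro bexI[OF _ orthogonal_group_one[of m]]) auto
  next
    case True
    then obtain a where a: "a \<in> carrier_vec k" and nz: "(X *\<^sub>v a) \<bullet> (X *\<^sub>v a) \<noteq> 0" by blast
    define x where "x = X *\<^sub>v a"
    define y where "y = Y *\<^sub>v a"
    have x: "x \<in> carrier_vec m" and y: "y \<in> carrier_vec m" using Xc Yc by (auto simp: x_def y_def)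
    have xy: "y \<bullet> y = x \<bullet> x" using same_gramD[OF gram X a a] by (simp add: x_def y_def)
    have xnz: "x \<bullet> x \<noteq> 0" using nz by (simp add: x_def)
    \<comment> \<open>The product \<open>r \<bullet> b\<close> is the coefficient of the orthogonal
      projection of \<open>X b\<close> onto \<open>x\<close>. Thus \<open>J\<close> lifts the
      projection away from \<open>x\<close> to coefficient vectors, so that it acts on
      \<open>X\<close> and \<open>Y\<close> alike.\<close>
    define r where "r = inverse (x \<bullet> x) \<cdot>\<^sub>v (X\<^sup>T *\<^sub>v x)"
    have r: "r \<in> carrier_vec k" using X x by (auto simp: r_def)
    have XTx: "X\<^sup>T *\<^sub>v x \<in> carrier_vec k" using X x by auto
    have rb: "r \<bullet> b = inverse (x \<bullet> x) * (x \<bullet> (X *\<^sub>v b))" if b: "b \<in> carrier_vec k" for b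
      using scalar_prod_transpose(1)[OF X b x] b XTx X by (simp add: r_def scalar_prod_smult)
    define J where "J = 1\<^sub>m k - rank_one a r"
    have J: "J \<in> carrier_mat k k" unfolding J_def using a r by (intro minus_carrier_mat rank_one_carrier)
    have Jb: "J *\<^sub>v b = b - (r \<bullet> b) \<cdot>\<^sub>v a" if b: "b \<in> carrier_vec k" for b
      unfolding J_def using b a r by (subst minus_mult_distrib_mat_vec[of _ k k]) (auto simp: rank_one_mult_vec[of _ k])
    have Jc: "J *\<^sub>v b \<in> carrier_vec k" for b using J by (rule mult_mat_vec_in_carrier)
    have XJ: "X * J \<in> carrier_mat m k" and YJ: "Y * J \<in> carrier_mat m k" using X Y J by auto
    have XJb: "(X * J) *\<^sub>v b = X *\<^sub>v (J *\<^sub>v b)" and YJb: "(Y * J) *\<^sub>v b = Y *\<^sub>v (J *\<^sub>v b)"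
      if b: "b \<in> carrier_vec k" for b
      using X Y J b by (auto intro: assoc_mult_mat_vec)
    have XJ_eq: "X *\<^sub>v (J *\<^sub>v b) = X *\<^sub>v b - (r \<bullet> b) \<cdot>\<^sub>v x" if b: "b \<in> carrier_vec k" for b
      using X a b by (simp add: Jb mult_mat_vec_simps x_def)
    have YJ_eq: "Y *\<^sub>v (J *\<^sub>v b) = Y *\<^sub>v b - (r \<bullet> b) \<cdot>\<^sub>v y" if b: "b \<in> carrier_vec k" for b
      using Y a b by (simp add: Jb mult_mat_vec_simps y_def)
    have x_orth: "x \<bullet> (X *\<^sub>v (J *\<^sub>v b)) = 0" if b: "b \<in> carrier_vec k" for b
      unfolding XJ_eq[OF b] using x X b xnz by (simp add: scalar_prod_simps rb)
    have y_orth: "y \<bullet> (Y *\<^sub>v (J *\<^sub>v b)) = 0" if b: "b \<in> carrier_vec k" for b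
      using x_orth[OF b] same_gramD[OF gram X a Jc] by (simp add: x_def y_def)
    have "\<exists>Q\<in>orthogonal_group m. \<forall>b\<in>carrier_vec k. Q *\<^sub>v ((X * J) *\<^sub>v b) = (Y * J) *\<^sub>v b"
    proof (rule less.hyps[OF _ XJ YJ])
      have "x \<notin> (\<lambda>b. (X * J) *\<^sub>v b) ` carrier_vec k" using x_orth xnz by (auto simp: XJb)
      moreover have "x \<in> (\<lambda>a. X *\<^sub>v a) ` carrier_vec k" using a by (auto simp: x_def)
      moreover have "(\<lambda>b. (X * J) *\<^sub>v b) ` carrier_vec k \<subseteq> (\<lambda>a. X *\<^sub>v a) ` carrier_vec k"
        using Jc by (auto simp: XJb)
      ultimately show "card ((\<lambda>b. (X * J) *\<^sub>v b) ` carrier_vec k) < card ((\<lambda>a. X *\<^sub>v a) ` carrier_vec k)"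
        by (intro psubset_card_mono finite_imageI finite_carrier_vec) blast
      show "same_gram (X * J) (Y * J)"
        by (rule same_gram_mult[OF gram X Y J])
      show "kernel_subset (X * J) (Y * J)" "kernel_subset (Y * J) (X * J)"
        by (rule kernel_subset_mult[OF ker(1) X Y J] kernel_subset_mult[OF ker(2) Y X J])+
      fix b :: "'a vec" assume b: "b \<in> carrier_vec k"
        and deg: "\<And>d. d \<in> carrier_vec k \<Longrightarrow> ((X * J) *\<^sub>v d) \<bullet> ((X * J) *\<^sub>v b) = 0"
      have "X *\<^sub>v (J *\<^sub>v b) = 0\<^sub>v m"
      proof (rule nondeg[OF Jc])
        fix d :: "'a vec" assume d: "d \<in> carrier_vec k"
        have "X *\<^sub>v d = X *\<^sub>v (J *\<^sub>v d) + (r \<bullet> d) \<cdot>\<^sub>v x"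
          unfolding XJ_eq[OF d] using X x by (intro eq_vecI) auto
        then have "(X *\<^sub>v d) \<bullet> (X *\<^sub>v (J *\<^sub>v b)) = (X *\<^sub>v (J *\<^sub>v d)) \<bullet> (X *\<^sub>v (J *\<^sub>v b)) + (r \<bullet> d) * (x \<bullet> (X *\<^sub>v (J *\<^sub>v b)))"
          using X x by (simp add: scalar_prod_simps)
        then show "(X *\<^sub>v d) \<bullet> (X *\<^sub>v (J *\<^sub>v b)) = 0" using deg[OF d] x_orth[OF b] by (simp add: XJb b d)
      qed
      then show "(X * J) *\<^sub>v b = 0\<^sub>v m" by (simp add: XJb b)
    qed
    then obtain Q where Q: "Q \<in> orthogonal_group m"
      and Qb: "\<And>b. b \<in> carrier_vec k \<Longrightarrow> Q *\<^sub>v (X *\<^sub>v (J *\<^sub>v b)) = Y *\<^sub>v (J *\<^sub>v b)" by (auto simp: XJb YJb)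
    have Qc: "Q \<in> carrier_mat m m" by (rule orthogonal_group_carrier[OF Q])
    have Qx: "Q *\<^sub>v x \<in> carrier_vec m" using Qc x by auto
    have norm: "(Q *\<^sub>v x) \<bullet> (Q *\<^sub>v x) = x \<bullet> x" by (rule orthogonal_group_scalar_prod[OF Q x x])
    have Qx_orth: "(Y *\<^sub>v (J *\<^sub>v b)) \<bullet> (Q *\<^sub>v x) = 0" if b: "b \<in> carrier_vec k" for b
    proof -
      have "(Q *\<^sub>v (X *\<^sub>v (J *\<^sub>v b))) \<bullet> (Q *\<^sub>v x) = (X *\<^sub>v (J *\<^sub>v b)) \<bullet> x"
        by (rule orthogonal_group_scalar_prod[OF Q Xc x])
      then show ?thesis using x_orth[OF b] X x by (simp add: Qb b scalar_prod_commute)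
    qed
    \<comment> \<open>Both \<open>Q x\<close> and \<open>y\<close> are orthogonal to every
      \<open>Y J b\<close> and have the norm of \<open>x\<close>; hence \<open>R\<close> can move
      the one to the other while fixing all \<open>Y J b\<close>.\<close>
    obtain R where R: "R \<in> orthogonal_group m" "R *\<^sub>v (Q *\<^sub>v x) = y"
      "\<And>z. z \<in> carrier_vec m \<Longrightarrow> z \<bullet> (Q *\<^sub>v x) = 0 \<Longrightarrow> z \<bullet> y = 0 \<Longrightarrow> R *\<^sub>v z = z"
      using orthogonal_move_odd[OF odd Qx y] norm xy xnz by metis
    have Rc: "R \<in> carrier_mat m m" by (rule orthogonal_group_carrier[OF R(1)])
    have "(R * Q) *\<^sub>v (X *\<^sub>v b) = Y *\<^sub>v b" if b: "b \<in> carrier_vec k" for b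
    proof -
      have "X *\<^sub>v b = X *\<^sub>v (J *\<^sub>v b) + (r \<bullet> b) \<cdot>\<^sub>v x"
        unfolding XJ_eq[OF b] using X x by (intro eq_vecI) auto
      then have "R *\<^sub>v (Q *\<^sub>v (X *\<^sub>v b)) = R *\<^sub>v (Y *\<^sub>v (J *\<^sub>v b)) + (r \<bullet> b) \<cdot>\<^sub>v y"
        using Qc Rc X Y x b by (simp add: mult_mat_vec_simps Qb R(2))
      also have "R *\<^sub>v (Y *\<^sub>v (J *\<^sub>v b)) = Y *\<^sub>v (J *\<^sub>v b)"
        using y_orth[OF b] y Y by (intro R(3) Yc Qx_orth b) (simp add: scalar_prod_commute[of _ y])
      also have "Y *\<^sub>v (J *\<^sub>v b) + (r \<bullet> b) \<cdot>\<^sub>v y = Y *\<^sub>v b"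
        unfolding YJ_eq[OF b] using Y y by (intro eq_vecI) auto
      finally show ?thesis using assoc_mult_mat_vec[OF Rc Qc Xc] by simp
    qed
    then show ?thesis using orthogonal_group_mult[OF R(1) Q] by blast
  qed
qed

text \<open>Each radical vector is paired with a new vector of product 1 until the range is
  nondegenerate; then \<open>witt_nondegenerate_odd\<close> applies.\<close>

theorem witt_extension_odd:
  fixes X Y :: "'a::{field,finite} mat"
  assumes odd: "(2::'a) \<noteq> 0"
    and "X \<in> carrier_mat m k" "Y \<in> carrier_mat m k"
    and "same_gram X Y" "kernel_subset X Y" "kernel_subset Y X"
  shows "\<exists>Q\<in>orthogonal_group m. \<forall>a\<in>carrier_vec k. Q *\<^sub>v (X *\<^sub>v a) = Y *\<^sub>v a"
  using assms(2-)
proof (induction "card (range_complement X)" arbitrary: k X Y rule: less_induct)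
  case less
  note X = less.prems(1) and Y = less.prems(2) and gram = less.prems(3) and ker = less.prems(4,5)
  have gram': "same_gram Y X" using same_gram_sym[OF gram] X Y by simp
  show ?case
  proof (cases "\<exists>b\<in>carrier_vec k. X *\<^sub>v b \<noteq> 0\<^sub>v m \<and> (\<forall>a\<in>carrier_vec k. (X *\<^sub>v a) \<bullet> (X *\<^sub>v b) = 0)")
    case False
    then show ?thesis by (intro witt_nondegenerate_odd[OF odd X Y gram ker]) blast
  next
    case True
    then obtain b where b: "b \<in> carrier_vec k" "X *\<^sub>v b \<noteq> 0\<^sub>v m"
      and deg: "\<And>a. a \<in> carrier_vec k \<Longrightarrow> (X *\<^sub>v a) \<bullet> (X *\<^sub>v b) = 0" by blast
    have deg': "(Y *\<^sub>v a) \<bullet> (Y *\<^sub>v b) = 0" if "a \<in> carrier_vec k" for a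
      using same_gramD[OF gram X that b(1)] deg[OF that] by simp
    define w where "w = Y *\<^sub>v b"
    have w: "w \<in> carrier_vec m" using Y b by (auto simp: w_def)
    have "X *\<^sub>v b \<in> carrier_vec m" using X b by auto
    then obtain z where z: "z \<in> carrier_vec m" "z \<bullet> (X *\<^sub>v b) = 1" using exists_scalar_prod_1 b(2) by blast
    obtain v where v: "v \<in> carrier_vec m"
      and dual_v: "\<And>a. a \<in> carrier_vec k \<Longrightarrow> v \<bullet> (Y *\<^sub>v a) = z \<bullet> (X *\<^sub>v a)"
      using dual_vector[OF X Y ker(2) z(1)] by blast
    have vw: "v \<bullet> w = 1" using dual_v[OF b(1)] z by (simp add: w_def)
    \<comment> \<open>Adding \<open>t w\<close> to \<open>v\<close> changes the norm by
      \<open>2 t\<close>, because \<open>v \<bullet> w = 1\<close> and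
      \<open>w \<bullet> w = 0\<close>, and changes no product with the range of \<open>Y\<close>.
      So \<open>t\<close> is solved from \<open>2 t = z \<bullet> z - v \<bullet> v\<close>.\<close>
    define t where "t = inverse 2 * (z \<bullet> z - v \<bullet> v)"
    define z' where "z' = v + t \<cdot>\<^sub>v w"
    have z': "z' \<in> carrier_vec m" using v w by (simp add: z'_def)
    have dual: "z \<bullet> (X *\<^sub>v a) = z' \<bullet> (Y *\<^sub>v a)" if a: "a \<in> carrier_vec k" for a
    proof -
      have "w \<bullet> (Y *\<^sub>v a) = 0" using deg'[OF a] Y by (simp add: w_def scalar_prod_commute)
      then show ?thesis using v w Y a by (simp add: z'_def scalar_prod_simps dual_v)
    qed
    have "z' \<bullet> z' = v \<bullet> v + 2 * t"
      using v w vw deg'[OF b(1)]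
      by (simp add: z'_def scalar_prod_simps scalar_prod_commute[of w v] flip: w_def)
    moreover have "2 * t = z \<bullet> z - v \<bullet> v" unfolding t_def mult.assoc[symmetric] using odd by simp
    ultimately have norm: "z \<bullet> z = z' \<bullet> z'" by simp
    have new: "z \<noteq> X *\<^sub>v a" if "a \<in> carrier_vec k" for a using deg[OF that] z by auto
    have new': "z' \<noteq> Y *\<^sub>v a" if "a \<in> carrier_vec k" for a using deg'[OF that] z dual[OF b(1)] by auto
    note P = prepend_col_carrier[OF X, of z] prepend_col_carrier[OF Y, of z']
    have "\<exists>Q\<in>orthogonal_group m. \<forall>v\<in>carrier_vec (Suc k). Q *\<^sub>v (prepend_col z X *\<^sub>v v) = prepend_col z' Y *\<^sub>v v"
    proof (rule less.hyps[OF _ P])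
      show "card (range_complement (prepend_col z X)) < card (range_complement X)"
        by (rule card_range_complement_prepend[OF X z(1) new])
      show "same_gram (prepend_col z X) (prepend_col z' Y)" "kernel_subset (prepend_col z X) (prepend_col z' Y)"
        by (rule extend_isometry[OF X Y gram ker(1) z(1) z' dual norm new]; assumption)+
      show "kernel_subset (prepend_col z' Y) (prepend_col z X)"
        by (rule extend_isometry[OF Y X gram' ker(2) z' z(1) dual[symmetric] norm[symmetric] new']; assumption)
    qed
    then show ?thesis using isometry_of_prepend[OF X Y z(1) z'] by blast
  qed
qed

section \<open>Reducing the number of rows\<close>

text \<open>One row fewer is the right unit, as each reduction below deletes one coordinate. For
  zero rows the truncated subtraction makes \<open>X\<close> its own witness, so being
  incompressible forces a positive number of rows.\<close>

definition compressible :: "'a::field mat \<Rightarrow> bool" where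
  "compressible X \<longleftrightarrow> (\<exists>Z\<in>carrier_mat (dim_row X - 1) (dim_col X). same_gram X Z \<and> kernel_subset Z X)"

lemma compressibleI:
  "X \<in> carrier_mat m k \<Longrightarrow> Z \<in> carrier_mat (m - 1) k \<Longrightarrow> same_gram X Z \<Longrightarrow> kernel_subset Z X \<Longrightarrow> compressible X"
  by (auto simp: compressible_def)

lemma drop_zero_row:
  fixes X :: "'a::field mat"
  assumes X: "X \<in> carrier_mat m k" and j: "j < m"
    and zero: "\<And>a. a \<in> carrier_vec k \<Longrightarrow> (X *\<^sub>v a) $ j = 0"
  obtains Z where "Z \<in> carrier_mat (m - 1) k" "same_gram X Z" "kernel_subset Z X"
proof -
  \<comment> \<open>The increasing enumeration of the row indices other than
    \<open>j\<close>.\<close>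
  define skip where "skip i = (if i < j then i else Suc i)" for i
  have bij: "bij_betw skip {0..<m - 1} ({0..<m} - {j})"
  proof (rule bij_betw_imageI)
    show "inj_on skip {0..<m - 1}" by (auto simp: inj_on_def skip_def split: if_splits)
    show "skip ` {0..<m - 1} = {0..<m} - {j}"
    proof
      show "skip ` {0..<m - 1} \<subseteq> {0..<m} - {j}" using j by (auto simp: skip_def)
      show "{0..<m} - {j} \<subseteq> skip ` {0..<m - 1}"
      proof
        fix i assume i: "i \<in> {0..<m} - {j}"
        show "i \<in> skip ` {0..<m - 1}"
        proof (cases "i < j")
          case True
          then show ?thesis using i j by (intro image_eqI[of _ _ i]) (auto simp: skip_def)
        next
          case False
          then show ?thesis using i j by (intro image_eqI[of _ _ "i - 1"]) (auto simp: skip_def)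
        qed
      qed
    qed
  qed
  define Z where "Z = mat (m - 1) k (\<lambda>(i, c). X $$ (skip i, c))"
  have Z: "Z \<in> carrier_mat (m - 1) k" by (simp add: Z_def)
  have skip: "skip i < m" if "i < m - 1" for i using that j by (auto simp: skip_def)
  have Za: "(Z *\<^sub>v a) $ i = (X *\<^sub>v a) $ skip i" if "i < m - 1" "a \<in> carrier_vec k" for a i
    using that X skip[OF that(1)] by (simp add: Z_def scalar_prod_def)
  have dot: "(X *\<^sub>v a) \<bullet> (X *\<^sub>v b) = (Z *\<^sub>v a) \<bullet> (Z *\<^sub>v b)"
    if a: "a \<in> carrier_vec k" and b: "b \<in> carrier_vec k" for a b
  proof -
    have "(X *\<^sub>v a) \<bullet> (X *\<^sub>v b) = (\<Sum>i\<in>{0..<m}. (X *\<^sub>v a) $ i * (X *\<^sub>v b) $ i)"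
      using X by (simp add: scalar_prod_def)
    also have "\<dots> = (\<Sum>i\<in>{0..<m} - {j}. (X *\<^sub>v a) $ i * (X *\<^sub>v b) $ i)"
      using j zero[OF a] by (simp add: sum.remove[of _ j])
    also have "\<dots> = (\<Sum>i\<in>{0..<m - 1}. (X *\<^sub>v a) $ skip i * (X *\<^sub>v b) $ skip i)"
      by (rule sum.reindex_bij_betw[OF bij, symmetric])
    also have "\<dots> = (\<Sum>i\<in>{0..<m - 1}. (Z *\<^sub>v a) $ i * (Z *\<^sub>v b) $ i)"
      using a b by (intro sum.cong) (simp_all add: Za)
    also have "\<dots> = (Z *\<^sub>v a) \<bullet> (Z *\<^sub>v b)"
      using Z by (simp add: scalar_prod_def)
    finally show ?thesis .
  qed
  have ker: "X *\<^sub>v a = 0\<^sub>v m" if a: "a \<in> carrier_vec k" and 0: "Z *\<^sub>v a = 0\<^sub>v (m - 1)" for a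
  proof (rule eq_vecI)
    fix i assume "i < dim_vec (0\<^sub>v m)"
    then have i: "i < m" by simp
    show "(X *\<^sub>v a) $ i = 0\<^sub>v m $ i"
    proof (cases "i = j")
      case True
      then show ?thesis using zero[OF a] i by simp
    next
      case False
      then have "i \<in> skip ` {0..<m - 1}" using i bij by (simp add: bij_betw_def)
      then obtain l where l: "l < m - 1" "i = skip l" by auto
      then show ?thesis using Za[OF l(1) a] 0 i by simp
    qed
  qed (use X in simp)
  show thesis
  proof (rule that[OF Z])
    show "same_gram X Z" unfolding same_gram_def using X dot by simp
    show "kernel_subset Z X" unfolding kernel_subset_def using X Z ker by simp
  qed
qed

lemma compressible_unit_complement:
  fixes X :: "'a::field mat"
  assumes X: "X \<in> carrier_mat m k" and v: "v \<in> carrier_vec m" and norm: "v \<bullet> v = 1"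
    and ones: "v \<noteq> ones m" and orth: "\<And>a. a \<in> carrier_vec k \<Longrightarrow> v \<bullet> (X *\<^sub>v a) = 0"
  shows "compressible X"
proof -
  obtain j where j: "j < m" "v $ j \<noteq> 1" using v ones by (metis carrier_vecD dim_vec eq_vecI index_vec)
  let ?e = "unit_vec m j"
  obtain Q where Q: "Q \<in> orthogonal_group m" "Q *\<^sub>v v = ?e"
    using orthogonal_move[of v m ?e] v norm j by auto
  have Qc: "Q \<in> carrier_mat m m" by (rule orthogonal_group_carrier[OF Q(1)])
  have QX: "Q * X \<in> carrier_mat m k" using Qc X by (rule mult_carrier_mat)
  have QXa: "(Q * X) *\<^sub>v a = Q *\<^sub>v (X *\<^sub>v a)" if "a \<in> carrier_vec k" for a
    using Qc X that by (rule assoc_mult_mat_vec)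
  have Xc: "X *\<^sub>v a \<in> carrier_vec m" for a using X by (rule mult_mat_vec_in_carrier)
  have "((Q * X) *\<^sub>v a) $ j = 0" if a: "a \<in> carrier_vec k" for a
  proof -
    have "(Q *\<^sub>v v) \<bullet> (Q *\<^sub>v (X *\<^sub>v a)) = 0"
      using orthogonal_group_scalar_prod[OF Q(1) v Xc] orth[OF a] by simp
    then show ?thesis using j Qc mult_mat_vec_in_carrier[OF Qc, of "X *\<^sub>v a"]
      by (simp add: QXa a Q(2) del: index_mult_mat_vec)
  qed
  then obtain Z where Z: "Z \<in> carrier_mat (m - 1) k" "same_gram (Q * X) Z" "kernel_subset Z (Q * X)"
    using drop_zero_row[OF QX j(1)] by blast
  show ?thesis
  proof (rule compressibleI[OF X Z(1)])
    show "same_gram X Z"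
      unfolding same_gram_def using X same_gramD[OF Z(2) QX]
      by (simp add: QXa orthogonal_group_scalar_prod[OF Q(1) Xc Xc])
    show "kernel_subset Z X"
      unfolding kernel_subset_def
    proof (intro ballI impI)
      fix a assume "a \<in> carrier_vec (dim_col Z)" and 0: "Z *\<^sub>v a = 0\<^sub>v (dim_row Z)"
      then have a: "a \<in> carrier_vec k" using Z by simp
      have "Q *\<^sub>v (X *\<^sub>v a) = 0\<^sub>v m" using kernel_subsetD[OF Z(3,1) QX a] 0 Z a by (simp add: QXa)
      then have "X *\<^sub>v a = Q\<^sup>T *\<^sub>v 0\<^sub>v m" using orthogonal_group_inverse_vec[OF Q(1) Xc, of a] by simp
      then show "X *\<^sub>v a = 0\<^sub>v (dim_row X)" using X Qc by (simp add: mult_mat_vec_zero)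
    qed
  qed
qed

text \<open>Divides out the line of \<open>w\<close>. Subtracting from each \<open>X a\<close> the
  multiple of \<open>w\<close> that clears a fixed coordinate leaves the Gram matrix unchanged, as
  \<open>w\<close> is isotropic and orthogonal to the range; only vectors mapped into that line join
  the kernel.\<close>

lemma reduce_isotropic:
  fixes X :: "'a::field mat"
  assumes X: "X \<in> carrier_mat m k" and w: "w \<in> carrier_vec m" and nz: "w \<noteq> 0\<^sub>v m" and iso: "w \<bullet> w = 0"
    and orth: "\<And>a. a \<in> carrier_vec k \<Longrightarrow> w \<bullet> (X *\<^sub>v a) = 0"
  obtains Z where "Z \<in> carrier_mat (m - 1) k" "same_gram X Z"
    "\<And>a. a \<in> carrier_vec k \<Longrightarrow> Z *\<^sub>v a = 0\<^sub>v (m - 1) \<Longrightarrow> \<exists>t. X *\<^sub>v a = t \<cdot>\<^sub>v w"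
proof -
  obtain i where i: "i < m" "w $ i \<noteq> 0" using w nz by (metis carrier_vecD eq_vecI index_zero_vec)
  let ?p = "inverse (w $ i)"
  define X' where "X' = X - rank_one (?p \<cdot>\<^sub>v w) (row X i)"
  have r: "row X i \<in> carrier_vec k" using X i by auto
  have X': "X' \<in> carrier_mat m k" unfolding X'_def using r w by (intro minus_carrier_mat rank_one_carrier) auto
  have X'a: "X' *\<^sub>v a = X *\<^sub>v a - (?p * (X *\<^sub>v a) $ i) \<cdot>\<^sub>v w" if a: "a \<in> carrier_vec k" for a
    unfolding X'_def using a r w X i
    by (subst minus_mult_distrib_mat_vec[of _ m k]) (auto simp: rank_one_mult_vec[of _ k] smult_smult_assoc mult.commute)
  have Xc: "X *\<^sub>v a \<in> carrier_vec m" for a using X by (rule mult_mat_vec_in_carrier)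
  have "(X' *\<^sub>v a) $ i = 0" if a: "a \<in> carrier_vec k" for a
    unfolding X'a[OF a] using i w Xc[of a] X by (simp del: index_mult_mat_vec)
  then obtain Z where Z: "Z \<in> carrier_mat (m - 1) k" "same_gram X' Z" "kernel_subset Z X'"
    using drop_zero_row[OF X' i(1)] by blast
  show thesis
  proof (rule that[OF Z(1)])
    have "(X *\<^sub>v a) \<bullet> (X *\<^sub>v b) = (X' *\<^sub>v a) \<bullet> (X' *\<^sub>v b)" if "a \<in> carrier_vec k" "b \<in> carrier_vec k" for a b
      using that w X iso orth by (simp add: X'a scalar_prod_simps scalar_prod_commute[of "X *\<^sub>v a" w])
    then show "same_gram X Z" using same_gramD[OF Z(2) X'] X by (simp add: same_gram_def)
    fix a assume a: "a \<in> carrier_vec k" and "Z *\<^sub>v a = 0\<^sub>v (m - 1)"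
    then have "X' *\<^sub>v a = 0\<^sub>v m" using kernel_subsetD[OF Z(3,1) X'] by blast
    then have "X *\<^sub>v a = (?p * (X *\<^sub>v a) $ i) \<cdot>\<^sub>v w"
      using Xc w X'a[OF a] diff_vec_eq_zero_iff[of "X *\<^sub>v a" m] by simp
    then show "\<exists>t. X *\<^sub>v a = t \<cdot>\<^sub>v w" by blast
  qed
qed

text \<open>A vector \<open>b\<close> killed by \<open>Y\<close> but not by \<open>X\<close> makes
  \<open>X b\<close> isotropic and orthogonal to the range of \<open>X\<close>. Dividing it out of
  \<open>X\<close> produces a matrix that compresses \<open>Y\<close>.\<close>

lemma compressible_if_kernel_psubset:
  fixes X Y :: "'a::field mat"
  assumes X: "X \<in> carrier_mat m k" and Y: "Y \<in> carrier_mat m k" and gram: "same_gram X Y"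
    and ker: "kernel_subset X Y" and nker: "\<not> kernel_subset Y X"
  shows "compressible Y"
proof -
  obtain b where b: "b \<in> carrier_vec k" "Y *\<^sub>v b = 0\<^sub>v m" "X *\<^sub>v b \<noteq> 0\<^sub>v m"
    using nker X Y by (auto simp: kernel_subset_def)
  have Xc: "X *\<^sub>v a \<in> carrier_vec m" and Yc: "Y *\<^sub>v a \<in> carrier_vec m" for a
    using X Y by (auto intro: mult_mat_vec_in_carrier)
  have orth: "(X *\<^sub>v b) \<bullet> (X *\<^sub>v a) = 0" if a: "a \<in> carrier_vec k" for a
    using same_gramD[OF gram X b(1) a] b(2) Yc[of a] by simp
  obtain Z where Z: "Z \<in> carrier_mat (m - 1) k" "same_gram X Z"
    and Zker: "\<And>a. a \<in> carrier_vec k \<Longrightarrow> Z *\<^sub>v a = 0\<^sub>v (m - 1) \<Longrightarrow> \<exists>t. X *\<^sub>v a = t \<cdot>\<^sub>v (X *\<^sub>v b)"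
    using reduce_isotropic[OF X Xc b(3) orth[OF b(1)] orth] by blast
  have "Y *\<^sub>v a = 0\<^sub>v m" if a: "a \<in> carrier_vec k" and 0: "Z *\<^sub>v a = 0\<^sub>v (m - 1)" for a
  proof -
    obtain t where t: "X *\<^sub>v a = t \<cdot>\<^sub>v (X *\<^sub>v b)" using Zker[OF a 0] by blast
    \<comment> \<open>If \<open>X a = t X b\<close>, then \<open>a - t b\<close> is in the kernel of
      \<open>X\<close>, hence of \<open>Y\<close>, which kills \<open>b\<close> as well.\<close>
    have "X *\<^sub>v (a - t \<cdot>\<^sub>v b) = 0\<^sub>v m" using a b(1) X t by (simp add: mult_mat_vec_simps)
    then have "Y *\<^sub>v (a - t \<cdot>\<^sub>v b) = 0\<^sub>v m" using a b(1) by (intro kernel_subsetD[OF ker X Y]) auto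
    then have "Y *\<^sub>v a - t \<cdot>\<^sub>v (Y *\<^sub>v b) = 0\<^sub>v m" using a b(1) Y by (simp add: mult_mat_vec_simps)
    then have "Y *\<^sub>v a = t \<cdot>\<^sub>v (Y *\<^sub>v b)" using Yc diff_vec_eq_zero_iff[of "Y *\<^sub>v a" m "t \<cdot>\<^sub>v (Y *\<^sub>v b)"] by simp
    then show ?thesis by (auto simp: b(2))
  qed
  then have "kernel_subset Z Y" using Y Z by (simp add: kernel_subset_def)
  moreover have "same_gram Y Z" using gram Z(2) X Y by (simp add: same_gram_def)
  ultimately show ?thesis using compressibleI[OF Y Z(1)] by blast
qed

lemma mult_inverse_vec:
  fixes T S :: "'a::semiring_1 mat"
  assumes "T \<in> carrier_mat k k" "S \<in> carrier_mat k k" "T * S = 1\<^sub>m k" "a \<in> carrier_vec k"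
  shows "T *\<^sub>v (S *\<^sub>v a) = a"
  using assoc_mult_mat_vec[OF assms(1,2,4)] assms by simp

text \<open>A compression of \<open>X T\<close> is carried back by the inverse of \<open>T\<close>,
  so incompressibility survives a change of coefficient coordinates.\<close>

lemma compressible_mult:
  fixes X :: "'a::field mat"
  assumes X: "X \<in> carrier_mat m k" and T: "T \<in> carrier_mat k k" and S: "S \<in> carrier_mat k k"
    and TS: "T * S = 1\<^sub>m k" and compr: "compressible (X * T)"
  shows "compressible X"
proof -
  have XT: "X * T \<in> carrier_mat m k" using X T by (rule mult_carrier_mat)
  obtain Z where Z: "Z \<in> carrier_mat (m - 1) k" "same_gram (X * T) Z" "kernel_subset Z (X * T)"
    using compr unfolding compressible_def carrier_matD[OF XT] by blast
  have eq: "(X * T) * S = X" using X T S TS by (simp add: assoc_mult_mat[of _ m k _ k _ k])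
  have "same_gram X (Z * S)" "kernel_subset (Z * S) X"
    using same_gram_mult[OF Z(2) XT Z(1) S] kernel_subset_mult[OF Z(3,1) XT S] by (simp_all add: eq)
  then show ?thesis using mult_carrier_mat[OF Z(1) S] by (intro compressibleI[OF X])
qed

section \<open>Equivalence of incompressible matrices with the same Gram matrix\<close>

text \<open>The Sherman-Morrison formula gives the inverse.\<close>

lemma rank_one_update_invertible:
  fixes x d :: "'a::field vec"
  assumes x: "x \<in> carrier_vec k" and d: "d \<in> carrier_vec k" and nz: "1 + x \<bullet> d \<noteq> 0"
  obtains T S where "T \<in> carrier_mat k k" "S \<in> carrier_mat k k" "T * S = 1\<^sub>m k" "S * T = 1\<^sub>m k"
    "\<And>a. a \<in> carrier_vec k \<Longrightarrow> T *\<^sub>v a = a + (x \<bullet> a) \<cdot>\<^sub>v d"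
proof -
  define T where "T = 1\<^sub>m k + rank_one d x"
  define S where "S = 1\<^sub>m k - rank_one (inverse (1 + x \<bullet> d) \<cdot>\<^sub>v d) x"
  have T: "T \<in> carrier_mat k k" and S: "S \<in> carrier_mat k k"
    unfolding T_def S_def using x d by (auto intro!: add_carrier_mat minus_carrier_mat rank_one_carrier)
  have Ta: "T *\<^sub>v a = a + (x \<bullet> a) \<cdot>\<^sub>v d" if "a \<in> carrier_vec k" for a
    unfolding T_def using that x d
    by (subst add_mult_distrib_mat_vec[of _ k k]) (auto simp: rank_one_mult_vec[of _ k])
  have Sa: "S *\<^sub>v a = a - ((x \<bullet> a) * inverse (1 + x \<bullet> d)) \<cdot>\<^sub>v d" if "a \<in> carrier_vec k" for a
    unfolding S_def using that x d
    by (subst minus_mult_distrib_mat_vec[of _ k k]) (auto simp: rank_one_mult_vec[of _ k] smult_smult_assoc)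
  have "S * T = 1\<^sub>m k"
  proof (rule mat_eq_by_vecI[of _ k k])
    fix a :: "'a vec" assume a: "a \<in> carrier_vec k"
    have "(S * T) *\<^sub>v a = S *\<^sub>v (T *\<^sub>v a)" using S T a by (rule assoc_mult_mat_vec)
    also have "\<dots> = a + (x \<bullet> a) \<cdot>\<^sub>v d - ((x \<bullet> (a + (x \<bullet> a) \<cdot>\<^sub>v d)) * inverse (1 + x \<bullet> d)) \<cdot>\<^sub>v d"
      using a d by (simp add: Ta Sa)
    also have "x \<bullet> (a + (x \<bullet> a) \<cdot>\<^sub>v d) = (x \<bullet> a) * (1 + x \<bullet> d)"
      using a d x by (simp add: scalar_prod_simps distrib_left)
    finally show "(S * T) *\<^sub>v a = 1\<^sub>m k *\<^sub>v a" using nz a d by (auto intro!: eq_vecI)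
  qed (use S T in auto)
  then show thesis using that[OF T S _ _ Ta] mat_mult_left_right_inverse[OF S T] by blast
qed

text \<open>While neither kernel contains the other, a transvection moves a vector killed only by
  \<open>Y\<close> into the common kernel without losing anything already there. The measure counts
  the vectors outside the common kernel.\<close>

lemma align_kernels:
  fixes X Y :: "'a::{field,finite} mat"
  assumes "X \<in> carrier_mat m k" and Y: "Y \<in> carrier_mat l k" and "same_gram X Y"
  shows "\<exists>T\<in>carrier_mat k k. \<exists>S\<in>carrier_mat k k. T * S = 1\<^sub>m k \<and> S * T = 1\<^sub>m k \<and> same_gram (X * T) Y \<and>
    (kernel_subset (X * T) Y \<or> kernel_subset Y (X * T))"
  using assms(1,3)
proof (induction "card {a \<in> carrier_vec k. X *\<^sub>v a \<noteq> 0\<^sub>v m \<or> Y *\<^sub>v a \<noteq> 0\<^sub>v l}" arbitrary: X rule: less_induct)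
  case less
  note X = less.prems(1) and gram = less.prems(2)
  show ?case
  proof (cases "kernel_subset X Y \<or> kernel_subset Y X")
    case True
    then show ?thesis using X gram by (intro bexI[of _ "1\<^sub>m k"]) auto
  next
    case False
    then obtain a b where a: "a \<in> carrier_vec k" "X *\<^sub>v a = 0\<^sub>v m" "Y *\<^sub>v a \<noteq> 0\<^sub>v l"
      and b: "b \<in> carrier_vec k" "Y *\<^sub>v b = 0\<^sub>v l" "X *\<^sub>v b \<noteq> 0\<^sub>v m"
      using X Y by (auto simp: kernel_subset_def)
    have Xc: "X *\<^sub>v a \<in> carrier_vec m" and Yc: "Y *\<^sub>v a \<in> carrier_vec l" for a
      using X Y by (auto intro: mult_mat_vec_in_carrier)
    obtain g where g: "g \<in> carrier_vec m" "g \<bullet> (X *\<^sub>v b) = 1" using exists_scalar_prod_1[OF Xc b(3)] by blast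
    obtain h where h: "h \<in> carrier_vec l" "h \<bullet> (Y *\<^sub>v a) = 1" using exists_scalar_prod_1[OF Yc a(3)] by blast
    \<comment> \<open>The functional \<open>x\<close> takes the value 1 at \<open>a\<close> and at
      \<open>b\<close>, where only one summand contributes, and vanishes on the common
      kernel.\<close>
    define x where "x = X\<^sup>T *\<^sub>v g + Y\<^sup>T *\<^sub>v h"
    have Xg: "X\<^sup>T *\<^sub>v g \<in> carrier_vec k" and Yh: "Y\<^sup>T *\<^sub>v h \<in> carrier_vec k"
      using X Y by (auto intro: mult_mat_vec_in_carrier)
    have x: "x \<in> carrier_vec k" using Xg Yh by (simp add: x_def)
    have xy: "x \<bullet> y = g \<bullet> (X *\<^sub>v y) + h \<bullet> (Y *\<^sub>v y)" if y: "y \<in> carrier_vec k" for y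
      using scalar_prod_transpose(1)[OF X y g(1)] scalar_prod_transpose(1)[OF Y y h(1)] Xg Yh y X Y
      by (simp add: x_def scalar_prod_simps)
    \<comment> \<open>As \<open>x \<bullet> d = 0\<close>, the update by \<open>d\<close> is a
      transvection. It subtracts multiples of \<open>X b\<close> from the range of \<open>X\<close>;
      this vector is orthogonal to the range because \<open>Y b = 0\<close>, so the Gram matrix
      stays. Since \<open>x \<bullet> b = 1\<close>, the new matrix kills \<open>b\<close>.\<close>
    define d where "d = a - b"
    have d: "d \<in> carrier_vec k" using a b by (simp add: d_def)
    have xa: "x \<bullet> a = 1" and xb: "x \<bullet> b = 1" using a b g h by (auto simp: xy)
    have "x \<bullet> d = 0" using a b x xa xb by (simp add: d_def scalar_prod_simps)
    then obtain T S where T: "T \<in> carrier_mat k k" and S: "S \<in> carrier_mat k k"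
      and TS: "T * S = 1\<^sub>m k" "S * T = 1\<^sub>m k" and Ty: "\<And>y. y \<in> carrier_vec k \<Longrightarrow> T *\<^sub>v y = y + (x \<bullet> y) \<cdot>\<^sub>v d"
      using rank_one_update_invertible[OF x d] by auto
    have XT: "X * T \<in> carrier_mat m k" using X T by (rule mult_carrier_mat)
    have XTy: "(X * T) *\<^sub>v y = X *\<^sub>v y - (x \<bullet> y) \<cdot>\<^sub>v (X *\<^sub>v b)" if y: "y \<in> carrier_vec k" for y
    proof -
      have "(X * T) *\<^sub>v y = X *\<^sub>v y + (x \<bullet> y) \<cdot>\<^sub>v (0\<^sub>v m - X *\<^sub>v b)"
        using assoc_mult_mat_vec[OF X T y] a b X y by (simp add: Ty d_def mult_mat_vec_simps)
      then show ?thesis using X by (auto intro!: eq_vecI)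
    qed
    have iso: "(X *\<^sub>v b) \<bullet> (X *\<^sub>v y) = 0" if y: "y \<in> carrier_vec k" for y
      using same_gramD[OF gram X b(1) y] b(2) Yc[of y] by simp
    have "((X * T) *\<^sub>v y) \<bullet> ((X * T) *\<^sub>v z) = (X *\<^sub>v y) \<bullet> (X *\<^sub>v z)"
      if "y \<in> carrier_vec k" "z \<in> carrier_vec k" for y z
      using that X b by (simp add: XTy scalar_prod_simps iso scalar_prod_commute[of "X *\<^sub>v y" "X *\<^sub>v b"])
    then have gramT: "same_gram (X * T) Y" using same_gramD[OF gram X] unfolding same_gram_def carrier_matD[OF XT] by simp
    let ?N = "\<lambda>X. {a \<in> carrier_vec k. X *\<^sub>v a \<noteq> 0\<^sub>v m \<or> Y *\<^sub>v a \<noteq> 0\<^sub>v l}"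
    have "(X * T) *\<^sub>v b = 0\<^sub>v m" using b xb X by (simp add: XTy)
    then have "b \<in> ?N X" "b \<notin> ?N (X * T)" using b by auto
    moreover have "?N (X * T) \<subseteq> ?N X"
    proof
      fix y assume y: "y \<in> ?N (X * T)"
      show "y \<in> ?N X"
      proof (rule ccontr)
        assume "y \<notin> ?N X"
        then have 0: "X *\<^sub>v y = 0\<^sub>v m" "Y *\<^sub>v y = 0\<^sub>v l" "y \<in> carrier_vec k" using y by auto
        then have "x \<bullet> y = 0" using g h by (simp add: xy)
        then have "(X * T) *\<^sub>v y = 0\<^sub>v m" using 0 X by (simp add: XTy zero_smult_vec)
        then show False using y 0 by auto
      qed
    qed
    ultimately have "card (?N (X * T)) < card (?N X)"
      by (intro psubset_card_mono) (auto intro: finite_subset[OF _ finite_carrier_vec[of k]])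
    from less.hyps[OF this XT gramT] obtain T' S' where T': "T' \<in> carrier_mat k k" "S' \<in> carrier_mat k k"
      "T' * S' = 1\<^sub>m k" "S' * T' = 1\<^sub>m k" "same_gram (X * T * T') Y"
      "kernel_subset (X * T * T') Y \<or> kernel_subset Y (X * T * T')" by blast
    have "T * T' * (S' * S) = T * (T' * S') * S" "S' * S * (T * T') = S' * (S * T) * T'"
      using T S T'(1,2) by (simp_all add: assoc_mult_mat[of _ k k _ k _ k] mult_carrier_mat[of _ k k])
    then have "T * T' * (S' * S) = 1\<^sub>m k" "S' * S * (T * T') = 1\<^sub>m k"
      using TS T' T S by simp_all
    moreover have "X * T * T' = X * (T * T')" using X T T'(1) by (rule assoc_mult_mat)
    ultimately show ?thesis
      using T'(5,6) mult_carrier_mat[OF T T'(1)] mult_carrier_mat[OF T'(2) S]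
      by (intro bexI[of _ "T * T'"] bexI[of _ "S' * S"]) simp_all
  qed
qed

lemma square_injective_char_2:
  fixes p q :: "'a::field"
  assumes "(2::'a) = 0" "p\<^sup>2 = q\<^sup>2"
  shows "p = q"
proof -
  have "(p - q)\<^sup>2 = p\<^sup>2 + q\<^sup>2 - 2 * p * q" by (rule power2_diff)
  also have "\<dots> = 2 * q\<^sup>2" using assms by simp
  finally show ?thesis using assms(1) by simp
qed

text \<open>The norms of \<open>X a\<close> and \<open>Y a\<close> agree and are the squares of
  these two products; squaring is injective in characteristic 2.\<close>

lemma same_gram_ones:
  fixes X Y :: "'a::field mat"
  assumes char: "(2::'a) = 0" and X: "X \<in> carrier_mat m k" and Y: "Y \<in> carrier_mat m k"
    and gram: "same_gram X Y" and a: "a \<in> carrier_vec k"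
  shows "ones m \<bullet> (X *\<^sub>v a) = ones m \<bullet> (Y *\<^sub>v a)"
proof (rule square_injective_char_2[OF char])
  show "(ones m \<bullet> (X *\<^sub>v a))\<^sup>2 = (ones m \<bullet> (Y *\<^sub>v a))\<^sup>2"
    using same_gramD[OF gram X a a] norm_char_2[OF char mult_mat_vec_in_carrier[OF X, of a]]
      norm_char_2[OF char mult_mat_vec_in_carrier[OF Y, of a]] X Y
    by (simp add: scalar_prod_commute[of "ones m"])
qed

text \<open>The vector \<open>ones m\<close> can be adjoined to both ranges as its own partner: it
  lies outside them, having norm 1 while being orthogonal to them. Afterwards the isometry fixes it,
  as \<open>witt_extension_char_2\<close> demands.\<close>

lemma witt_ones_orthogonal:
  fixes X Y :: "'a::{field,finite} mat"
  assumes char: "(2::'a) = 0" and X: "X \<in> carrier_mat m k" and Y: "Y \<in> carrier_mat m k"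
    and gram: "same_gram X Y" and ker: "kernel_subset X Y" "kernel_subset Y X"
    and orth: "\<And>a. a \<in> carrier_vec k \<Longrightarrow> ones m \<bullet> (X *\<^sub>v a) = 0" and norm: "ones m \<bullet> ones m = (1::'a)"
  shows "\<exists>Q\<in>orthogonal_group m. \<forall>a\<in>carrier_vec k. Q *\<^sub>v (X *\<^sub>v a) = Y *\<^sub>v a"
proof -
  let ?z = "ones m :: 'a vec"
  have z: "?z \<in> carrier_vec m" by simp
  have gram': "same_gram Y X" using same_gram_sym[OF gram] X Y by simp
  have dual: "?z \<bullet> (X *\<^sub>v a) = ?z \<bullet> (Y *\<^sub>v a)" if "a \<in> carrier_vec k" for a
    by (rule same_gram_ones[OF char X Y gram that])
  have new: "?z \<noteq> X *\<^sub>v a" if "a \<in> carrier_vec k" for a using orth[OF that] norm by (metis zero_neq_one)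
  have new': "?z \<noteq> Y *\<^sub>v a" if "a \<in> carrier_vec k" for a
    using orth[OF that] dual[OF that] norm by (metis zero_neq_one)
  have "\<exists>Q\<in>orthogonal_group m. \<forall>v\<in>carrier_vec (Suc k). Q *\<^sub>v (prepend_col ?z X *\<^sub>v v) = prepend_col ?z Y *\<^sub>v v"
  proof (rule witt_extension_char_2[OF char prepend_col_carrier[OF X] prepend_col_carrier[OF Y]])
    show "same_gram (prepend_col ?z X) (prepend_col ?z Y)" "kernel_subset (prepend_col ?z X) (prepend_col ?z Y)"
      by (rule extend_isometry[OF X Y gram ker(1) z z dual refl new]; assumption)+
    show "kernel_subset (prepend_col ?z Y) (prepend_col ?z X)"
      by (rule extend_isometry[OF Y X gram' ker(2) z z dual[symmetric] refl new']; assumption)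
    show "vCons 1 (0\<^sub>v k) \<in> carrier_vec (Suc k)" by simp
    show "prepend_col ?z X *\<^sub>v vCons 1 (0\<^sub>v k) = ?z" "prepend_col ?z Y *\<^sub>v vCons 1 (0\<^sub>v k) = ?z"
      using X Y by (auto simp: prepend_col_mult_vec[of _ m k] mult_mat_vec_zero)
  qed
  then show ?thesis using isometry_of_prepend[OF X Y z z] by blast
qed

text \<open>If \<open>ones m\<close> is outside the range, some vector of the complement has product
  1 with it and therefore norm 1. Incompressibility leaves \<open>ones m\<close> as the only such
  vector, so it lies in the complement itself.\<close>

lemma incompressible_ones:
  fixes X :: "'a::field mat"
  assumes char: "(2::'a) = 0" and X: "X \<in> carrier_mat m k" and incompr: "\<not> compressible X"
    and ones: "\<And>a. a \<in> carrier_vec k \<Longrightarrow> X *\<^sub>v a \<noteq> ones m"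
  shows "ones m \<bullet> ones m = (1::'a)" "\<And>a. a \<in> carrier_vec k \<Longrightarrow> ones m \<bullet> (X *\<^sub>v a) = 0"
proof -
  let ?z = "ones m :: 'a vec"
  have z: "?z \<in> carrier_vec m" by simp
  have "\<exists>y\<in>range_complement X. ?z \<bullet> y \<noteq> 0"
  proof (rule ccontr)
    assume "\<not> (\<exists>y\<in>range_complement X. ?z \<bullet> y \<noteq> 0)"
    then have "?z \<bullet> y = 0" if "y \<in> range_complement X" for y using that by blast
    then obtain a where "a \<in> carrier_vec k" "?z = X *\<^sub>v a" by (rule in_rangeI[OF X z])
    then show False using ones by metis
  qed
  then obtain y where y: "y \<in> range_complement X" "?z \<bullet> y \<noteq> 0" by blast
  have yc: "y \<in> carrier_vec m" and y_orth: "\<And>a. a \<in> carrier_vec k \<Longrightarrow> y \<bullet> (X *\<^sub>v a) = 0"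
    using y X by (auto simp: range_complement_def)
  define v where "v = inverse (?z \<bullet> y) \<cdot>\<^sub>v y"
  have v: "v \<in> carrier_vec m" using yc by (simp add: v_def)
  have v_orth: "v \<bullet> (X *\<^sub>v a) = 0" if "a \<in> carrier_vec k" for a
    using y_orth[OF that] yc X by (simp add: v_def scalar_prod_smult)
  have "v \<bullet> ?z = 1" using y(2) yc by (simp add: v_def scalar_prod_smult scalar_prod_commute[of y])
  then have norm: "v \<bullet> v = 1" using norm_char_2[OF char v] by simp
  have "v = ?z" using compressible_unit_complement[OF X v norm _ v_orth] incompr by blast
  then show "?z \<bullet> ?z = 1" "\<And>a. a \<in> carrier_vec k \<Longrightarrow> ?z \<bullet> (X *\<^sub>v a) = 0" using norm v_orth by simp_all
qed

text \<open>Two hyperplanes through zero do not cover the space, even over the field with two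
  elements: a vector off the first, one off the second, or their sum avoids both.\<close>

lemma exists_two_nonzero_scalar_prods:
  fixes p q :: "'a::field vec"
  assumes p: "p \<in> carrier_vec m" "p \<noteq> 0\<^sub>v m" and q: "q \<in> carrier_vec m" "q \<noteq> 0\<^sub>v m"
  obtains g where "g \<in> carrier_vec m" "g \<bullet> p = 1" "g \<bullet> q \<noteq> 0"
proof -
  obtain e where e: "e \<in> carrier_vec m" "e \<bullet> p = 1" using exists_scalar_prod_1[OF p] by blast
  obtain f where f: "f \<in> carrier_vec m" "f \<bullet> q = 1" using exists_scalar_prod_1[OF q] by blast
  consider "e \<bullet> q \<noteq> 0" | "f \<bullet> p \<noteq> 0" | "e \<bullet> q = 0" "f \<bullet> p = 0" by blast
  then show thesis
  proof cases
    case 1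
    then show thesis using that e by blast
  next
    case 2
    then show thesis using f p q by (intro that[of "inverse (f \<bullet> p) \<cdot>\<^sub>v f"]) (auto simp: scalar_prod_smult)
  next
    case 3
    then show thesis using e f p q by (intro that[of "e + f"]) (auto simp: scalar_prod_simps)
  qed
qed

text \<open>If \<open>X c = Y c' = ones\<close>, the transvection \<open>T\<close> mapping \<open>c\<close> to \<open>c'\<close> preserves the Gram matrix of \<open>Y\<close>,
  because \<open>Y (c' - c)\<close> is orthogonal to the range of \<open>Y\<close>.\<close>

lemma witt_ones_in_ranges:
  fixes X Y :: "'a::{field,finite} mat"
  assumes char: "(2::'a) = 0" and X: "X \<in> carrier_mat m k" and Y: "Y \<in> carrier_mat m k" and m: "m > 0"
    and gram: "same_gram X Y" and ker: "kernel_subset X Y" "kernel_subset Y X"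
    and c: "c \<in> carrier_vec k" "X *\<^sub>v c = ones m" and c': "c' \<in> carrier_vec k" "Y *\<^sub>v c' = ones m"
  obtains T S Q where "T \<in> carrier_mat k k" "S \<in> carrier_mat k k" "T * S = 1\<^sub>m k" "S * T = 1\<^sub>m k"
    "Q \<in> orthogonal_group m" "\<And>a. a \<in> carrier_vec k \<Longrightarrow> Q *\<^sub>v (X *\<^sub>v a) = Y *\<^sub>v (T *\<^sub>v a)"
proof -
  let ?z = "ones m :: 'a vec"
  have Xc: "X *\<^sub>v a \<in> carrier_vec m" and Yc: "Y *\<^sub>v a \<in> carrier_vec m" for a
    using X Y by (auto intro: mult_mat_vec_in_carrier)
  have "?z $ 0 = 1" using m by simp
  then have z: "?z \<noteq> 0\<^sub>v m" using m by (metis index_zero_vec(1) zero_neq_one)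
  have "X *\<^sub>v c' \<noteq> 0\<^sub>v m" using kernel_subsetD[OF ker(1) X Y c'(1)] c'(2) z by metis
  \<comment> \<open>The value 1 at \<open>ones m\<close> makes \<open>x \<bullet> c = 1\<close>,
    hence \<open>T c = c'\<close>; the nonzero value at \<open>X c'\<close> makes
    \<open>1 + x \<bullet> d = x \<bullet> c'\<close> nonzero, hence \<open>T\<close> invertible. As
    \<open>x\<close> factors through \<open>X\<close>, it vanishes on the kernel of
    \<open>X\<close>.\<close>
  then obtain g where g: "g \<in> carrier_vec m" "g \<bullet> ?z = 1" "g \<bullet> (X *\<^sub>v c') \<noteq> 0"
    using exists_two_nonzero_scalar_prods[OF _ z Xc] by (metis vec_carrier)
  define x where "x = X\<^sup>T *\<^sub>v g"
  have x: "x \<in> carrier_vec k" unfolding x_def using X by (auto intro: mult_mat_vec_in_carrier)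
  have xa: "x \<bullet> a = g \<bullet> (X *\<^sub>v a)" if "a \<in> carrier_vec k" for a
    unfolding x_def by (rule scalar_prod_transpose(1)[OF X that g(1)])
  define d where "d = c' - c"
  have d: "d \<in> carrier_vec k" using c c' by (simp add: d_def)
  have xd: "1 + x \<bullet> d = x \<bullet> c'" using c c' x g by (simp add: d_def scalar_prod_simps xa)
  have xc': "x \<bullet> c' \<noteq> 0" using g c' by (simp add: xa)
  obtain T S where T: "T \<in> carrier_mat k k" and S: "S \<in> carrier_mat k k"
    and TS: "T * S = 1\<^sub>m k" "S * T = 1\<^sub>m k" and Ta: "\<And>a. a \<in> carrier_vec k \<Longrightarrow> T *\<^sub>v a = a + (x \<bullet> a) \<cdot>\<^sub>v d"
    using rank_one_update_invertible[OF x d] xd xc' by metis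
  have Tc: "T *\<^sub>v a \<in> carrier_vec k" for a using T by (rule mult_mat_vec_in_carrier)
  have YT: "Y * T \<in> carrier_mat m k" using Y T by (rule mult_carrier_mat)
  have YTa: "(Y * T) *\<^sub>v a = Y *\<^sub>v (T *\<^sub>v a)" if "a \<in> carrier_vec k" for a
    using Y T that by (rule assoc_mult_mat_vec)
  \<comment> \<open>Since \<open>Y c' = ones m = X c\<close>, this compares
    \<open>ones m \<bullet> Y a\<close> with \<open>ones m \<bullet> X a\<close>, and these are
    equal by \<open>same_gram_ones\<close>.\<close>
  have Yd: "(Y *\<^sub>v d) \<bullet> (Y *\<^sub>v a) = 0" if a: "a \<in> carrier_vec k" for a
  proof -
    have "(Y *\<^sub>v d) \<bullet> (Y *\<^sub>v a) = ?z \<bullet> (Y *\<^sub>v a) - (X *\<^sub>v c) \<bullet> (X *\<^sub>v a)"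
      using c c' Y a same_gramD[OF gram X c(1) a] by (simp add: d_def mult_mat_vec_simps scalar_prod_simps)
    then show ?thesis using same_gram_ones[OF char X Y gram a] c by simp
  qed
  have YT_eq: "Y *\<^sub>v (T *\<^sub>v a) = Y *\<^sub>v a + (x \<bullet> a) \<cdot>\<^sub>v (Y *\<^sub>v d)" if "a \<in> carrier_vec k" for a
    using that d Y by (simp add: Ta mult_mat_vec_simps)
  have "same_gram X (Y * T)"
    unfolding same_gram_def
  proof (intro ballI)
    fix a b :: "'a vec" assume "a \<in> carrier_vec (dim_col X)" "b \<in> carrier_vec (dim_col X)"
    then have ab: "a \<in> carrier_vec k" "b \<in> carrier_vec k" using X by auto
    show "(X *\<^sub>v a) \<bullet> (X *\<^sub>v b) = ((Y * T) *\<^sub>v a) \<bullet> ((Y * T) *\<^sub>v b)"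
      using ab Y d same_gramD[OF gram X ab]
      by (simp add: YTa YT_eq scalar_prod_simps Yd scalar_prod_commute[of "Y *\<^sub>v a" "Y *\<^sub>v d"])
  qed
  moreover have "kernel_subset X (Y * T)"
    unfolding kernel_subset_def
  proof (intro ballI impI)
    fix a assume "a \<in> carrier_vec (dim_col X)" and 0: "X *\<^sub>v a = 0\<^sub>v (dim_row X)"
    then have a: "a \<in> carrier_vec k" using X by simp
    have "x \<bullet> a = 0" "Y *\<^sub>v a = 0\<^sub>v m" using 0 X a g kernel_subsetD[OF ker(1) X Y a] by (auto simp: xa)
    then show "(Y * T) *\<^sub>v a = 0\<^sub>v (dim_row (Y * T))" using a Y by (simp add: YTa YT_eq zero_smult_vec)
  qed
  moreover have "kernel_subset (Y * T) X"
    unfolding kernel_subset_def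
  proof (intro ballI impI)
    fix a assume "a \<in> carrier_vec (dim_col (Y * T))" and 0: "(Y * T) *\<^sub>v a = 0\<^sub>v (dim_row (Y * T))"
    then have a: "a \<in> carrier_vec k" using T by simp
    have XT: "X *\<^sub>v (T *\<^sub>v a) = 0\<^sub>v m" using 0 Y a by (intro kernel_subsetD[OF ker(2) Y X Tc]) (simp add: YTa)
    have "x \<bullet> (T *\<^sub>v a) = 0" using XT g by (simp add: xa Tc)
    \<comment> \<open>The factor is nonzero, so \<open>T a\<close> in the kernel of \<open>X\<close>
      forces \<open>x \<bullet> a = 0\<close>, and then \<open>T\<close> fixes
      \<open>a\<close>.\<close>
    moreover have "x \<bullet> (T *\<^sub>v a) = (x \<bullet> a) * (1 + x \<bullet> d)"
      using a d x by (simp add: Ta scalar_prod_simps distrib_left)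
    ultimately have "x \<bullet> a = 0" using xd xc' by simp
    then have "T *\<^sub>v a = a" using a d by (simp add: Ta zero_smult_vec)
    then show "X *\<^sub>v a = 0\<^sub>v (dim_row X)" using XT X by simp
  qed
  moreover have "(Y * T) *\<^sub>v c = ?z"
  proof -
    have "T *\<^sub>v c = c + (c' - c)" using c g by (simp add: Ta xa d_def)
    also have "\<dots> = c'" using c c' by (intro eq_vecI) auto
    finally show ?thesis using c c' by (simp add: YTa)
  qed
  ultimately obtain Q where "Q \<in> orthogonal_group m" "\<forall>a\<in>carrier_vec k. Q *\<^sub>v (X *\<^sub>v a) = (Y * T) *\<^sub>v a"
    using witt_extension_char_2[OF char X YT _ _ _ c] by blast
  then show thesis using that[OF T S TS] by (simp add: YTa)
qed

theorem incompressible_equivalent: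
  fixes X Y :: "'a::{field,finite} mat"
  assumes X: "X \<in> carrier_mat m k" and Y: "Y \<in> carrier_mat m k" and m: "m > 0"
    and gram: "same_gram X Y" and incompr: "\<not> compressible X" "\<not> compressible Y"
  obtains T S Q where "T \<in> carrier_mat k k" "S \<in> carrier_mat k k" "T * S = 1\<^sub>m k" "S * T = 1\<^sub>m k"
    "Q \<in> orthogonal_group m" "\<And>a. a \<in> carrier_vec k \<Longrightarrow> Q *\<^sub>v (X *\<^sub>v (T *\<^sub>v a)) = Y *\<^sub>v a"
proof -
  note equivI = that
  obtain T S where T: "T \<in> carrier_mat k k" and S: "S \<in> carrier_mat k k"
    and TS: "T * S = 1\<^sub>m k" "S * T = 1\<^sub>m k" and gramT: "same_gram (X * T) Y"
    and comparable: "kernel_subset (X * T) Y \<or> kernel_subset Y (X * T)"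
    using align_kernels[OF X Y gram] by blast
  have XT: "X * T \<in> carrier_mat m k" using X T by (rule mult_carrier_mat)
  have XTa: "(X * T) *\<^sub>v a = X *\<^sub>v (T *\<^sub>v a)" if "a \<in> carrier_vec k" for a
    using X T that by (rule assoc_mult_mat_vec)
  have incomprT: "\<not> compressible (X * T)" using compressible_mult[OF X T S TS(1)] incompr(1) by blast
  have gramT': "same_gram Y (X * T)" using same_gram_sym[OF gramT] XT Y T by simp
  \<comment> \<open>A strict inclusion in either direction would compress the matrix with the larger
    kernel.\<close>
  have ker: "kernel_subset (X * T) Y" "kernel_subset Y (X * T)"
    using comparable compressible_if_kernel_psubset[OF XT Y gramT] compressible_if_kernel_psubset[OF Y XT gramT']
      incompr(2) incomprT by blast+
  have direct: thesis
    if "\<exists>Q\<in>orthogonal_group m. \<forall>a\<in>carrier_vec k. Q *\<^sub>v ((X * T) *\<^sub>v a) = Y *\<^sub>v a"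
    using that equivI[OF T S TS] by (auto simp: XTa)
  show thesis
  proof (cases "(2::'a) = 0")
    case False
    then show thesis using direct witt_extension_odd[OF _ XT Y gramT ker] by blast
  next
    case char: True
    \<comment> \<open>If one range misses \<open>ones m\<close>, incompressibility makes this vector
      orthogonal to that range, and by \<open>same_gram_ones\<close> to the other one too. If both
      contain it, the coefficient vectors representing it are matched.\<close>
    consider (X) "\<And>a. a \<in> carrier_vec k \<Longrightarrow> (X * T) *\<^sub>v a \<noteq> ones m"
      | (Y) "\<And>a. a \<in> carrier_vec k \<Longrightarrow> Y *\<^sub>v a \<noteq> ones m"
      | (both) c c' where "c \<in> carrier_vec k" "(X * T) *\<^sub>v c = ones m" "c' \<in> carrier_vec k" "Y *\<^sub>v c' = ones m"
      by blast
    then show thesis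
    proof cases
      case X
      show thesis
        using incompressible_ones[OF char XT incomprT X]
        by (intro direct witt_ones_orthogonal[OF char XT Y gramT ker]) blast+
    next
      case 2: Y
      have "ones m \<bullet> ((X * T) *\<^sub>v a) = 0" if "a \<in> carrier_vec k" for a
        using incompressible_ones(2)[OF char Y incompr(2) 2 that] same_gram_ones[OF char XT Y gramT that] by simp
      then show thesis
        using incompressible_ones(1)[OF char Y incompr(2) 2]
        by (intro direct witt_ones_orthogonal[OF char XT Y gramT ker]) blast+
    next
      case both
      obtain T' S' Q where T': "T' \<in> carrier_mat k k" "S' \<in> carrier_mat k k" "T' * S' = 1\<^sub>m k" "S' * T' = 1\<^sub>m k"
        and Q: "Q \<in> orthogonal_group m" "\<And>a. a \<in> carrier_vec k \<Longrightarrow> Q *\<^sub>v ((X * T) *\<^sub>v a) = Y *\<^sub>v (T' *\<^sub>v a)"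
        using witt_ones_in_ranges[OF char XT Y m gramT ker both] by blast
      \<comment> \<open>The matching matrix \<open>T'\<close> acts on the side of \<open>Y\<close>;
        moving it across contributes its inverse \<open>S'\<close> to the change of coordinates for
        \<open>X\<close>.\<close>
      have "T * S' * (T' * S) = T * (S' * T') * S" "T' * S * (T * S') = T' * (S * T) * S'"
        using T S T'(1,2) by (simp_all add: assoc_mult_mat[of _ k k _ k _ k] mult_carrier_mat[of _ k k])
      then have inv: "T * S' * (T' * S) = 1\<^sub>m k" "T' * S * (T * S') = 1\<^sub>m k" using TS T' T S by simp_all
      have "Q *\<^sub>v (X *\<^sub>v ((T * S') *\<^sub>v a)) = Y *\<^sub>v a" if a: "a \<in> carrier_vec k" for a
      proof -
        have S'a: "S' *\<^sub>v a \<in> carrier_vec k" using T'(2) by (rule mult_mat_vec_in_carrier)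
        have "Q *\<^sub>v (X *\<^sub>v ((T * S') *\<^sub>v a)) = Q *\<^sub>v ((X * T) *\<^sub>v (S' *\<^sub>v a))"
          using assoc_mult_mat_vec[OF T T'(2) a] XTa[OF S'a] by simp
        also have "\<dots> = Y *\<^sub>v a" using Q(2)[OF S'a] mult_inverse_vec[OF T'(1-3) a] by simp
        finally show ?thesis .
      qed
      then show thesis
        using that[OF mult_carrier_mat[OF T T'(2)] mult_carrier_mat[OF T'(1) S] inv Q(1)] by blast
    qed
  qed
qed

section \<open>The image of \<open>phi\<close>\<close>

lemma mult_mat_vec_assoc:
  fixes A B :: "'a::semiring_0 mat"
  shows "dim_col A = dim_row B \<Longrightarrow> dim_vec v = dim_col B \<Longrightarrow> (A * B) *\<^sub>v v = A *\<^sub>v (B *\<^sub>v v)"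
  by (rule assoc_mult_mat_vec[of A "dim_row A" "dim_col A" B "dim_col B"]) (auto intro: carrier_matI carrier_vecI)

lemma mat_linear_mult_vec:
  fixes A B :: "'a::comm_ring_1 mat"
  assumes "dim_row B = dim_row A" "dim_col B = dim_col A" "dim_vec v = dim_col A"
  shows "(A + B) *\<^sub>v v = A *\<^sub>v v + B *\<^sub>v v" "(A - B) *\<^sub>v v = A *\<^sub>v v - B *\<^sub>v v"
  using assms by (auto intro!: eq_vecI simp: scalar_prod_def algebra_simps sum.distrib sum_subtractf)

lemma uminus_mult_vec:
  fixes A :: "'a::comm_ring_1 mat"
  assumes "dim_vec v = dim_col A"
  shows "(- A) *\<^sub>v v = - (A *\<^sub>v v)" "A *\<^sub>v (- v) = - (A *\<^sub>v v)"
  using assms by (auto intro!: eq_vecI simp: scalar_prod_def sum_negf)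

lemma zero_mat_mult_vec: "dim_vec v = l \<Longrightarrow> 0\<^sub>m k l *\<^sub>v v = (0\<^sub>v k :: 'a::comm_ring_1 vec)"
  by (auto intro!: eq_vecI simp: scalar_prod_def)

lemma transpose_mult_dim:
  fixes A B :: "'a::comm_semiring_0 mat"
  shows "dim_col A = dim_row B \<Longrightarrow> (A * B)\<^sup>T = B\<^sup>T * A\<^sup>T"
  by (rule transpose_mult[of A "dim_row A" "dim_col A" B "dim_col B"]) (auto intro: carrier_matI)

lemma transpose_linear:
  fixes A B :: "'a::comm_ring_1 mat"
  assumes "dim_row B = dim_row A" "dim_col B = dim_col A"
  shows "(A + B)\<^sup>T = A\<^sup>T + B\<^sup>T" "(A - B)\<^sup>T = A\<^sup>T - B\<^sup>T"
  using assms by (auto intro!: eq_matI)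

lemmas mat_action_simps = mult_mat_vec_assoc mat_linear_mult_vec uminus_mult_vec zero_mat_mult_vec
  transpose_mult_dim  transpose_linear mult_mat_vec_simps

lemma phi_carrier [simp]:
  "X \<in> carrier_mat k m \<Longrightarrow> Y \<in> carrier_mat k m \<Longrightarrow> phi X Y \<in> carrier_mat k k"
  unfolding phi_def by (intro add_carrier_mat) auto

lemma phi_linear:
  fixes X Y Z :: "'a::field mat"
  assumes "X \<in> carrier_mat k m" "Y \<in> carrier_mat k m" "Z \<in> carrier_mat k m"
  shows "phi X (Y + Z) = phi X Y + phi X Z" "phi X (Y - Z) = phi X Y - phi X Z"
  using assms
  by (auto intro!: mat_eq_by_vecI[of _ k k] eq_vecI simp: phi_def mat_action_simps simp del: index_mult_mat_vec)

lemma phi_left_mult: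
  fixes X Y P :: "'a::field mat"
  assumes "X \<in> carrier_mat k m" "Y \<in> carrier_mat k m" "P \<in> carrier_mat k k"
  shows "phi (P * X) (P * Y) = P * phi X Y * P\<^sup>T"
  using assms by (intro mat_eq_by_vecI[of _ k k]) (auto simp: phi_def mat_action_simps)

lemma orthogonal_group_cancel:
  assumes Q: "Q \<in> orthogonal_group m" and v: "dim_vec v = m"
  shows "Q *\<^sub>v (Q\<^sup>T *\<^sub>v v) = v"
  using orthogonal_group_inverse_vec[OF orthogonal_group_transpose[OF Q] carrier_vecI[OF v]] by simp

lemma gram_right_mult:
  fixes X Q :: "'a::field mat"
  assumes X: "X \<in> carrier_mat k m" and Y: "Y \<in> carrier_mat k m" and Q: "Q \<in> orthogonal_group m"
  shows "(X * Q) * (Y * Q)\<^sup>T = X * Y\<^sup>T"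
  using X Y orthogonal_group_carrier[OF Q]
  by (intro mat_eq_by_vecI[of _ k k]) (auto simp: mat_action_simps orthogonal_group_cancel[OF Q])

lemma phi_right_mult:
  fixes X Y Q :: "'a::field mat"
  assumes "X \<in> carrier_mat k m" "Y \<in> carrier_mat k m" "Q \<in> orthogonal_group m"
  shows "phi (X * Q) (Y * Q) = phi X Y"
  using assms by (simp add: phi_def gram_right_mult)

lemma left_kernel_iff:
  "X \<in> carrier_mat k m \<Longrightarrow> x \<in> left_kernel X \<longleftrightarrow> x \<in> carrier_vec k \<and> X\<^sup>T *\<^sub>v x = 0\<^sub>v m"
  by (auto simp: left_kernel_def row_mult_def)

text \<open>The necessary condition for membership in the image of \<open>phi X\<close>, whose
  converse is \<open>in_phi_image\<close>: each summand contains a factor \<open>X\<close> or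
  \<open>X\<^sup>T\<close> that meets \<open>u\<close> or \<open>v\<close>.\<close>

lemma phi_left_kernel:
  fixes X Y :: "'a::field mat"
  assumes X: "X \<in> carrier_mat k m" and Y: "Y \<in> carrier_mat k m"
    and u: "u \<in> left_kernel X" and v: "v \<in> left_kernel X"
  shows "u \<bullet> (phi X Y *\<^sub>v v) = 0"
proof -
  have uv: "u \<in> carrier_vec k" "v \<in> carrier_vec k" "X\<^sup>T *\<^sub>v u = 0\<^sub>v m" "X\<^sup>T *\<^sub>v v = 0\<^sub>v m"
    using u v X by (auto simp: left_kernel_iff)
  have Yv: "Y\<^sup>T *\<^sub>v v \<in> carrier_vec m" using Y by (auto intro: mult_mat_vec_in_carrier)
  have "phi X Y *\<^sub>v v = X *\<^sub>v (Y\<^sup>T *\<^sub>v v) + Y *\<^sub>v 0\<^sub>v m"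
    using X Y uv by (simp add: phi_def mat_action_simps)
  also have "\<dots> = X *\<^sub>v (Y\<^sup>T *\<^sub>v v)" using mult_mat_vec_in_carrier[OF X] by (simp add: mult_mat_vec_zero[OF Y])
  finally have "u \<bullet> (phi X Y *\<^sub>v v) = (X\<^sup>T *\<^sub>v u) \<bullet> (Y\<^sup>T *\<^sub>v v)"
    using scalar_prod_transpose(1)[OF X Yv uv(1)] scalar_prod_transpose[of "X" k m "Y\<^sup>T *\<^sub>v v" u] X Yv uv by simp
  then show ?thesis using uv(3) Yv by simp
qed

text \<open>With \<open>X T X = X\<close> and \<open>R = X T\<close>, the rows of \<open>1 - R\<close> lie in the left kernel of \<open>X\<close>. Hence \<open>M\<close> has
  no component in the corresponding corner and is of the form \<open>Z + Z\<^sup>T\<close> with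
  \<open>Z = R (N R\<^sup>T + M (1 - R)\<^sup>T)\<close>.\<close>

lemma in_phi_image:
  fixes X N M :: "'a::field mat"
  assumes X: "X \<in> carrier_mat k m" and N: "N \<in> carrier_mat k k" and M: "M = N + N\<^sup>T"
    and ker: "\<And>u v. u \<in> left_kernel X \<Longrightarrow> v \<in> left_kernel X \<Longrightarrow> u \<bullet> (M *\<^sub>v v) = 0"
  shows "\<exists>S\<in>carrier_mat k m. phi X S = M"
proof -
  obtain T where T: "T \<in> carrier_mat m k"
    and XTX: "\<And>a. a \<in> carrier_vec m \<Longrightarrow> X *\<^sub>v (T *\<^sub>v (X *\<^sub>v a)) = X *\<^sub>v a"
    using generalized_inverse_vec[OF X] by blast
  have Mc: "M \<in> carrier_mat k k" using N M by simp
  define R where "R = X * T"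
  have R: "R \<in> carrier_mat k k" unfolding R_def using X T by (rule mult_carrier_mat)
  \<comment> \<open>Chosen so that \<open>X S\<^sup>T\<close> is the matrix \<open>Z\<close>
    described above.\<close>
  define S where "S = (T * (N * R\<^sup>T + M * (1\<^sub>m k - R)\<^sup>T))\<^sup>T"
  have S: "S \<in> carrier_mat k m"
    unfolding S_def using T N R Mc by (auto intro!: mult_carrier_mat[of _ _ k] add_carrier_mat)
  \<comment> \<open>From \<open>X T X = X\<close> follows \<open>R X = X\<close>, so
    \<open>X\<^sup>T\<close> takes the same value at \<open>v\<close> and at
    \<open>R\<^sup>T v\<close>.\<close>
  have ker_proj: "v - R\<^sup>T *\<^sub>v v \<in> left_kernel X" if v: "v \<in> carrier_vec k" for v
  proof -
    have Rv: "R\<^sup>T *\<^sub>v v \<in> carrier_vec k" using R by (auto intro: mult_mat_vec_in_carrier)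
    have "X\<^sup>T *\<^sub>v (R\<^sup>T *\<^sub>v v) = X\<^sup>T *\<^sub>v v"
    proof (rule eq_vec_by_scalar_prodI[of _ m])
      fix a :: "'a vec" assume a: "a \<in> carrier_vec m"
      have Xa: "X *\<^sub>v a \<in> carrier_vec k" using X by (rule mult_mat_vec_in_carrier)
      have "(X\<^sup>T *\<^sub>v (R\<^sup>T *\<^sub>v v)) \<bullet> a = v \<bullet> (R *\<^sub>v (X *\<^sub>v a))"
        using scalar_prod_transpose(1)[OF X a Rv] scalar_prod_transpose(1)[OF R Xa v] by simp
      also have "\<dots> = (X\<^sup>T *\<^sub>v v) \<bullet> a"
        using scalar_prod_transpose(1)[OF X a v] XTX[OF a] X T a by (simp add: R_def mult_mat_vec_assoc)
      finally show "(X\<^sup>T *\<^sub>v (R\<^sup>T *\<^sub>v v)) \<bullet> a = (X\<^sup>T *\<^sub>v v) \<bullet> a" .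
    qed (use X in \<open>auto intro: mult_mat_vec_in_carrier\<close>)
    moreover have "X\<^sup>T *\<^sub>v v \<in> carrier_vec m" using X by (auto intro: mult_mat_vec_in_carrier)
    ultimately show ?thesis using X R v Rv by (simp add: left_kernel_iff mult_mat_vec_simps)
  qed
  have "phi X S = M"
  proof (rule mat_eq_by_vecI[of _ k k])
    fix v :: "'a vec" assume v: "v \<in> carrier_vec k"
    show "phi X S *\<^sub>v v = M *\<^sub>v v"
    proof (rule eq_vec_by_scalar_prodI[of _ k])
      fix u :: "'a vec" assume u: "u \<in> carrier_vec k"
      have XS: "a \<bullet> (X *\<^sub>v (S\<^sup>T *\<^sub>v b)) = (R\<^sup>T *\<^sub>v a) \<bullet> (N *\<^sub>v (R\<^sup>T *\<^sub>v b)) + (R\<^sup>T *\<^sub>v a) \<bullet> (M *\<^sub>v (b - R\<^sup>T *\<^sub>v b))"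
        if a: "a \<in> carrier_vec k" and b: "b \<in> carrier_vec k" for a b
      proof -
        define w where "w = N *\<^sub>v (R\<^sup>T *\<^sub>v b) + M *\<^sub>v (b - R\<^sup>T *\<^sub>v b)"
        have w: "w \<in> carrier_vec k" using N Mc by (auto simp: w_def intro!: add_carrier_vec mult_mat_vec_in_carrier)
        have "X *\<^sub>v (S\<^sup>T *\<^sub>v b) = R *\<^sub>v w"
          using X T N R Mc b by (simp add: S_def w_def R_def mat_action_simps)
        then have "a \<bullet> (X *\<^sub>v (S\<^sup>T *\<^sub>v b)) = (R\<^sup>T *\<^sub>v a) \<bullet> w"
          using scalar_prod_transpose(1)[OF R w a] by simp
        then show ?thesis using N R Mc by (simp add: w_def scalar_prod_simps)
      qed
      define u1 v1 u2 v2 where "u1 = R\<^sup>T *\<^sub>v u" and "v1 = R\<^sup>T *\<^sub>v v" and "u2 = u - u1" and "v2 = v - v1"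
      have c: "u1 \<in> carrier_vec k" "v1 \<in> carrier_vec k" "u2 \<in> carrier_vec k" "v2 \<in> carrier_vec k"
        using u v R unfolding u1_def v1_def u2_def v2_def by (auto intro!: mult_mat_vec_in_carrier minus_carrier_vec)
      \<comment> \<open>Here \<open>N\<close> stands in for half of \<open>M\<close>: on the corner
        spanned by \<open>u1\<close> and \<open>v1\<close> its two transposed contributions add up
        to \<open>M\<close> in every characteristic.\<close>
      have NT: "a \<bullet> (N *\<^sub>v b) + b \<bullet> (N *\<^sub>v a) = a \<bullet> (M *\<^sub>v b)"
        if a: "a \<in> carrier_vec k" and b: "b \<in> carrier_vec k" for a b
        using scalar_prod_transpose(2)[OF N a b] a b N
        by (simp add: M mat_action_simps scalar_prod_simps scalar_prod_commute[of b])
      have sym: "a \<bullet> (M *\<^sub>v b) = b \<bullet> (M *\<^sub>v a)" if a: "a \<in> carrier_vec k" and b: "b \<in> carrier_vec k" for a b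
        using NT[OF a b] NT[OF b a] by (metis add.commute)
      have Sv: "S\<^sup>T *\<^sub>v u \<in> carrier_vec m" "X\<^sup>T *\<^sub>v v \<in> carrier_vec m" using S X by (auto intro: mult_mat_vec_in_carrier)
      have "(phi X S *\<^sub>v v) \<bullet> u = u \<bullet> (X *\<^sub>v (S\<^sup>T *\<^sub>v v)) + u \<bullet> (S *\<^sub>v (X\<^sup>T *\<^sub>v v))"
        using X S u v by (simp add: phi_def mat_action_simps scalar_prod_simps scalar_prod_commute[of _ u])
      also have "u \<bullet> (S *\<^sub>v (X\<^sup>T *\<^sub>v v)) = v \<bullet> (X *\<^sub>v (S\<^sup>T *\<^sub>v u))"
        using scalar_prod_transpose(1)[OF S Sv(2) u] scalar_prod_transpose(1)[OF X Sv(1) v] S X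
        by (simp add: scalar_prod_commute[of "S\<^sup>T *\<^sub>v u" "X\<^sup>T *\<^sub>v v"])
      also have "u \<bullet> (X *\<^sub>v (S\<^sup>T *\<^sub>v v)) + v \<bullet> (X *\<^sub>v (S\<^sup>T *\<^sub>v u))
          = u1 \<bullet> (M *\<^sub>v v1) + u1 \<bullet> (M *\<^sub>v v2) + u2 \<bullet> (M *\<^sub>v v1)"
        using XS[OF u v] XS[OF v u] NT[OF c(1,2)] sym[OF c(2,3)] by (simp add: u1_def v1_def u2_def v2_def)
      \<comment> \<open>The missing fourth term \<open>u2 \<bullet> M v2\<close> is zero, since
        \<open>u2\<close> and \<open>v2\<close> lie in the left kernel of \<open>X\<close>.\<close>
      also have "\<dots> = (u1 + u2) \<bullet> (M *\<^sub>v (v1 + v2))"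
        using ker[of u2 v2] ker_proj[OF u] ker_proj[OF v] c Mc
        by (simp add: mat_action_simps scalar_prod_simps u1_def[symmetric] v1_def[symmetric] u2_def[symmetric] v2_def[symmetric])
      also have "u1 + u2 = u" using c u by (auto simp: u2_def intro!: eq_vecI)
      also have "v1 + v2 = v" using c v by (auto simp: v2_def intro!: eq_vecI)
      finally show "(phi X S *\<^sub>v v) \<bullet> u = (M *\<^sub>v v) \<bullet> u"
        using Mc u by (simp add: scalar_prod_commute[of u])
    qed (rule mult_mat_vec_in_carrier[OF phi_carrier[OF X S]] mult_mat_vec_in_carrier[OF Mc])+
  qed (use X S Mc in auto)
  with S show ?thesis by blast
qed

section \<open>Matrices over \<open>F + uF\<close>\<close>

lemma scal_hom:
  "scal 0 = 0" "scal 1 = 1" "scal (a + b) = scal a + scal b" "scal (a * b) = scal a * scal b"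
  for a b :: "'a::field"
  by (transfer; simp add: one_pCons)+

lemma scal_sum: "scal (\<Sum>i\<in>I. f i) = (\<Sum>i\<in>I. scal (f i :: 'a::field))"
  by (induction I rule: infinite_finite_induct) (simp_all add: scal_hom)

lemma dual_eq_iff:
  fixes a b c d :: "'a::field"
  shows "scal a + dual_u * scal b = scal c + dual_u * scal d \<longleftrightarrow> a = c \<and> b = d"
  using dual_decomposition[of "scal a + dual_u * scal b"] by (auto dest: ex1_implies_ex)

lemma dual_cases:
  obtains a b :: "'a::field" where "x = scal a + dual_u * scal b"
  using dual_decomposition[of x] by auto

lemma u_times_u_assoc: "dual_u * (dual_u * x) = (0 :: 'a::field dual)"
  by (simp add: u_times_u flip: mult.assoc)

lemma dual_mult:
  fixes a b c d :: "'a::field"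
  shows "(scal a + dual_u * scal b) * (scal c + dual_u * scal d) = scal (a * c) + dual_u * scal (a * d + b * c)"
  by (simp add: scal_hom algebra_simps u_times_u_assoc)

lemma dual_sum:
  fixes f g :: "'b \<Rightarrow> 'a::field"
  shows "(\<Sum>i\<in>I. scal (f i) + dual_u * scal (g i)) = scal (\<Sum>i\<in>I. f i) + dual_u * scal (\<Sum>i\<in>I. g i)"
  by (simp add: sum.distrib scal_sum sum_distrib_left)

lemma dual_mat_carrier [simp]:
  "X \<in> carrier_mat k m \<Longrightarrow> Y \<in> carrier_mat k m \<Longrightarrow> dual_mat X Y \<in> carrier_mat k m"
  unfolding dual_mat_def by (intro add_carrier_mat) simp

lemma dual_mat_index:
  assumes "X \<in> carrier_mat k m" "Y \<in> carrier_mat k m" "i < k" "j < m"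
  shows "dual_mat X Y $$ (i, j) = scal (X $$ (i, j)) + dual_u * scal (Y $$ (i, j))"
  using assms by (simp add: dual_mat_def)

lemma dual_mat_eq_iff:
  assumes "X \<in> carrier_mat k m" "Y \<in> carrier_mat k m" "X' \<in> carrier_mat k m" "Y' \<in> carrier_mat k m"
  shows "dual_mat X Y = dual_mat X' Y' \<longleftrightarrow> X = X' \<and> Y = Y'"
proof
  assume eq: "dual_mat X Y = dual_mat X' Y'"
  have "X $$ (i, j) = X' $$ (i, j) \<and> Y $$ (i, j) = Y' $$ (i, j)" if "i < k" "j < m" for i j
    using arg_cong[OF eq, of "\<lambda>A. A $$ (i, j)"] assms that
    by (simp add: dual_mat_index[of _ k m] dual_eq_iff)
  then show "X = X' \<and> Y = Y'" using assms by (auto intro!: eq_matI)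
qed simp

lemma dual_mat_cases:
  assumes B: "B \<in> carrier_mat k m"
  obtains X Y :: "'a::field mat" where "X \<in> carrier_mat k m" "Y \<in> carrier_mat k m" "B = dual_mat X Y"
proof -
  have "\<exists>p. x = scal (fst p) + dual_u * scal (snd p)" for x :: "'a dual"
    by (rule dual_cases[of x]) auto
  then obtain f where f: "\<And>x :: 'a dual. x = scal (fst (f x)) + dual_u * scal (snd (f x))" by metis
  let ?X = "mat k m (\<lambda>ij. fst (f (B $$ ij)))" and ?Y = "mat k m (\<lambda>ij. snd (f (B $$ ij)))"
  have "B = dual_mat ?X ?Y"
    using B by (intro eq_matI) (simp_all add: dual_mat_def f[symmetric])
  then show thesis by (intro that[of ?X ?Y]) auto
qed

lemma dual_mat_add:
  assumes "X \<in> carrier_mat k m" "Y \<in> carrier_mat k m" "X' \<in> carrier_mat k m" "Y' \<in> carrier_mat k m"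
  shows "dual_mat X Y + dual_mat X' Y' = dual_mat (X + X') (Y + Y')"
  using assms by (intro eq_matI) (simp_all add: dual_mat_def scal_hom algebra_simps)

lemma dual_mat_zero: "dual_mat (0\<^sub>m k m) (0\<^sub>m k m) = (0\<^sub>m k m :: 'a::field dual mat)"
  by (intro eq_matI) (simp_all add: dual_mat_def scal_hom)

lemma mult_mat_index:
  assumes "A \<in> carrier_mat k m" "B \<in> carrier_mat m l" "i < k" "j < l"
  shows "(A * B) $$ (i, j) = (\<Sum>r\<in>{0..<m}. A $$ (i, r) * B $$ (r, j))"
  using assms by (simp add: scalar_prod_def)

text \<open>The product of the two \<open>u\<close>-parts disappears with
  \<open>u\<^sup>2 = 0\<close>, and the mixed terms form \<open>phi X Y\<close>.\<close>

lemma dual_mat_gram: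
  fixes X Y :: "'a::field mat"
  assumes X: "X \<in> carrier_mat k m" and Y: "Y \<in> carrier_mat k m"
  shows "dual_mat X Y * (dual_mat X Y)\<^sup>T = dual_mat (X * X\<^sup>T) (phi X Y)"
proof (rule eq_matI)
  note D = dual_mat_carrier[OF X Y]
  have c: "X * X\<^sup>T \<in> carrier_mat k k" "phi X Y \<in> carrier_mat k k" using X Y by auto
  fix i j assume "i < dim_row (dual_mat (X * X\<^sup>T) (phi X Y))" "j < dim_col (dual_mat (X * X\<^sup>T) (phi X Y))"
  then have ij: "i < k" "j < k" using dual_mat_carrier[OF c] by auto
  have "(dual_mat X Y * (dual_mat X Y)\<^sup>T) $$ (i, j)
      = (\<Sum>r\<in>{0..<m}. dual_mat X Y $$ (i, r) * dual_mat X Y $$ (j, r))"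
    using D ij by (subst mult_mat_index[of _ k m _ k]) auto
  also have "\<dots> = (\<Sum>r\<in>{0..<m}. scal (X $$ (i, r) * X $$ (j, r))
      + dual_u * scal (X $$ (i, r) * Y $$ (j, r) + Y $$ (i, r) * X $$ (j, r)))"
    using X Y ij by (intro sum.cong) (simp_all add: dual_mat_index[of _ k m] dual_mult)
  also have "\<dots> = scal (\<Sum>r\<in>{0..<m}. X $$ (i, r) * X $$ (j, r))
      + dual_u * scal (\<Sum>r\<in>{0..<m}. X $$ (i, r) * Y $$ (j, r) + Y $$ (i, r) * X $$ (j, r))"
    by (rule dual_sum)
  also have "(\<Sum>r\<in>{0..<m}. X $$ (i, r) * X $$ (j, r)) = (X * X\<^sup>T) $$ (i, j)"
    using X ij by (subst mult_mat_index[of _ k m _ k]) auto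
  also have "(\<Sum>r\<in>{0..<m}. X $$ (i, r) * Y $$ (j, r) + Y $$ (i, r) * X $$ (j, r)) = phi X Y $$ (i, j)"
    using X Y ij by (simp add: phi_def scalar_prod_def sum.distrib)
  finally show "(dual_mat X Y * (dual_mat X Y)\<^sup>T) $$ (i, j) = dual_mat (X * X\<^sup>T) (phi X Y) $$ (i, j)"
    using c ij by (simp add: dual_mat_index[of _ k k])
qed (use assms in \<open>auto simp: dual_mat_def phi_def\<close>)

lemma dual_mat_mult_scal:
  fixes X Y Q :: "'a::field mat"
  assumes X: "X \<in> carrier_mat k m" and Y: "Y \<in> carrier_mat k m" and Q: "Q \<in> carrier_mat m l"
  shows "dual_mat X Y * map_mat scal Q = dual_mat (X * Q) (Y * Q)"
proof (rule eq_matI)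
  note D = dual_mat_carrier[OF X Y]
  have c: "X * Q \<in> carrier_mat k l" "Y * Q \<in> carrier_mat k l" using X Y Q by auto
  fix i j assume "i < dim_row (dual_mat (X * Q) (Y * Q))" "j < dim_col (dual_mat (X * Q) (Y * Q))"
  then have ij: "i < k" "j < l" using dual_mat_carrier[OF c] by auto
  have "(dual_mat X Y * map_mat scal Q) $$ (i, j)
      = (\<Sum>r\<in>{0..<m}. scal (X $$ (i, r) * Q $$ (r, j)) + dual_u * scal (Y $$ (i, r) * Q $$ (r, j)))"
    using D ij Q X Y
    by (subst mult_mat_index[of _ k m _ l]) (auto simp: dual_mat_index[of _ k m] scal_hom algebra_simps intro!: sum.cong)
  also have "\<dots> = scal (\<Sum>r\<in>{0..<m}. X $$ (i, r) * Q $$ (r, j)) + dual_u * scal (\<Sum>r\<in>{0..<m}. Y $$ (i, r) * Q $$ (r, j))"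
    by (rule dual_sum)
  finally show "(dual_mat X Y * map_mat scal Q) $$ (i, j) = dual_mat (X * Q) (Y * Q) $$ (i, j)"
    using c ij mult_mat_index[OF X Q ij] mult_mat_index[OF Y Q ij] by (simp add: dual_mat_index[of _ k l])
qed (use assms in \<open>auto simp: dual_mat_def\<close>)

section \<open>Self-orthogonal embeddings\<close>

lemma generated_code_subset:
  assumes A: "A \<in> carrier_mat k n"
    and N: "N \<subseteq> carrier_vec n" "0\<^sub>v n \<in> N" "\<And>v w. v \<in> N \<Longrightarrow> w \<in> N \<Longrightarrow> v + w \<in> N" "\<And>c v. v \<in> N \<Longrightarrow> c \<cdot>\<^sub>v v \<in> N"
    and rows: "set (rows A) \<subseteq> N"
  shows "generated_code A \<subseteq> N"
proof -
  interpret vec_module "TYPE('a dual)" n .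
  have "submodule class_ring N V"
    by (unfold_locales) (use N in \<open>auto simp: module_vec_simps\<close>)
  from span_is_subset[OF rows this] A show ?thesis by (simp add: generated_code_def)
qed

lemma generated_code_rows:
  assumes A: "A \<in> carrier_mat k n"
  shows "set (rows A) \<subseteq> generated_code A" "0\<^sub>v n \<in> generated_code A" "generated_code A \<subseteq> carrier_vec n"
proof -
  interpret vec_module "TYPE('a dual)" n .
  have rows: "set (rows A) \<subseteq> carrier_vec n" using A by (auto simp: rows_def)
  have "submodule class_ring (span (set (rows A))) V" by (rule span_is_submodule[OF rows])
  then show "0\<^sub>v n \<in> generated_code A" "generated_code A \<subseteq> carrier_vec n"
    using A by (auto simp: generated_code_def submodule_def module_vec_simps)
  show "set (rows A) \<subseteq> generated_code A"
    using in_own_span[OF rows] A by (simp add: generated_code_def)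
qed

text \<open>Orthogonality of the rows spreads to the generated code one argument at a time.\<close>

lemma self_orthogonal_generated_iff:
  fixes A :: "'a::field dual mat"
  assumes A: "A \<in> carrier_mat k n"
  shows "self_orthogonal (generated_code A) \<longleftrightarrow> A * A\<^sup>T = 0\<^sub>m k k"
proof
  assume so: "self_orthogonal (generated_code A)"
  show "A * A\<^sup>T = 0\<^sub>m k k"
  proof (rule eq_matI)
    fix i j assume "i < dim_row (0\<^sub>m k k)" "j < dim_col (0\<^sub>m k k)"
    then have ij: "i < k" "j < k" by auto
    have "row A i \<in> set (rows A)" "row A j \<in> set (rows A)" using A ij by (auto simp: rows_def)
    then have "row A i \<bullet> row A j = 0" using so generated_code_rows(1)[OF A] by (auto simp: self_orthogonal_def)
    then show "(A * A\<^sup>T) $$ (i, j) = 0\<^sub>m k k $$ (i, j)" using A ij by simp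
  qed (use A in auto)
next
  assume gram: "A * A\<^sup>T = 0\<^sub>m k k"
  have "row A i \<bullet> row A j = 0" if "i < k" "j < k" for i j
    using arg_cong[OF gram, of "\<lambda>M. M $$ (i, j)"] A that by simp
  then have rows: "x \<bullet> y = 0" if "x \<in> set (rows A)" "y \<in> set (rows A)" for x y
    using that A by (auto simp: rows_def)
  have rows_c: "set (rows A) \<subseteq> carrier_vec n" using A by (auto simp: rows_def)
  \<comment> \<open>The vectors orthogonal to a set \<open>N\<close> form a submodule. This is used
    with \<open>N\<close> the set of rows, then with \<open>N\<close> the whole code.\<close>
  have compl: "generated_code A \<subseteq> {x \<in> carrier_vec n. \<forall>y\<in>N. x \<bullet> y = 0}"
    if "\<And>x y. x \<in> set (rows A) \<Longrightarrow> y \<in> N \<Longrightarrow> x \<bullet> y = 0" "N \<subseteq> carrier_vec n" for N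
    using that rows_c by (intro generated_code_subset[OF A]) (auto simp: scalar_prod_simps subset_iff)
  have half: "x \<bullet> y = 0" if "x \<in> generated_code A" "y \<in> set (rows A)" for x y
    using compl[OF rows rows_c] that by blast
  have "x \<bullet> y = 0" if x: "x \<in> set (rows A)" and y: "y \<in> generated_code A" for x y
    using half[OF y x] rows_c x y generated_code_rows(3)[OF A] by (subst scalar_prod_commute) (auto simp: subset_iff)
  then have "generated_code A \<subseteq> {x \<in> carrier_vec n. \<forall>y\<in>generated_code A. x \<bullet> y = 0}"
    using generated_code_rows(3)[OF A] by (intro compl) auto
  then show "self_orthogonal (generated_code A)" by (auto simp: self_orthogonal_def)
qed

lemma hblock_carrier:
  "A \<in> carrier_mat k n \<Longrightarrow> B \<in> carrier_mat k m \<Longrightarrow> hblock A B \<in> carrier_mat k (n + m)"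
  by (auto simp: hblock_def)

lemma hblock_gram:
  fixes A B :: "'a::comm_ring_1 mat"
  assumes A: "A \<in> carrier_mat k n" and B: "B \<in> carrier_mat k m"
  shows "hblock A B * (hblock A B)\<^sup>T = A * A\<^sup>T + B * B\<^sup>T"
proof (rule eq_matI)
  note H = hblock_carrier[OF A B]
  fix i j assume "i < dim_row (A * A\<^sup>T + B * B\<^sup>T)" "j < dim_col (A * A\<^sup>T + B * B\<^sup>T)"
  then have ij: "i < k" "j < k" using B by auto
  have row: "row (hblock A B) i = row A i @\<^sub>v row B i" if "i < k" for i
    using that A B by (intro eq_vecI) (auto simp: hblock_def)
  have "row (hblock A B) i \<bullet> row (hblock A B) j = row A i \<bullet> row A j + row B i \<bullet> row B j"
    using ij A B unfolding row[OF ij(1)] row[OF ij(2)] by (intro scalar_prod_append[of _ n _ m]) auto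
  then show "(hblock A B * (hblock A B)\<^sup>T) $$ (i, j) = (A * A\<^sup>T + B * B\<^sup>T) $$ (i, j)"
    using ij A B H by simp
qed (use assms in \<open>auto simp: hblock_def\<close>)

lemma self_orthogonal_embedding_iff:
  fixes G :: "'a::field dual mat"
  assumes G: "G \<in> carrier_mat k n"
  shows "self_orthogonal_embedding G l C' \<longleftrightarrow>
    (\<exists>p. \<exists>B\<in>carrier_mat k p. l = n + p \<and> C' = generated_code (hblock G B) \<and> G * G\<^sup>T + B * B\<^sup>T = 0\<^sub>m k k)"
    (is "?L \<longleftrightarrow> ?R")
proof
  assume ?L
  then obtain B where B: "dim_row B = k" "l = n + dim_col B" "C' = generated_code (hblock G B)"
    and so: "self_orthogonal C'" using G by (auto simp: self_orthogonal_embedding_def)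
  have Bc: "B \<in> carrier_mat k (dim_col B)" using B by (intro carrier_matI) auto
  have "G * G\<^sup>T + B * B\<^sup>T = 0\<^sub>m k k"
    using so self_orthogonal_generated_iff[OF hblock_carrier[OF G Bc]] hblock_gram[OF G Bc] B(3) by simp
  with B Bc show ?R by blast
next
  assume ?R
  then obtain p B where B: "B \<in> carrier_mat k p" "l = n + p" "C' = generated_code (hblock G B)"
    "G * G\<^sup>T + B * B\<^sup>T = 0\<^sub>m k k" by blast
  have "self_orthogonal C'"
    using B self_orthogonal_generated_iff[OF hblock_carrier[OF G B(1)]] hblock_gram[OF G B(1)] by simp
  then show ?L unfolding self_orthogonal_embedding_def using B G by (intro conjI exI[of _ B]) auto
qed

text \<open>Reduces minimality of codes to minimality of the number of columns in a matrix
  equation.\<close>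

lemma shortest_self_orthogonal_embeddings:
  fixes G :: "'a::field dual mat"
  assumes G: "G \<in> carrier_mat k n" and B: "B \<in> carrier_mat k m"
    and shortest: "shortest_self_orthogonal_embedding G (generated_code (hblock G B))"
  shows "G * G\<^sup>T + B * B\<^sup>T = 0\<^sub>m k k"
    and "\<And>p D. D \<in> carrier_mat k p \<Longrightarrow> G * G\<^sup>T + D * D\<^sup>T = 0\<^sub>m k k \<Longrightarrow> m \<le> p"
    and "\<And>C'. shortest_self_orthogonal_embedding G C' \<longleftrightarrow>
      (\<exists>D\<in>carrier_mat k m. C' = generated_code (hblock G D) \<and> G * G\<^sup>T + D * D\<^sup>T = 0\<^sub>m k k)"
proof -
  let ?C = "generated_code (hblock G B)"
  obtain l where l: "self_orthogonal_embedding G l ?C"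
    and least: "\<And>l' C''. self_orthogonal_embedding G l' C'' \<Longrightarrow> l \<le> l'"
    using shortest unfolding shortest_self_orthogonal_embedding_def by blast
  obtain p D where D: "D \<in> carrier_mat k p" "l = n + p" "?C = generated_code (hblock G D)"
    using l self_orthogonal_embedding_iff[OF G] by blast
  \<comment> \<open>The embedding may come with a different matrix \<open>D\<close>, but a code
    contains a zero vector, whose dimension reveals the length; so \<open>p = m\<close>.\<close>
  have "?C \<subseteq> carrier_vec (n + p)"
    unfolding D(3) by (rule generated_code_rows(3)[OF hblock_carrier[OF G D(1)]])
  from subsetD[OF this generated_code_rows(2)[OF hblock_carrier[OF G B]]]
  have "(0\<^sub>v (n + m) :: 'a dual vec) \<in> carrier_vec (n + p)" .
  then have lm: "l = n + m" using D(2) by (auto dest!: carrier_vecD)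
  have "self_orthogonal ?C" using l by (simp add: self_orthogonal_embedding_def)
  then show "G * G\<^sup>T + B * B\<^sup>T = 0\<^sub>m k k"
    using self_orthogonal_generated_iff[OF hblock_carrier[OF G B]] hblock_gram[OF G B] by simp
  show min: "m \<le> p" if "D \<in> carrier_mat k p" "G * G\<^sup>T + D * D\<^sup>T = 0\<^sub>m k k" for p D
  proof -
    have "self_orthogonal_embedding G (n + p) (generated_code (hblock G D))"
      unfolding self_orthogonal_embedding_iff[OF G] using that by blast
    from least[OF this] show ?thesis using lm by simp
  qed
  show "shortest_self_orthogonal_embedding G C' \<longleftrightarrow>
      (\<exists>D\<in>carrier_mat k m. C' = generated_code (hblock G D) \<and> G * G\<^sup>T + D * D\<^sup>T = 0\<^sub>m k k)" (is "_ \<longleftrightarrow> ?R") for C'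
  proof
    assume "shortest_self_orthogonal_embedding G C'"
    then obtain l' where l': "self_orthogonal_embedding G l' C'"
      and least': "\<And>l'' C''. self_orthogonal_embedding G l'' C'' \<Longrightarrow> l' \<le> l''"
      unfolding shortest_self_orthogonal_embedding_def by blast
    have "l' = n + m" using least[OF l'] least'[OF l] lm by simp
    then show ?R using l' unfolding self_orthogonal_embedding_iff[OF G] by auto
  next
    assume ?R
    then have "self_orthogonal_embedding G (n + m) C'" using self_orthogonal_embedding_iff[OF G] by blast
    then show "shortest_self_orthogonal_embedding G C'"
      unfolding shortest_self_orthogonal_embedding_def using least lm by blast
  qed
qed

section \<open>Classification\<close>

lemma minus_of_sum_zero:
  fixes A B :: "'a::ab_group_add mat"
  assumes "A \<in> carrier_mat k l" "B \<in> carrier_mat k l"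
  shows "A + B = 0\<^sub>m k l \<longleftrightarrow> B = - A"
proof
  assume sum: "A + B = 0\<^sub>m k l"
  have "A $$ (i, j) + B $$ (i, j) = 0" if "i < k" "j < l" for i j
    using arg_cong[OF sum, of "\<lambda>M. M $$ (i, j)"] assms that by simp
  then show "B = - A" using assms by (intro eq_matI) (auto simp: eq_neg_iff_add_eq_0 add.commute)
qed (use assms in auto)

text \<open>The equation over the ring splits into its two components because the decomposition of
  an element into \<open>a + u b\<close> is unique.\<close>

lemma gram_condition_iff:
  fixes G :: "'a::field dual mat"
  assumes A: "A0 \<in> carrier_mat k k" "A1 \<in> carrier_mat k k" and G: "G * G\<^sup>T = dual_mat A0 A1"
    and X: "X \<in> carrier_mat k m" and Y: "Y \<in> carrier_mat k m"
  shows "G * G\<^sup>T + dual_mat X Y * (dual_mat X Y)\<^sup>T = 0\<^sub>m k k \<longleftrightarrow> X * X\<^sup>T = - A0 \<and> phi X Y = - A1"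
proof -
  have XX: "X * X\<^sup>T \<in> carrier_mat k k" using X by auto
  show ?thesis
    using A XX phi_carrier[OF X Y]
    by (simp add: G dual_mat_gram[OF X Y] dual_mat_add[of _ k k] dual_mat_eq_iff[of _ k k] minus_of_sum_zero[of _ k k]
        flip: dual_mat_zero)
qed

text \<open>A compression would supply \<open>Z\<close> with one column fewer and the Gram matrix of
  \<open>X\<close>; its smaller left kernel keeps the equation for the \<open>u\<close>-part
  solvable, against minimality.\<close>

lemma minimal_imp_incompressible:
  fixes X Y :: "'a::field mat"
  assumes X: "X \<in> carrier_mat k m" and Y: "Y \<in> carrier_mat k m" and m: "m > 0"
    and min: "\<And>Z W. Z \<in> carrier_mat k (m - 1) \<Longrightarrow> W \<in> carrier_mat k (m - 1) \<Longrightarrow>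
      \<not> (Z * Z\<^sup>T = X * X\<^sup>T \<and> phi Z W = phi X Y)"
  shows "\<not> compressible X\<^sup>T"
proof
  have XT: "X\<^sup>T \<in> carrier_mat m k" using X by simp
  assume "compressible X\<^sup>T"
  then obtain Z where Z: "Z \<in> carrier_mat (m - 1) k" and gram: "same_gram X\<^sup>T Z" and ker: "kernel_subset Z X\<^sup>T"
    unfolding compressible_def carrier_matD[OF XT] by blast
  have ZT: "Z\<^sup>T \<in> carrier_mat k (m - 1)" using Z by simp
  have "Z\<^sup>T * Z\<^sup>T\<^sup>T = X * X\<^sup>T"
  proof (rule mat_eq_by_vecI[of _ k k])
    fix v :: "'a vec" assume v: "v \<in> carrier_vec k"
    show "(Z\<^sup>T * Z\<^sup>T\<^sup>T) *\<^sub>v v = (X * X\<^sup>T) *\<^sub>v v"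
    proof (rule eq_vec_by_scalar_prodI[of _ k])
      fix a :: "'a vec" assume a: "a \<in> carrier_vec k"
      have "((Z\<^sup>T * Z\<^sup>T\<^sup>T) *\<^sub>v v) \<bullet> a = (Z *\<^sub>v v) \<bullet> (Z *\<^sub>v a)"
        using scalar_prod_transpose(1)[OF Z a mult_mat_vec_in_carrier[OF Z, of v]] Z v by (simp add: mat_action_simps)
      also have "\<dots> = (X\<^sup>T *\<^sub>v v) \<bullet> (X\<^sup>T *\<^sub>v a)" using same_gramD[OF gram XT v a] by simp
      also have "\<dots> = ((X * X\<^sup>T) *\<^sub>v v) \<bullet> a"
        using scalar_prod_transpose(1)[OF XT a mult_mat_vec_in_carrier[OF XT, of v]] X v by (simp add: mat_action_simps)
      finally show "((Z\<^sup>T * Z\<^sup>T\<^sup>T) *\<^sub>v v) \<bullet> a = ((X * X\<^sup>T) *\<^sub>v v) \<bullet> a" .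
    qed (use X Z in \<open>auto intro!: mult_mat_vec_in_carrier\<close>)
  qed (use X Z in auto)
  moreover have "\<exists>S\<in>carrier_mat k (m - 1). phi Z\<^sup>T S = phi X Y"
  proof (rule in_phi_image[OF ZT])
    show "X * Y\<^sup>T \<in> carrier_mat k k" using X Y by auto
    \<comment> \<open>The known solution \<open>Y\<close> itself exhibits the shape
      \<open>N + N\<^sup>T\<close> required by \<open>in_phi_image\<close>.\<close>
    show "phi X Y = X * Y\<^sup>T + (X * Y\<^sup>T)\<^sup>T" using X Y by (simp add: phi_def mat_action_simps)
    have sub: "u \<in> left_kernel X" if "u \<in> left_kernel Z\<^sup>T" for u
      using that kernel_subsetD[OF ker Z XT, of u] X ZT by (simp add: left_kernel_iff)
    show "u \<bullet> (phi X Y *\<^sub>v v) = 0" if "u \<in> left_kernel Z\<^sup>T" "v \<in> left_kernel Z\<^sup>T" for u v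
      using phi_left_kernel[OF X Y sub sub] that by blast
  qed
  ultimately show False using min[OF ZT] by blast
qed

section \<open>Invertible matrices and the set \<open>Gamma_set\<close>\<close>

lemma general_linear_groupI:
  "P \<in> carrier_mat k k \<Longrightarrow> S \<in> carrier_mat k k \<Longrightarrow> P * S = 1\<^sub>m k \<Longrightarrow> S * P = 1\<^sub>m k \<Longrightarrow> P \<in> general_linear_group k"
  unfolding general_linear_group_def invertible_mat_def inverts_mat_def by auto

lemma general_linear_groupE:
  assumes "P \<in> general_linear_group k"
  obtains S where "P \<in> carrier_mat k k" "S \<in> carrier_mat k k" "P * S = 1\<^sub>m k" "S * P = 1\<^sub>m k"
    "mat_inverse P = Some S"
proof -
  have P: "P \<in> carrier_mat k k" and "invertible_mat P" using assms by (auto simp: general_linear_group_def)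
  then obtain B where B: "P * B = 1\<^sub>m k" "B * P = 1\<^sub>m (dim_row B)"
    by (auto simp: invertible_mat_def inverts_mat_def)
  \<comment> \<open>The library notion of invertibility leaves the dimensions of \<open>B\<close>
    open; the two product equations determine them.\<close>
  have "dim_col (P * B) = k" using B(1) by simp
  moreover have "dim_col (B * P) = dim_row B" using B(2) by simp
  ultimately have "B \<in> carrier_mat k k" using P by (intro carrier_matI) auto
  then have "P \<in> Units (ring_mat TYPE('a) k ())"
    using B P by (auto simp: Units_def ring_mat_def)
  then obtain S where S: "mat_inverse P = Some S"
    using mat_inverse(1)[OF P, of "()"] by (cases "mat_inverse P") auto
  then show thesis using mat_inverse(2)[OF P S] P by (intro that[of S]) auto
qed

text \<open>The image of the left kernel of \<open>X\<close> under the inverse of \<open>P\<close>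
  is the left kernel of \<open>P X\<close>, since \<open>x = u P\<close> turns
  \<open>x X = 0\<close> into \<open>u P X = 0\<close>.\<close>

lemma Gamma_set_iff:
  fixes X :: "'a::field mat"
  assumes X: "X \<in> carrier_mat k m" and A0: "A0 \<in> carrier_mat k k" and A1: "A1 \<in> carrier_mat k k"
  shows "P \<in> Gamma_set k A0 A1 X \<longleftrightarrow> P \<in> general_linear_group k \<and> P * A0 * P\<^sup>T = A0 \<and>
    (\<forall>u\<in>left_kernel (P * X). \<forall>v\<in>left_kernel (P * X). u \<bullet> (A1 *\<^sub>v v) = 0)"
proof (cases "P \<in> general_linear_group k")
  case False
  then show ?thesis by (simp add: Gamma_set_def)
next
  case True
  then obtain S where P: "P \<in> carrier_mat k k" and S: "S \<in> carrier_mat k k"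
    and PS: "P * S = 1\<^sub>m k" "S * P = 1\<^sub>m k" "mat_inverse P = Some S" by (rule general_linear_groupE)
  have PX: "P * X \<in> carrier_mat k m" using P X by (rule mult_carrier_mat)
  have inv: "P\<^sup>T * S\<^sup>T = 1\<^sub>m k" "S\<^sup>T * P\<^sup>T = 1\<^sub>m k"
    using transpose_mult[OF S P, symmetric] transpose_mult[OF P S, symmetric] PS by simp_all
  have image: "(\<lambda>x. row_mult x S) ` left_kernel X = left_kernel (P * X)"
  proof
    show "(\<lambda>x. row_mult x S) ` left_kernel X \<subseteq> left_kernel (P * X)"
    proof (intro subsetI, elim imageE)
      fix u x assume u: "u = row_mult x S" and x: "x \<in> left_kernel X"
      then have xc: "x \<in> carrier_vec k" "X\<^sup>T *\<^sub>v x = 0\<^sub>v m" using X by (auto simp: left_kernel_iff)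
      have "P\<^sup>T *\<^sub>v (S\<^sup>T *\<^sub>v x) = x" by (rule mult_inverse_vec[OF _ _ inv(1) xc(1)]) (use P S in auto)
      then show "u \<in> left_kernel (P * X)"
        using P X S xc mult_mat_vec_in_carrier[of "S\<^sup>T" k k x]
        by (simp add: left_kernel_iff[OF PX] u row_mult_def mat_action_simps)
    qed
    show "left_kernel (P * X) \<subseteq> (\<lambda>x. row_mult x S) ` left_kernel X"
    proof
      fix u assume "u \<in> left_kernel (P * X)"
      then have u: "u \<in> carrier_vec k" "X\<^sup>T *\<^sub>v (P\<^sup>T *\<^sub>v u) = 0\<^sub>v m"
        using P X by (auto simp: left_kernel_iff[OF PX] mat_action_simps)
      have "P\<^sup>T *\<^sub>v u \<in> left_kernel X"
        using u X P mult_mat_vec_in_carrier[of "P\<^sup>T" k k u] by (simp add: left_kernel_iff)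
      moreover have "row_mult (P\<^sup>T *\<^sub>v u) S = u"
        unfolding row_mult_def by (rule mult_inverse_vec[OF _ _ inv(2) u(1)]) (use P S in auto)
      ultimately show "u \<in> (\<lambda>x. row_mult x S) ` left_kernel X" by force
    qed
  qed
  show ?thesis unfolding Gamma_set_def using True by (simp only: mem_Collect_eq PS(3) option.sel Let_def image)
qed

text \<open>On the left kernel of \<open>P X\<close>, the matrix \<open>A1\<close> vanishes by
  membership of \<open>P\<close>, and \<open>P A1 P\<^sup>T = - phi (P X) (P Y)\<close> vanishes by
  its form; so their difference passes the test of \<open>in_phi_image\<close>.\<close>

lemma Gamma_set_phi_solvable:
  fixes X Y :: "'a::field mat"
  assumes X: "X \<in> carrier_mat k m" and Y: "Y \<in> carrier_mat k m" and A0: "A0 \<in> carrier_mat k k"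
    and A1: "A1 \<in> carrier_mat k k" and phi: "phi X Y = - A1" and P: "P \<in> Gamma_set k A0 A1 X"
  shows "\<exists>S\<in>carrier_mat k m. phi (P * X) S = P * A1 * P\<^sup>T - A1"
proof -
  have GL: "P \<in> general_linear_group k"
    and ker: "\<And>u v. u \<in> left_kernel (P * X) \<Longrightarrow> v \<in> left_kernel (P * X) \<Longrightarrow> u \<bullet> (A1 *\<^sub>v v) = 0"
    using P Gamma_set_iff[OF X A0 A1] by auto
  have Pc: "P \<in> carrier_mat k k" using GL by (rule general_linear_groupE)
  have PX: "P * X \<in> carrier_mat k m" and PY: "P * Y \<in> carrier_mat k m" using Pc X Y by auto
  have A1_eq: "A1 = - phi X Y" using phi A1 by (auto intro!: eq_matI)
  have PA1: "P * A1 * P\<^sup>T = - phi (P * X) (P * Y)"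
    unfolding phi_left_mult[OF X Y Pc] phi using Pc A1 by (intro mat_eq_by_vecI[of _ k k]) (auto simp: mat_action_simps)
  \<comment> \<open>Assembled from the halves of \<open>- A1 = phi X Y\<close> and of
    \<open>phi (P X) (P Y)\<close>, so that no division by 2 occurs.\<close>
  let ?N = "X * Y\<^sup>T - P * X * (P * Y)\<^sup>T"
  show ?thesis
  proof (rule in_phi_image[OF PX, of ?N])
    show "?N \<in> carrier_mat k k" using PX PY by (intro minus_carrier_mat) auto
    show "P * A1 * P\<^sup>T - A1 = ?N + ?N\<^sup>T"
      unfolding PA1 A1_eq phi_def using X Y Pc
      by (intro mat_eq_by_vecI[of _ k k]) (auto intro!: eq_vecI simp: mat_action_simps simp del: index_mult_mat_vec)
    fix u v assume uv: "u \<in> left_kernel (P * X)" "v \<in> left_kernel (P * X)"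
    then have c: "u \<in> carrier_vec k" "v \<in> carrier_vec k" using PX by (auto simp: left_kernel_iff)
    have "(P * A1 * P\<^sup>T - A1) *\<^sub>v v = - (phi (P * X) (P * Y) *\<^sub>v v) - A1 *\<^sub>v v"
      unfolding PA1 using A1 c phi_carrier[OF PX PY] by (simp add: mat_action_simps)
    then show "u \<bullet> ((P * A1 * P\<^sup>T - A1) *\<^sub>v v) = 0"
      using phi_left_kernel[OF PX PY uv] ker[OF uv] c A1 phi_carrier[OF PX PY]
      by (simp add: scalar_prod_simps scalar_prod_uminus_right)
  qed
qed

text \<open>The factor \<open>Q\<close> cancels in the Gram matrix, so \<open>P\<close> preserves
  \<open>A0\<close>; and \<open>- A1\<close> lies in the image of \<open>phi (P X)\<close>, so it
  vanishes on the left kernel.\<close>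

lemma Gamma_set_mult_orthogonal:
  fixes X Y P Q :: "'a::field mat"
  assumes X: "X \<in> carrier_mat k m" and Y: "Y \<in> carrier_mat k m" and A0: "A0 \<in> carrier_mat k k"
    and A1: "A1 \<in> carrier_mat k k" and P: "P \<in> general_linear_group k" and Q: "Q \<in> orthogonal_group m"
    and gram: "X * X\<^sup>T = - A0" "P * X * Q * (P * X * Q)\<^sup>T = - A0" and phi: "phi (P * X) Y = - A1"
  shows "P \<in> Gamma_set k A0 A1 X"
proof -
  have Pc: "P \<in> carrier_mat k k" using P by (rule general_linear_groupE)
  have PX: "P * X \<in> carrier_mat k m" using Pc X by (rule mult_carrier_mat)
  have A0_eq: "A0 = - (X * X\<^sup>T)" using gram A0 by (auto intro!: eq_matI)
  have "P * A0 * P\<^sup>T = - (P * X * (P * X)\<^sup>T)"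
    unfolding A0_eq using Pc X by (intro mat_eq_by_vecI[of _ k k]) (auto simp: mat_action_simps)
  also have "\<dots> = A0" using gram(2) gram_right_mult[OF PX PX Q] A0 by (auto intro!: eq_matI)
  finally have "P * A0 * P\<^sup>T = A0" .
  moreover have "u \<bullet> (A1 *\<^sub>v v) = 0" if "u \<in> left_kernel (P * X)" "v \<in> left_kernel (P * X)" for u v
  proof -
    have c: "u \<in> carrier_vec k" "v \<in> carrier_vec k" using that PX by (auto simp: left_kernel_iff)
    have "u \<bullet> ((- A1) *\<^sub>v v) = 0" using phi_left_kernel[OF PX Y that] phi by simp
    then show ?thesis using c A1 by (simp add: uminus_mult_vec)
  qed
  ultimately show ?thesis using P Gamma_set_iff[OF X A0 A1] by blast
qed

text \<open>Equivalence of incompressible matrices settles \<open>X'\<close>. For fixed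
  \<open>P\<close> and \<open>Q\<close>, the admissible \<open>Y'\<close> form a coset of the kernel
  of a linear map, with a representative built from \<open>Y\<close> and \<open>S P\<close>.\<close>

lemma embedding_decomposition:
  fixes X Y X' Y' :: "'a::{field,finite} mat"
  assumes X: "X \<in> carrier_mat k m" and Y: "Y \<in> carrier_mat k m" and X': "X' \<in> carrier_mat k m"
    and Y': "Y' \<in> carrier_mat k m" and m: "m > 0" and A0: "A0 \<in> carrier_mat k k" and A1: "A1 \<in> carrier_mat k k"
    and eqs: "X * X\<^sup>T = - A0" "phi X Y = - A1" "X' * X'\<^sup>T = - A0" "phi X' Y' = - A1"
    and min: "\<And>Z W. Z \<in> carrier_mat k (m - 1) \<Longrightarrow> W \<in> carrier_mat k (m - 1) \<Longrightarrow>
      \<not> (Z * Z\<^sup>T = - A0 \<and> phi Z W = - A1)"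
    and S: "\<And>P. P \<in> Gamma_set k A0 A1 X \<Longrightarrow> S P \<in> carrier_mat k m \<and> phi (P * X) (S P) = P * A1 * P\<^sup>T - A1"
  shows "\<exists>P\<in>Gamma_set k A0 A1 X. \<exists>H\<in>ker_phi X. \<exists>Q\<in>orthogonal_group m.
    X' = P * X * Q \<and> Y' = (P * Y + S P + P * H) * Q"
proof -
  have XT: "X\<^sup>T \<in> carrier_mat m k" and XT': "X'\<^sup>T \<in> carrier_mat m k" using X X' by auto
  have dot: "(M\<^sup>T *\<^sub>v a) \<bullet> (M\<^sup>T *\<^sub>v b) = a \<bullet> ((M * M\<^sup>T) *\<^sub>v b)"
    if M: "M \<in> carrier_mat k m" and ab: "a \<in> carrier_vec k" "b \<in> carrier_vec k" for M :: "'a mat" and a b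
    using scalar_prod_transpose(1)[OF M _ ab(1), of "M\<^sup>T *\<^sub>v b"] M ab mult_mat_vec_in_carrier[of "M\<^sup>T" m k b]
    by (simp add: mat_action_simps)
  have gram: "same_gram X\<^sup>T X'\<^sup>T"
    unfolding same_gram_def carrier_matD[OF XT] using X X' by (simp add: dot eqs)
  have "\<not> compressible X\<^sup>T" "\<not> compressible X'\<^sup>T"
    using minimal_imp_incompressible[OF X Y m] minimal_imp_incompressible[OF X' Y' m] min
    unfolding eqs by blast+
  then obtain T U Q where T: "T \<in> carrier_mat k k" and U: "U \<in> carrier_mat k k"
    and TU: "T * U = 1\<^sub>m k" "U * T = 1\<^sub>m k" and Q: "Q \<in> orthogonal_group m"
    and eq: "\<And>a. a \<in> carrier_vec k \<Longrightarrow> Q *\<^sub>v (X\<^sup>T *\<^sub>v (T *\<^sub>v a)) = X'\<^sup>T *\<^sub>v a"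
    using incompressible_equivalent[OF XT XT' m gram] by blast
  have Qc: "Q \<in> carrier_mat m m" by (rule orthogonal_group_carrier[OF Q])
  \<comment> \<open>Transposing back exchanges sides: the coordinate change \<open>T\<close> becomes
    the left factor, and the orthogonal factor in the result is \<open>Q\<^sup>T\<close>.\<close>
  define P where "P = T\<^sup>T"
  define R where "R = U\<^sup>T"
  have P: "P \<in> carrier_mat k k" and R: "R \<in> carrier_mat k k" using T U by (auto simp: P_def R_def)
  have PR: "P * R = 1\<^sub>m k" "R * P = 1\<^sub>m k"
    using transpose_mult[OF U T, symmetric] transpose_mult[OF T U, symmetric] TU by (simp_all add: P_def R_def)
  have QT: "Q\<^sup>T \<in> orthogonal_group m" by (rule orthogonal_group_transpose[OF Q])
  have PX: "P * X \<in> carrier_mat k m" and PY: "P * Y \<in> carrier_mat k m" using P X Y by auto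
  have "X'\<^sup>T = Q * (X\<^sup>T * T)"
    by (rule mat_eq_by_vecI[OF XT', of "Q * (X\<^sup>T * T)"]) (use Qc X T eq in \<open>auto simp: mat_action_simps\<close>)
  then have "X'\<^sup>T\<^sup>T = (Q * (X\<^sup>T * T))\<^sup>T" by simp
  then have X'_eq: "X' = P * X * Q\<^sup>T" using Qc X T by (simp add: transpose_mult_dim P_def)
  \<comment> \<open>Undoes the orthogonal factor, so that \<open>Y1\<close> solves the equation for
    \<open>P X\<close>.\<close>
  define Y1 where "Y1 = Y' * Q"
  have Y1: "Y1 \<in> carrier_mat k m" unfolding Y1_def using Y' Qc by (rule mult_carrier_mat)
  have Y'_eq: "Y' = Y1 * Q\<^sup>T"
    unfolding Y1_def using Y' Qc
    by (intro mat_eq_by_vecI[of _ k m]) (auto simp: mat_action_simps orthogonal_group_cancel[OF Q])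
  have phi1: "phi (P * X) Y1 = - A1"
    using phi_right_mult[OF PX Y1 QT] eqs(4) by (simp add: X'_eq Y'_eq[symmetric])
  have GL: "P \<in> general_linear_group k" by (rule general_linear_groupI[OF P R PR])
  have Gamma: "P \<in> Gamma_set k A0 A1 X"
    by (rule Gamma_set_mult_orthogonal[OF X Y1 A0 A1 GL QT eqs(1) _ phi1]) (use eqs(3) X'_eq in simp)
  have SP: "S P \<in> carrier_mat k m" and phiS: "phi (P * X) (S P) = P * A1 * P\<^sup>T - A1" using S[OF Gamma] by auto
  \<comment> \<open>The deviation of \<open>Y1\<close> from the particular solution
    \<open>P Y + S P\<close>. It lies in the kernel of \<open>phi (P X)\<close>, and its pullback
    along \<open>P\<close> is the required \<open>H\<close>.\<close>
  define D where "D = Y1 - P * Y - S P"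
  have D: "D \<in> carrier_mat k m" unfolding D_def by (rule minus_carrier_mat[OF SP])
  define H where "H = R * D"
  have H: "H \<in> carrier_mat k m" unfolding H_def using R D by (rule mult_carrier_mat)
  have PRv: "P *\<^sub>v (R *\<^sub>v v) = v" "R *\<^sub>v (P *\<^sub>v v) = v" if "dim_vec v = k" for v
    using mult_inverse_vec[OF P R PR(1)] mult_inverse_vec[OF R P PR(2)] that carrier_vecI[OF that] by auto
  have PH: "P * H = D"
    unfolding H_def using P R D by (intro mat_eq_by_vecI[of _ k m]) (auto simp: mat_action_simps PRv)
  have "phi (P * X) D = phi (P * X) Y1 - phi (P * X) (P * Y) - phi (P * X) (S P)"
    unfolding D_def using phi_linear(2)[OF PX minus_carrier_mat[OF PY] SP, of Y1] phi_linear(2)[OF PX Y1 PY] by simp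
  also have "\<dots> = - A1 - P * (- A1) * P\<^sup>T - (P * A1 * P\<^sup>T - A1)"
    by (simp only: phi1 phi_left_mult[OF X Y P] eqs(2) phiS)
  also have "\<dots> = 0\<^sub>m k k"
    using A1 P by (intro mat_eq_by_vecI[of _ k k])
      (auto intro!: eq_vecI simp: mat_action_simps simp del: index_mult_mat_vec)
  finally have "P * phi X H * P\<^sup>T = 0\<^sub>m k k" using phi_left_mult[OF X H P] PH by simp
  \<comment> \<open>Cancels the congruence by \<open>P\<close>, which carries
    \<open>phi X H = 0\<close> back from \<open>phi (P X) (P H) = 0\<close>.\<close>
  moreover have "R * (P * phi X H * P\<^sup>T) * R\<^sup>T = phi X H"
  proof (rule mat_eq_by_vecI[of _ k k])
    fix v :: "'a vec" assume v: "v \<in> carrier_vec k"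
    have "P\<^sup>T *\<^sub>v (R\<^sup>T *\<^sub>v v) = v"
      using mult_inverse_vec[OF _ _ TU(1) v] T U by (simp add: P_def R_def)
    then show "(R * (P * phi X H * P\<^sup>T) * R\<^sup>T) *\<^sub>v v = phi X H *\<^sub>v v"
      using P R v carrier_matD[OF phi_carrier[OF X H]] by (simp add: mat_action_simps PRv)
  qed (use P R phi_carrier[OF X H] in auto)
  ultimately have "phi X H = R * 0\<^sub>m k k * R\<^sup>T" by simp
  then have "phi X H = 0\<^sub>m k k" using R by simp
  then have "H \<in> ker_phi X" using X H by (simp add: ker_phi_def)
  moreover have "P * Y + S P + P * H = Y1"
    unfolding PH D_def using P Y SP Y1 by (intro eq_matI) auto
  ultimately show ?thesis using Gamma QT X'_eq Y'_eq by metis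
qed

text \<open>The orthogonal factor cancels. What remains is \<open>- P A1 P\<^sup>T\<close> from
  \<open>P Y\<close>, its correction from \<open>S\<close>, and nothing from \<open>H\<close>; the
  sum is \<open>- A1\<close>.\<close>

lemma embedding_composition:
  fixes X Y :: "'a::field mat"
  assumes X: "X \<in> carrier_mat k m" and Y: "Y \<in> carrier_mat k m" and A0: "A0 \<in> carrier_mat k k"
    and A1: "A1 \<in> carrier_mat k k" and eqs: "X * X\<^sup>T = - A0" "phi X Y = - A1"
    and Gamma: "P \<in> Gamma_set k A0 A1 X" and H: "H \<in> ker_phi X" and Q: "Q \<in> orthogonal_group m"
    and S: "S \<in> carrier_mat k m" "phi (P * X) S = P * A1 * P\<^sup>T - A1"
  shows "P * X * Q * (P * X * Q)\<^sup>T = - A0" "phi (P * X * Q) ((P * Y + S + P * H) * Q) = - A1"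
proof -
  have GL: "P \<in> general_linear_group k" and PA0: "P * A0 * P\<^sup>T = A0"
    using Gamma Gamma_set_iff[OF X A0 A1] by auto
  have P: "P \<in> carrier_mat k k" using GL by (rule general_linear_groupE)
  have Hc: "H \<in> carrier_mat k m" and phiH: "phi X H = 0\<^sub>m k k" using H X by (auto simp: ker_phi_def)
  have PX: "P * X \<in> carrier_mat k m" and PY: "P * Y \<in> carrier_mat k m" and PH: "P * H \<in> carrier_mat k m"
    using P X Y Hc by auto
  have "P * X * (P * X)\<^sup>T = P * (X * X\<^sup>T) * P\<^sup>T"
    using P X by (intro mat_eq_by_vecI[of _ k k]) (auto simp: mat_action_simps)
  also have "\<dots> = - (P * A0 * P\<^sup>T)"
    unfolding eqs using P A0 by (intro mat_eq_by_vecI[of _ k k]) (auto simp: mat_action_simps)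
  finally show "P * X * Q * (P * X * Q)\<^sup>T = - A0" using gram_right_mult[OF PX PX Q] PA0 by simp
  have YS: "P * Y + S \<in> carrier_mat k m" using PY S by auto
  have "phi (P * X * Q) ((P * Y + S + P * H) * Q) = phi (P * X) (P * Y + S + P * H)"
    using YS PH by (intro phi_right_mult[OF PX _ Q]) auto
  also have "\<dots> = phi (P * X) (P * Y) + phi (P * X) S + phi (P * X) (P * H)"
    using phi_linear(1)[OF PX YS PH] phi_linear(1)[OF PX PY S(1)] by simp
  also have "\<dots> = P * (- A1) * P\<^sup>T + (P * A1 * P\<^sup>T - A1) + P * 0\<^sub>m k k * P\<^sup>T"
    by (simp only: phi_left_mult[OF X Y P] phi_left_mult[OF X Hc P] eqs(2) S(2) phiH)
  also have "\<dots> = - A1"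
    using A1 P by (intro mat_eq_by_vecI[of _ k k])
      (auto intro!: eq_vecI simp: mat_action_simps simp del: index_mult_mat_vec)
  finally show "phi (P * X * Q) ((P * Y + S + P * H) * Q) = - A1" .
qed

theorem theorem5p6:
  fixes C :: "'a::{field,finite} dual vec set"
    and G :: "'a dual mat"
    and A0 A1 Xs Ys :: "'a mat"
    and n k m :: nat
  assumes "linear_code n C"
    and "generator_matrix n k C G"
    and "A0 \<in> carrier_mat k k" and "A1 \<in> carrier_mat k k"
    and "G * transpose_mat G = dual_mat A0 A1"
    and "nu (G * transpose_mat G) = enat m" and "m > 0"
    and "Xs \<in> carrier_mat k m" and "Ys \<in> carrier_mat k m"
    and "shortest_self_orthogonal_embedding G (generated_code (hblock G (dual_mat Xs Ys)))"
  shows "(\<forall>P\<in>Gamma_set k A0 A1 Xs. \<exists>S\<in>carrier_mat k m.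
            phi (P * Xs) S = P * A1 * transpose_mat P - A1) \<and>
         (\<forall>S :: 'a mat \<Rightarrow> 'a mat.
            (\<forall>P\<in>Gamma_set k A0 A1 Xs. S P \<in> carrier_mat k m \<and>
               phi (P * Xs) (S P) = P * A1 * transpose_mat P - A1) \<longrightarrow>
            (\<forall>C'. shortest_self_orthogonal_embedding G C' \<longleftrightarrow>
               (\<exists>P\<in>Gamma_set k A0 A1 Xs. \<exists>H\<in>ker_phi Xs. \<exists>Q\<in>orthogonal_group m.
                  C' = generated_code
                    (hblock G (dual_mat (P * Xs) (P * Ys + S P + P * H) * map_mat scal Q)))))"
proof -
  have G: "G \<in> carrier_mat k n" using assms(2) by (simp add: generator_matrix_def)
  note A = assms(3,4) and GG = assms(5) and m = assms(7) and X = assms(8) and Y = assms(9)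
  note shortest = shortest_self_orthogonal_embeddings[OF G dual_mat_carrier[OF X Y] assms(10)]
  note iff = gram_condition_iff[OF A GG]
  have eqs: "Xs * Xs\<^sup>T = - A0" "phi Xs Ys = - A1" using shortest(1) iff[OF X Y] by auto
  \<comment> \<open>Minimality is used only against \<open>m - 1\<close> columns, which are fewer
    than \<open>m\<close> because \<open>m > 0\<close>.\<close>
  have min: "\<not> (Z * Z\<^sup>T = - A0 \<and> phi Z W = - A1)"
    if "Z \<in> carrier_mat k (m - 1)" "W \<in> carrier_mat k (m - 1)" for Z W
    using shortest(2)[OF dual_mat_carrier[OF that]] iff[OF that] m by auto
  show ?thesis
  proof (intro conjI ballI allI impI)
    fix P assume "P \<in> Gamma_set k A0 A1 Xs"
    then show "\<exists>S\<in>carrier_mat k m. phi (P * Xs) S = P * A1 * P\<^sup>T - A1"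
      by (rule Gamma_set_phi_solvable[OF X Y A eqs(2)])
  next
    fix S :: "'a mat \<Rightarrow> 'a mat" and C'
    assume S: "\<forall>P\<in>Gamma_set k A0 A1 Xs. S P \<in> carrier_mat k m \<and> phi (P * Xs) (S P) = P * A1 * P\<^sup>T - A1"
    \<comment> \<open>A matrix with entries from the field multiplies both components separately, so
      \<open>Q\<close> may be moved inside \<open>dual_mat\<close>.\<close>
    have block: "dual_mat (P * Xs) (P * Ys + S P + P * H) * map_mat scal Q
        = dual_mat (P * Xs * Q) ((P * Ys + S P + P * H) * Q)"
      and carrier: "P * Xs * Q \<in> carrier_mat k m" "(P * Ys + S P + P * H) * Q \<in> carrier_mat k m"
      if P: "P \<in> Gamma_set k A0 A1 Xs" and H: "H \<in> ker_phi Xs" and Q: "Q \<in> orthogonal_group m" for P H Q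
    proof -
      have "P \<in> general_linear_group k" using P by (simp add: Gamma_set_def)
      then have Pc: "P \<in> carrier_mat k k" by (rule general_linear_groupE)
      have Hc: "H \<in> carrier_mat k m" using H X by (simp add: ker_phi_def)
      have PX: "P * Xs \<in> carrier_mat k m" using Pc X by (rule mult_carrier_mat)
      have W: "P * Ys + S P + P * H \<in> carrier_mat k m"
        using Pc Hc by (intro add_carrier_mat mult_carrier_mat[OF Pc Hc])
      show "dual_mat (P * Xs) (P * Ys + S P + P * H) * map_mat scal Q
          = dual_mat (P * Xs * Q) ((P * Ys + S P + P * H) * Q)"
        by (rule dual_mat_mult_scal[OF PX W orthogonal_group_carrier[OF Q]])
      show "P * Xs * Q \<in> carrier_mat k m" "(P * Ys + S P + P * H) * Q \<in> carrier_mat k m"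
        using PX W orthogonal_group_carrier[OF Q] by (auto intro: mult_carrier_mat)
    qed
    show "shortest_self_orthogonal_embedding G C' \<longleftrightarrow>
       (\<exists>P\<in>Gamma_set k A0 A1 Xs. \<exists>H\<in>ker_phi Xs. \<exists>Q\<in>orthogonal_group m.
          C' = generated_code (hblock G (dual_mat (P * Xs) (P * Ys + S P + P * H) * map_mat scal Q)))"
      (is "_ \<longleftrightarrow> ?R")
    proof
      assume "shortest_self_orthogonal_embedding G C'"
      then obtain D where D: "D \<in> carrier_mat k m" "C' = generated_code (hblock G D)" "G * G\<^sup>T + D * D\<^sup>T = 0\<^sub>m k k"
        unfolding shortest(3) by blast
      obtain X' Y' where X': "X' \<in> carrier_mat k m" and Y': "Y' \<in> carrier_mat k m" and DXY: "D = dual_mat X' Y'"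
        by (rule dual_mat_cases[OF D(1)])
      have eqs': "X' * X'\<^sup>T = - A0" "phi X' Y' = - A1" using D(3) iff[OF X' Y'] DXY by auto
      obtain P H Q where P: "P \<in> Gamma_set k A0 A1 Xs" and H: "H \<in> ker_phi Xs" and Q: "Q \<in> orthogonal_group m"
        and eq: "X' = P * Xs * Q" "Y' = (P * Ys + S P + P * H) * Q"
        using embedding_decomposition[OF X Y X' Y' m A eqs eqs' min, of S] S by blast
      have "D = dual_mat (P * Xs) (P * Ys + S P + P * H) * map_mat scal Q"
        unfolding DXY block[OF P H Q] eq ..
      then show ?R using P H Q D(2) by blast
    next
      assume ?R
      then obtain P H Q where P: "P \<in> Gamma_set k A0 A1 Xs" and H: "H \<in> ker_phi Xs" and Q: "Q \<in> orthogonal_group m"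
        and C': "C' = generated_code (hblock G (dual_mat (P * Xs) (P * Ys + S P + P * H) * map_mat scal Q))"
        by blast
      have SP: "S P \<in> carrier_mat k m" "phi (P * Xs) (S P) = P * A1 * P\<^sup>T - A1" using S P by auto
      show "shortest_self_orthogonal_embedding G C'"
        unfolding shortest(3) C' block[OF P H Q]
        using iff[OF carrier[OF P H Q]] embedding_composition[OF X Y A eqs P H Q SP] carrier[OF P H Q]
        by (intro bexI[of _ "dual_mat (P * Xs * Q) ((P * Ys + S P + P * H) * Q)"]) auto
    qed
  qed
qed

end
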